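(* For any $A\subset\mathbb R^n$, the set $A^r$ of inner $\alpha$-regular points of $A$ is Borel measurable.
   Context: Standing assumptions: $n\ge3$, $\alpha\in(0,2]$, and $\kappa_\alpha(x,y)=|x-y|^{\alpha-n}$ is the Riesz kernel on $\mathbb R^n$. $\mathfrak M^+$ denotes the cone of positive Radon measures $\mu$ on $\mathbb R^n$ whose potential $\kappa_\alpha\mu(x)=\int|x-z|^{\alpha-n}d\mu(z)$ is not identically $+\infty$. The energy of $\mu$ is $\|\mu\|_\alpha^2=\iint\kappa_\alpha\,d\mu\,d\mu$; $\mathcal E^+_\alpha(A)$ is the set of positive measures of finite energy concentrated on $A$. The inner capacity of $A\subset\mathbb R^n$ is defined by $1/c_\alpha(A)=\inf\{\|\mu\|_\alpha^2:\ \mu\in\mathcal E^+_\alpha(A),\ \mu(\mathbb R^n)=1\}$. "n.e. on $A$" means: for all points of $A$ except a subset of inner capacity zero. Inner balayage: for $\mu\in\mathfrak M^+$ and arbitrary $A$, $\mu^A$ is the unique measure in $\mathfrak M^+$ with $\kappa_\alpha\mu^A=\inf\{\kappa_\alpha\nu:\ \nu\in\mathfrak M^+,\ \kappa_\alpha\nu\ge\kappa_\alpha\mu \text{ n.e. on }A\}$ pointwise. $\varepsilon_y$ is the Dirac measure at $y$, $\varepsilon_y^A:=(\varepsilon_y)^A$, and $A^r:=\{y\in\mathbb R^n:\ \varepsilon_y^A=\varepsilon_y\}$. *)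

theory Defs
  imports "HOL-Probability.Probability"
begin

text \<open>Riesz kernel |x-y|^(alpha-n) on R^n, n = DIM('a), valued in [0,\<infinity>];
  since alpha \<le> 2 < n the exponent is negative and the kernel is +\<infinity> on the diagonal.\<close>
definition riesz_kernel :: "real \<Rightarrow> 'a::euclidean_space \<Rightarrow> 'a \<Rightarrow> ennreal" where
  "riesz_kernel \<alpha> x y =
     (if x = y then \<infinity> else ennreal (dist x y powr (\<alpha> - real DIM('a))))"

definition potential :: "real \<Rightarrow> 'a::euclidean_space measure \<Rightarrow> 'a \<Rightarrow> ennreal" where
  "potential \<alpha> \<mu> x = (\<integral>\<^sup>+ z. riesz_kernel \<alpha> x z \<partial>\<mu>)"

definition radon_measure :: "'a::euclidean_space measure \<Rightarrow> bool" where
  "radon_measure \<mu> \<longleftrightarrow> sets \<mu> = sets borel \<and> (\<forall>K. compact K \<longrightarrow> emeasure \<mu> K < \<infinity>)"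

definition Mplus :: "real \<Rightarrow> 'a::euclidean_space measure set" where
  "Mplus \<alpha> = {\<mu>. radon_measure \<mu> \<and> \<not> (\<forall>x. potential \<alpha> \<mu> x = \<infinity>)}"

definition energy :: "real \<Rightarrow> 'a::euclidean_space measure \<Rightarrow> ennreal" where
  "energy \<alpha> \<mu> = (\<integral>\<^sup>+ x. potential \<alpha> \<mu> x \<partial>\<mu>)"

definition concentrated_on :: "'a::euclidean_space measure \<Rightarrow> 'a set \<Rightarrow> bool" where
  "concentrated_on \<mu> A \<longleftrightarrow> (\<exists>N \<in> sets borel. - A \<subseteq> N \<and> emeasure \<mu> N = 0)"

definition finite_energy_on :: "real \<Rightarrow> 'a::euclidean_space set \<Rightarrow> 'a measure set" where
  "finite_energy_on \<alpha> A =
     {\<mu>. radon_measure \<mu> \<and> energy \<alpha> \<mu> < \<infinity> \<and> concentrated_on \<mu> A}"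

definition inner_capacity :: "real \<Rightarrow> 'a::euclidean_space set \<Rightarrow> ennreal" where
  "inner_capacity \<alpha> A =
     inverse (INF \<mu> \<in> {\<mu> \<in> finite_energy_on \<alpha> A. emeasure \<mu> UNIV = 1}. energy \<alpha> \<mu>)"

definition nearly_everywhere :: "real \<Rightarrow> 'a::euclidean_space set \<Rightarrow> ('a \<Rightarrow> bool) \<Rightarrow> bool" where
  "nearly_everywhere \<alpha> A P \<longleftrightarrow> (\<exists>E \<subseteq> A. inner_capacity \<alpha> E = 0 \<and> (\<forall>x \<in> A - E. P x))"

definition balayage :: "real \<Rightarrow> 'a::euclidean_space measure \<Rightarrow> 'a set \<Rightarrow> 'a measure" where
  "balayage \<alpha> \<mu> A =
     (THE \<nu>. \<nu> \<in> Mplus \<alpha> \<and>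
        (\<forall>x. potential \<alpha> \<nu> x =
              (INF \<nu>' \<in> {\<nu>' \<in> Mplus \<alpha>.
                   nearly_everywhere \<alpha> A (\<lambda>y. potential \<alpha> \<mu> y \<le> potential \<alpha> \<nu>' y)}.
                 potential \<alpha> \<nu>' x)))"

definition regular_points :: "real \<Rightarrow> 'a::euclidean_space set \<Rightarrow> 'a set" where
  "regular_points \<alpha> A = {y. balayage \<alpha> (return borel y) A = return borel y}"

end

theory Submission
  imports Defs
begin

text \<open>
  Write \<open>\<kappa>\<^sub>y\<close> for the kernel with pole \<open>y\<close>. Since \<open>\<epsilon>\<^sub>y\<close> is itself admissible in the infimum defining
  its balayage, \<open>y\<close> is irregular iff some \<open>\<nu>\<close> satisfies \<open>\<kappa>\<nu> \<ge> \<kappa>\<^sub>y\<close> n.e. on \<open>A\<close> but \<open>\<kappa>\<nu> < \<kappa>\<^sub>y\<close>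
  at some point. The set of such \<open>y\<close> is an \<open>F\<^sub>\<sigma>\<close>. Indeed the witness \<open>\<nu>\<close> can be taken to be a multiple of a
  probability measure with compact support, and the strict inequality at a point can be replaced by one
  between averages over one of countably many balls. For fixed mass, support, ball and gap
  the property passes to limits: a sequence \<open>\<nu>\<^sub>j\<close> of witnesses for \<open>y\<^sub>j \<rightarrow> y\<close> has a weakly convergent
  subsequence, the averages converge, and the inequality n.e. survives by Fatou's lemma, because a measure of finite
  energy charging a Borel set charges a compact subset on which its restriction has a continuous
  potential.

  The definite description in the definition of balayage is controlled by the uniqueness of potentials,
  which follows from the positive definiteness of the kernel, a mixture of Gaussian kernels.
\<close>

subsection \<open>The Riesz kernel\<close>

text \<open>Potentials are only lower semicontinuous, both in the point and under weak convergence
  of the measure, and this shapes the limit argument. For the inequality n.e. semicontinuity points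
  the wrong way, so the inequality is integrated against a measure with continuous potential, where
  weak convergence yields equality in the limit. For the strict inequality a countable supply of
  test points is wanted, but a point cannot be moved into a dense set while the potential may jump;
  averages over balls depend continuously on the centre. As A is arbitrary, "n.e. on A" is first
  turned into "a.e. for every measure of finite energy concentrated on A": the possibly
  nonmeasurable exceptional sets of a sequence of witnesses then need not be united, and the limit
  is taken for one measure at a time. Bounded mass and support are what makes a sequence of
  witnesses weakly compact, hence the reduction to multiples of probability measures on
  balls.\<close>

lemma riesz_kernel_commute: "riesz_kernel \<alpha> x y = riesz_kernel \<alpha> y x"
  by (simp add: riesz_kernel_def dist_commute)

locale riesz_exponent =
  fixes \<alpha> p :: real and T :: "'a::euclidean_space itself"
  assumes exponent_pos: "0 < \<alpha>" and p_pos: "0 < p" and p_eq: "p = real DIM('a) - \<alpha>"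
begin

abbreviation pot :: "'a measure \<Rightarrow> 'a \<Rightarrow> ennreal" where "pot \<equiv> potential \<alpha>"
abbreviation kern :: "'a \<Rightarrow> 'a \<Rightarrow> ennreal" where "kern \<equiv> riesz_kernel \<alpha>"

text \<open>As \<open>inverse 0 = \<infinity>\<close> in \<open>ennreal\<close>, one formula also
  covers the diagonal, and joint continuity of the kernel follows without a case
  distinction.\<close>

lemma kern_eq_inverse: "kern x y = inverse (ennreal (dist x y powr p))"
proof (cases "x = y")
  case False
  then have "inverse (ennreal (dist x y powr p)) = ennreal (dist x y powr (- p))"
    by (simp add: inverse_ennreal powr_minus)
  with False show ?thesis by (simp add: riesz_kernel_def p_eq)
qed (simp add: riesz_kernel_def)

lemma kern_off_diagonal: "x \<noteq> y \<Longrightarrow> kern x y = ennreal (dist x y powr (- p))"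
  by (simp add: riesz_kernel_def p_eq)

lemma continuous_kern: "continuous_on UNIV (\<lambda>q. kern (fst q) (snd q))"
  unfolding kern_eq_inverse using p_pos
  by (intro continuous_on_inverse_ennreal continuous_on_ennreal continuous_on_powr' continuous_intros) auto

lemma measurable_kern [measurable (raw)]:
  assumes "f \<in> borel_measurable M" "g \<in> borel_measurable M"
  shows "(\<lambda>x. kern (f x) (g x)) \<in> borel_measurable M"
proof -
  have k: "(\<lambda>q. kern (fst q) (snd q)) \<in> borel_measurable borel"
    by (rule borel_measurable_continuous_onI[OF continuous_kern])
  have "(\<lambda>x. (f x, g x)) \<in> borel_measurable M"
    using assms by (rule borel_measurable_Pair)
  from measurable_compose[OF this k] show ?thesis by simp
qed

lemma tendsto_kern:
  assumes "(f \<longlongrightarrow> x) F" "(g \<longlongrightarrow> y) F"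
  shows "((\<lambda>i. kern (f i) (g i)) \<longlongrightarrow> kern x y) F"
proof -
  have "isCont (\<lambda>q. kern (fst q) (snd q)) (x, y)"
    using continuous_kern by (simp add: continuous_on_eq_continuous_at)
  from isCont_tendsto_compose[OF this tendsto_Pair[OF assms]] show ?thesis by simp
qed

text \<open>Most geometric comparisons below go through this: a bound on the ratio of two distances
  becomes a constant factor between kernel values, the diagonal included.\<close>

lemma kern_scale_mono:
  assumes "0 < c" "dist x z \<le> c * dist x' z'"
  shows "kern x' z' \<le> ennreal (c powr p) * kern x z"
proof (cases "x = z")
  case True
  with assms show ?thesis by (simp add: riesz_kernel_def ennreal_mult_top)
next
  case False
  then have d: "0 < dist x z" by simp
  with assms have "0 < c * dist x' z'" by linarith
  with assms have d': "0 < dist x' z'" by (simp add: zero_less_mult_iff)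
  have "(c * dist x' z') powr (-p) \<le> dist x z powr (-p)"
    using assms d p_pos by (intro powr_mono2') auto
  then have "dist x' z' powr (-p) \<le> c powr p * dist x z powr (-p)"
    using assms d' by (simp add: powr_mult powr_minus field_simps)
  from ennreal_leI[OF this]
  have "ennreal (dist x' z' powr (-p)) \<le> ennreal (c powr p) * ennreal (dist x z powr (-p))"
    by (simp add: ennreal_mult')
  moreover from d' have "x' \<noteq> z'" by auto
  ultimately show ?thesis using False by (simp add: kern_off_diagonal[OF False] kern_off_diagonal[of x' z'])
qed

lemma measurable_potential [measurable]:
  assumes "sigma_finite_measure \<mu>" "sets \<mu> = sets borel"
  shows "pot \<mu> \<in> borel_measurable borel"
proof -
  interpret sigma_finite_measure \<mu> by fact
  have [measurable_cong]: "sets \<mu> = sets borel" by fact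
  show ?thesis unfolding potential_def by measurable
qed

lemma potential_scale: "pot (scale_measure (ennreal c) \<mu>) x = ennreal c * pot \<mu> x"
  if "sets \<mu> = sets borel"
proof -
  have [measurable_cong]: "sets \<mu> = sets borel" by fact
  show ?thesis unfolding potential_def by (rule nn_integral_scale_measure) measurable
qed

lemma potential_dirac: "pot (return borel y) x = kern x y"
  unfolding potential_def by (subst nn_integral_return) auto

text \<open>The reciprocity law: Tonelli's theorem and the symmetry of the kernel.\<close>

lemma nn_integral_potential_swap:
  assumes "sigma_finite_measure \<mu>" "sigma_finite_measure \<nu>" "sets \<mu> = sets borel" "sets \<nu> = sets borel"
  shows "(\<integral>\<^sup>+x. pot \<mu> x \<partial>\<nu>) = (\<integral>\<^sup>+x. pot \<nu> x \<partial>\<mu>)"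
proof -
  interpret \<mu>: sigma_finite_measure \<mu> by fact
  interpret \<nu>: sigma_finite_measure \<nu> by fact
  interpret pair_sigma_finite \<mu> \<nu> ..
  have [measurable_cong]: "sets \<mu> = sets borel" "sets \<nu> = sets borel" by fact+
  have "(\<integral>\<^sup>+x. (\<integral>\<^sup>+z. kern x z \<partial>\<mu>) \<partial>\<nu>) = (\<integral>\<^sup>+z. (\<integral>\<^sup>+x. kern x z \<partial>\<nu>) \<partial>\<mu>)"
    by (rule Fubini') measurable
  also have "\<dots> = (\<integral>\<^sup>+z. (\<integral>\<^sup>+x. kern z x \<partial>\<nu>) \<partial>\<mu>)"
    by (intro nn_integral_cong riesz_kernel_commute)
  finally show ?thesis unfolding potential_def .
qed

end

subsection \<open>Weak compactness of probability measures on balls\<close>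

text \<open>The digits are read off the orbit of x under the doubling map. The orbit stays in [0,1],
  so the remainder \<open>y m / 2 ^ m\<close> tends to 0; the point 1 is fixed and gets the digits
  1, 1, 1, ...\<close>

lemma binary_expansion:
  fixes x :: real
  assumes "0 \<le> x" "x \<le> 1"
  obtains a :: "nat \<Rightarrow> nat" where "\<And>k. a k \<le> 1" "(\<lambda>k. real (a k) / 2 ^ Suc k) sums x"
proof -
  define y where "y = rec_nat x (\<lambda>_ z. if z \<ge> 1/2 then 2 * z - 1 else 2 * z)"
  define a where "a k = (if y k \<ge> 1/2 then 1 else 0 :: nat)" for k
  have y_0: "y 0 = x" and y_Suc: "y (Suc k) = 2 * y k - real (a k)" for k
    by (simp_all add: y_def a_def)
  have y_bounds: "0 \<le> y k \<and> y k \<le> 1" for k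
  proof (induction k)
    case (Suc k)
    then show ?case by (auto simp: y_Suc a_def)
  qed (simp add: y_0 assms)
  have partial: "(\<Sum>k<m. real (a k) / 2 ^ Suc k) = x - y m / 2 ^ m" for m
    by (induction m) (auto simp: y_0 y_Suc field_simps)
  have "(\<lambda>m. y m / 2 ^ m) \<longlonglongrightarrow> 0"
  proof (rule tendsto_sandwich[of "\<lambda>_. 0" _ _ "\<lambda>m. (1/2) ^ m"])
    show "(\<lambda>m. (1/2) ^ m :: real) \<longlonglongrightarrow> 0" by (rule LIMSEQ_realpow_zero) auto
    show "\<forall>\<^sub>F m in sequentially. y m / 2 ^ m \<le> (1/2) ^ m"
      using y_bounds by (auto simp: field_simps power_divide)
    show "\<forall>\<^sub>F m in sequentially. 0 \<le> y m / 2 ^ m"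
      using y_bounds by auto
  qed (rule tendsto_const)
  then have "(\<lambda>m. x - y m / 2 ^ m) \<longlonglongrightarrow> x - 0" by (intro tendsto_intros)
  then have "(\<lambda>k. real (a k) / 2 ^ Suc k) sums x"
    unfolding sums_def partial by simp
  moreover have "a k \<le> 1" for k by (simp add: a_def)
  ultimately show ?thesis using that by blast
qed

text \<open>Schoenberg's function: it equals 0 on \<open>[0, 1/3]\<close> and 1 on \<open>[2/3, 1]\<close> modulo 2, so the
  values \<open>zigzag (3 ^ j * t)\<close> read off the ternary digits 0 and 2 of a point \<open>t\<close> of the Cantor set.\<close>
definition zigzag :: "real \<Rightarrow> real" where
  "zigzag t = max 0 (min 1 (1/2 - cos (pi * t)))"

lemma zigzag_bounds: "0 \<le> zigzag t" "zigzag t \<le> 1"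
  by (auto simp: zigzag_def)

lemma continuous_zigzag: "continuous_on UNIV zigzag"
  unfolding zigzag_def by (intro continuous_intros)

text \<open>The clamp of \<open>1/2 - cos\<close> is saturated where the cosine is at least 1/2 or
  at most -1/2, that is, on the outer thirds of [0,1]. Here \<open>2 * c\<close> is the leading
  ternary digit and \<open>s\<close> the remaining tail.\<close>

lemma zigzag_digit:
  fixes c :: nat
  assumes "c \<le> 1" "0 \<le> s" "s \<le> 1"
  shows "zigzag (2 * of_int m + (2 * real c + s) / 3) = real c"
proof -
  define r where "r = pi * ((2 * real c + s) / 3)"
  have *: "cos (pi * (2 * of_int m + (2 * real c + s) / 3)) = cos r"
  proof -
    have "pi * (2 * of_int m + (2 * real c + s) / 3) = r + 2 * pi * of_int m"
      by (simp add: r_def algebra_simps)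
    then show ?thesis by (simp only: cos_add cos_int_2pin sin_int_2pin mult_1_right mult_zero_right diff_0_right)
  qed
  consider "c = 0" | "c = 1" using assms by linarith
  then show ?thesis
  proof cases
    case 1
    then have "0 \<le> r" "r \<le> pi / 3" using assms by (auto simp: r_def)
    then have "cos (pi / 3) \<le> cos r"
      by (intro cos_monotone_0_pi_le) auto
    then show ?thesis using 1 * by (simp add: zigzag_def cos_60)
  next
    case 2
    then have r: "2 * pi / 3 \<le> r" "r \<le> pi" using assms by (auto simp: r_def field_simps)
    have "cos r \<le> cos (2 * pi / 3)"
      using r by (intro cos_monotone_0_pi_le) auto
    also have "\<dots> = - (1/2)" by (simp add: cos_120)
    finally show ?thesis using 2 * by (simp add: zigzag_def)
  qed
qed

lemma zigzag_prescribed_digits: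
  fixes c :: "nat \<Rightarrow> nat"
  assumes c: "\<And>j. c j \<le> 1"
  obtains t where "0 \<le> t" "t \<le> 1" "\<And>j. zigzag (3 ^ j * t) = real (c j)"
proof -
  define f where "f m k = 2 * real (c (k + m)) / 3 ^ Suc k" for m k
  define t where "t m = (\<Sum>k. f m k)" for m
  have g: "(\<lambda>k. 2 / 3 ^ Suc k :: real) sums 1"
  proof -
    have "(\<lambda>k. (2/3) * (1/3) ^ k :: real) sums ((2/3) * (1 / (1 - 1/3)))"
      by (intro sums_mult geometric_sums) auto
    then show ?thesis by (simp add: power_divide)
  qed
  have le: "0 \<le> f m k \<and> f m k \<le> 2 / 3 ^ Suc k" for m k
    using c[of "k + m"] by (auto simp: f_def divide_simps)
  have summ: "summable (f m)" for m
    by (rule summable_comparison_test'[OF sums_summable[OF g], of 0]) (use le in auto)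
  have t_bounds: "0 \<le> t m" "t m \<le> 1" for m
  proof -
    show "0 \<le> t m" unfolding t_def using le summ by (intro suminf_nonneg) auto
    have "t m \<le> (\<Sum>k. 2 / 3 ^ Suc k)"
      unfolding t_def using le summ sums_summable[OF g] by (intro suminf_le) auto
    then show "t m \<le> 1" using sums_unique[OF g] by simp
  qed
  have step: "t m = (2 * real (c m) + t (Suc m)) / 3" for m
  proof -
    have "t m = f m 0 + (\<Sum>k. f m (Suc k))"
      unfolding t_def using suminf_split_head[OF summ[of m]] by simp
    also have "(\<lambda>k. f m (Suc k)) = (\<lambda>k. f (Suc m) k / 3)"
      by (auto simp: f_def)
    also have "(\<Sum>k. f (Suc m) k / 3) = t (Suc m) / 3"
      unfolding t_def by (rule suminf_divide[OF summ])
    finally show ?thesis by (simp add: f_def)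
  qed
  \<comment> \<open>All ternary digits \<open>2 * c j\<close> are even, so the integer split off by
    multiplying with \<open>3 ^ j\<close> is even too, and the period 2 of \<open>zigzag\<close>
    removes it. What remains is the tail \<open>t j\<close>, whose leading digit is
    \<open>2 * c j\<close>.\<close>
  have pow: "\<exists>m::int. 3 ^ j * t 0 = 2 * of_int m + t j" for j
  proof (induction j)
    case (Suc j)
    then obtain m :: int where "3 ^ j * t 0 = 2 * of_int m + t j" by blast
    then have "3 ^ Suc j * t 0 = 3 * (2 * of_int m) + 3 * t j" by (simp add: algebra_simps)
    also have "\<dots> = 2 * of_int (3 * m + int (c j)) + t (Suc j)" by (subst step) simp
    finally show ?case by blast
  qed (auto intro: exI[of _ 0])
  show ?thesis
  proof (rule that[of "t 0"])
    fix j
    obtain m :: int where "3 ^ j * t 0 = 2 * of_int m + t j" using pow by blast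
    then have "3 ^ j * t 0 = 2 * of_int m + (2 * real (c j) + t (Suc j)) / 3" by (subst (asm) step) simp
    then show "zigzag (3 ^ j * t 0) = real (c j)"
      using zigzag_digit[OF c t_bounds] by metis
  qed (use t_bounds in auto)
qed

text \<open>Schoenberg's space-filling curve, scaled to the cube \<open>[-R, R]^n\<close> around the
  ball. Its coordinates are binary series in values of \<open>zigzag\<close>, continuous on the
  whole line as uniform limits. The curve reduces weak compactness in n dimensions to Helly's
  selection theorem on the line.\<close>

lemma cball_continuous_image_of_line:
  fixes R :: real
  assumes "0 < R"
  obtains g :: "real \<Rightarrow> 'a::euclidean_space" where "continuous_on UNIV g"
    "\<And>x. x \<in> cball 0 R \<Longrightarrow> \<exists>t. 0 \<le> t \<and> t \<le> 1 \<and> g t = x"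
proof -
  define n where "n = DIM('a)"
  have n: "0 < n" by (simp add: n_def)
  obtain idx :: "'a \<Rightarrow> nat" where idx: "bij_betw idx Basis {0..<n}"
    using ex_bij_betw_finite_nat[OF finite_Basis] unfolding n_def by blast
  have idx_less: "idx b < n" if "b \<in> Basis" for b
    using idx that by (auto simp: bij_betw_def)
  define X where "X i t = (\<Sum>k. zigzag (3 ^ (n * k + i) * t) / 2 ^ Suc k)" for i t
  have cont_X: "continuous_on UNIV (X i)" for i
  proof -
    have "uniform_limit UNIV (\<lambda>m t. \<Sum>k<m. zigzag (3 ^ (n * k + i) * t) / 2 ^ Suc k)
        (\<lambda>t. \<Sum>k. zigzag (3 ^ (n * k + i) * t) / 2 ^ Suc k) sequentially"
    proof (rule Weierstrass_m_test)
      show "norm (zigzag (3 ^ (n * k + i) * t) / 2 ^ Suc k) \<le> (1/2) ^ k" for k t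
        using zigzag_bounds[of "3 ^ (n * k + i) * t"]
        by (auto simp: power_divide field_simps intro: order_trans)
      show "summable (\<lambda>k. (1/2) ^ k :: real)" by (rule summable_geometric) auto
    qed
    then show ?thesis unfolding X_def[abs_def]
    proof (rule uniform_limit_theorem[rotated])
      show "\<forall>\<^sub>F m in sequentially. continuous_on UNIV (\<lambda>t. \<Sum>k<m. zigzag (3 ^ (n * k + i) * t) / 2 ^ Suc k)"
        by (intro always_eventually allI continuous_intros
          continuous_on_compose2[OF continuous_zigzag]) auto
    qed auto
  qed
  define g where "g t = (\<Sum>b\<in>Basis. (2 * R * X (idx b) t - R) *\<^sub>R b)" for t :: real
  have "continuous_on UNIV g" unfolding g_def
    by (intro continuous_intros continuous_on_compose2[OF cont_X]) auto
  moreover have "\<exists>t. 0 \<le> t \<and> t \<le> 1 \<and> g t = x" if x: "x \<in> cball 0 R" for x :: 'a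
  proof -
    have "\<exists>a::nat \<Rightarrow> nat. (\<forall>k. a k \<le> 1) \<and> (\<lambda>k. real (a k) / 2 ^ Suc k) sums ((x \<bullet> b + R) / (2 * R))"
      if b: "b \<in> Basis" for b
    proof -
      have "\<bar>x \<bullet> b\<bar> \<le> R" using Basis_le_norm[OF b, of x] x by (auto simp: dist_norm)
      then have "0 \<le> (x \<bullet> b + R) / (2 * R)" "(x \<bullet> b + R) / (2 * R) \<le> 1"
        using \<open>0 < R\<close> by (auto simp: field_simps)
      then show ?thesis using binary_expansion by metis
    qed
    then obtain a :: "'a \<Rightarrow> nat \<Rightarrow> nat" where a: "\<And>b k. b \<in> Basis \<Longrightarrow> a b k \<le> 1"
      "\<And>b. b \<in> Basis \<Longrightarrow> (\<lambda>k. real (a b k) / 2 ^ Suc k) sums ((x \<bullet> b + R) / (2 * R))"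
      by metis
    \<comment> \<open>One digit sequence stores all coordinates interleaved: position
      \<open>n * k + i\<close> holds the k-th binary digit of the i-th coordinate, which is where
      \<open>X i\<close> looks for it.\<close>
    define c where "c j = a (inv_into Basis idx (j mod n)) (j div n)" for j
    have "c j \<le> 1" for j
      unfolding c_def by (intro a inv_into_into) (use idx n in \<open>auto simp: bij_betw_def\<close>)
    then obtain t where t: "0 \<le> t" "t \<le> 1" "\<And>j. zigzag (3 ^ j * t) = real (c j)"
      using zigzag_prescribed_digits by metis
    have "X (idx b) t = (x \<bullet> b + R) / (2 * R)" if b: "b \<in> Basis" for b
    proof -
      have "c (n * k + idx b) = a b k" for k
        using idx_less[OF b] idx b by (simp add: c_def bij_betw_def inv_into_f_f)
      then have "X (idx b) t = (\<Sum>k. real (a b k) / 2 ^ Suc k)"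
        by (simp add: X_def t)
      then show ?thesis using sums_unique[OF a(2)[OF b]] by simp
    qed
    then have "g t = (\<Sum>b\<in>Basis. (x \<bullet> b) *\<^sub>R b)"
      unfolding g_def using \<open>0 < R\<close> by (intro sum.cong) auto
    then show ?thesis using t by (auto simp: euclidean_representation)
  qed
  ultimately show ?thesis using that by blast
qed

text \<open>The least preimage in [0,1] is a Borel section: its sublevel sets are images of compact
  intervals, hence closed, up to the complement of the whole image.\<close>

lemma borel_section_of_continuous:
  fixes g :: "real \<Rightarrow> 'a::{t2_space, second_countable_topology}"
  assumes g: "continuous_on UNIV g"
  obtains d :: "'a \<Rightarrow> real" where "d \<in> borel_measurable borel" "\<And>x. 0 \<le> d x \<and> d x \<le> 1"
    "\<And>x t. 0 \<le> t \<Longrightarrow> t \<le> 1 \<Longrightarrow> g t = x \<Longrightarrow> g (d x) = x"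
proof -
  define F where "F x = {t \<in> {0..1}. g t = x}" for x
  define d where "d x = (if F x = {} then 0 else Inf (F x))" for x
  have "compact (F x)" for x
  proof -
    have "closed (g -` {x})" by (rule closed_vimage) (use g in auto)
    then have "compact ({0..1} \<inter> g -` {x})" by (intro compact_Int_closed) auto
    then show ?thesis by (simp add: F_def vimage_def Int_def)
  qed
  then have inf: "Inf (F x) \<in> F x" if "F x \<noteq> {}" for x
    using that by (intro closed_contains_Inf compact_imp_closed bounded_imp_bdd_below compact_imp_bounded) auto
  have bdd: "bdd_below (F x)" for x
    by (auto simp: F_def bdd_below_def)
  \<comment> \<open>Off the image \<open>d\<close> has the default value 0, so the complement of the
    image joins as soon as \<open>0 \<le> s\<close>. For \<open>s < 0\<close> the interval is
    empty.\<close>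
  have img: "{x. d x \<le> s} = (g ` {0..min 1 s}) \<union> (if 0 \<le> s then - (g ` {0..1}) else {})" for s
  proof (intro set_eqI iffI)
    fix x assume x: "x \<in> {x. d x \<le> s}"
    show "x \<in> (g ` {0..min 1 s}) \<union> (if 0 \<le> s then - (g ` {0..1}) else {})"
    proof (cases "F x = {}")
      case True
      with x show ?thesis by (auto simp: d_def F_def)
    next
      case False
      with x have "Inf (F x) \<le> s" by (simp add: d_def)
      with inf[OF False] have "Inf (F x) \<in> {0..min 1 s}" "g (Inf (F x)) = x" by (simp_all add: F_def)
      then have "x \<in> g ` {0..min 1 s}" by (metis imageI)
      then show ?thesis by simp
    qed
  next
    fix x assume "x \<in> (g ` {0..min 1 s}) \<union> (if 0 \<le> s then - (g ` {0..1}) else {})"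
    then consider t where "x = g t" "0 \<le> t" "t \<le> 1" "t \<le> s" | "0 \<le> s" "x \<notin> g ` {0..1}"
      by (auto split: if_splits)
    then show "x \<in> {x. d x \<le> s}"
    proof cases
      case 1
      then have "t \<in> F x" by (auto simp: F_def)
      with 1 cInf_lower[OF this bdd] show ?thesis by (auto simp: d_def)
    next
      case 2
      then have "F x = {}" by (auto simp: F_def)
      with 2 show ?thesis by (auto simp: d_def)
    qed
  qed
  have comp: "compact (g ` {a..b})" for a b :: real
    by (rule compact_continuous_image[OF continuous_on_subset[OF g]]) auto
  have cl: "g ` {a..b} \<in> sets borel" for a b :: real
    by (rule borel_closed[OF compact_imp_closed[OF comp]])
  have "d \<in> borel_measurable borel"
  proof (rule borel_measurableI_le)
    fix s
    show "{x \<in> space borel. d x \<le> s} \<in> sets borel"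
      using cl by (simp add: img)
  qed
  moreover have "0 \<le> d x \<and> d x \<le> 1" for x
    using inf[of x] by (auto simp: d_def F_def)
  moreover have "g (d x) = x" if "0 \<le> t" "t \<le> 1" "g t = x" for x t
  proof -
    have "F x \<noteq> {}" using that by (auto simp: F_def)
    then show ?thesis using inf[of x] by (auto simp: d_def F_def)
  qed
  ultimately show ?thesis using that by blast
qed

text \<open>The measures are pushed to the line by a Borel section \<open>d\<close> of the curve
  \<open>g\<close>. There they live on [0,1], so they are tight and have a convergent subsequence,
  whose limit is pushed forward by \<open>g\<close>. Weak convergence survives although
  \<open>d\<close> may be discontinuous: test functions are composed with the continuous
  \<open>g\<close> only, and \<open>g (d x) = x\<close> on the ball.\<close>

lemma prob_weakly_compact_cball:
  fixes \<rho> :: "nat \<Rightarrow> 'a::euclidean_space measure" and R :: real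
  assumes "\<And>j. prob_space (\<rho> j)" "\<And>j. sets (\<rho> j) = sets borel" "\<And>j. AE x in \<rho> j. x \<in> cball 0 R"
  obtains r \<rho>' where "strict_mono (r :: nat \<Rightarrow> nat)" "prob_space \<rho>'" "sets \<rho>' = sets borel"
    "\<And>f :: 'a \<Rightarrow> real. continuous_on UNIV f \<Longrightarrow> bounded (range f) \<Longrightarrow>
       (\<lambda>j. \<integral>x. f x \<partial>\<rho> (r j)) \<longlonglongrightarrow> (\<integral>x. f x \<partial>\<rho>')"
proof -
  obtain g :: "real \<Rightarrow> 'a" where g: "continuous_on UNIV g"
    "\<And>x. x \<in> cball 0 (max R 1) \<Longrightarrow> \<exists>t. 0 \<le> t \<and> t \<le> 1 \<and> g t = x"
    by (rule cball_continuous_image_of_line[of "max R 1"]) auto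
  obtain d where d [measurable]: "d \<in> borel_measurable borel" and d01: "\<And>x. 0 \<le> d x \<and> d x \<le> 1"
    and gd: "\<And>x t. 0 \<le> t \<Longrightarrow> t \<le> 1 \<Longrightarrow> g t = x \<Longrightarrow> g (d x) = x"
    using borel_section_of_continuous[OF g(1)] by metis
  have [measurable]: "g \<in> borel_measurable borel" by (rule borel_measurable_continuous_onI[OF g(1)])
  have [measurable_cong]: "sets (\<rho> j) = sets borel" for j by fact
  define M where "M j = distr (\<rho> j) borel d" for j
  have M: "real_distribution (M j)" for j
    unfolding M_def real_distribution_def real_distribution_axioms_def
    by (auto intro!: prob_space.prob_space_distr assms)
  have "tight M"
    unfolding tight_def
  proof (intro conjI allI impI)
    fix e :: real assume "0 < e"
    \<comment> \<open>Tightness is phrased with intervals open on the left, so the left end lies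
      below 0 to keep a possible atom at 0.\<close>
    have "measure (M j) {-1<..1} = 1" for j
    proof -
      interpret real_distribution "M j" by (rule M)
      have "AE x in M j. x \<in> {-1<..1}"
        unfolding M_def by (subst AE_distr_iff) (auto intro!: always_eventually dest: d01[THEN conjunct1, THEN order_trans[of "-1", rotated]] simp: d01 intro: less_le_trans[of "-1" 0])
      then show ?thesis by (simp add: prob_eq_1)
    qed
    with \<open>0 < e\<close> show "\<exists>a b. a < b \<and> (\<forall>n. 1 - e < measure (M n) {a<..b})"
      by (intro exI[of _ "-1"] exI[of _ 1]) auto
  qed (rule M)
  from tight_imp_convergent_subsubsequence[OF this strict_mono_id]
  obtain r L where r: "strict_mono (r :: nat \<Rightarrow> nat)" and L: "real_distribution L"
    and conv: "weak_conv_m (M \<circ> r) L" by (auto simp: comp_def)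
  interpret L: real_distribution L by (rule L)
  show ?thesis
  proof (rule that[of r "distr L borel g"])
    show "prob_space (distr L borel g)" by (rule L.prob_space_distr) measurable
    fix f :: "'a \<Rightarrow> real" assume f: "continuous_on UNIV f" "bounded (range f)"
    have [measurable]: "f \<in> borel_measurable borel" by (rule borel_measurable_continuous_onI[OF f(1)])
    obtain B where B: "\<And>x. norm (f x) \<le> B" using f(2) by (auto simp: bounded_iff)
    have cont: "continuous_on UNIV (\<lambda>t. f (g t))"
      by (rule continuous_on_compose2[OF f(1) g(1)]) auto
    have "(\<lambda>j. \<integral>t. f (g t) \<partial>(M \<circ> r) j) \<longlonglongrightarrow> (\<integral>t. f (g t) \<partial>L)"
    proof (rule weak_conv_imp_integral_bdd_continuous_conv[OF _ L conv])
      show "isCont (\<lambda>t. f (g t)) x" for x using cont by (simp add: continuous_on_eq_continuous_at)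
    qed (use M B in auto)
    moreover have "(\<integral>t. f (g t) \<partial>(M \<circ> r) j) = (\<integral>x. f x \<partial>\<rho> (r j))" for j
    proof -
      have "(\<integral>t. f (g t) \<partial>(M \<circ> r) j) = (\<integral>x. f (g (d x)) \<partial>\<rho> (r j))"
        by (simp add: M_def integral_distr)
      also have "\<dots> = (\<integral>x. f x \<partial>\<rho> (r j))"
      proof (rule integral_cong_AE)
        show "AE x in \<rho> (r j). f (g (d x)) = f x"
          using assms(3)[of "r j"]
        proof (rule AE_mp, intro always_eventually allI impI)
          fix x assume "x \<in> cball (0::'a) R"
          then have "x \<in> cball 0 (max R 1)" by auto
          then show "f (g (d x)) = f x" using g(2) gd by metis
        qed
      qed measurable
      finally show ?thesis .
    qed
    ultimately show "(\<lambda>j. \<integral>x. f x \<partial>\<rho> (r j)) \<longlonglongrightarrow> (\<integral>x. f x \<partial>distr L borel g)"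
      by (simp add: integral_distr)
  qed (use r in auto)
qed

subsection \<open>Gaussian kernels\<close>

lemma AE_eq_of_nn_integral_eq:
  fixes f g :: "'b \<Rightarrow> ennreal"
  assumes [measurable]: "f \<in> borel_measurable M" "g \<in> borel_measurable M"
    and le: "AE x in M. f x \<le> g x" and eq: "(\<integral>\<^sup>+x. f x \<partial>M) = (\<integral>\<^sup>+x. g x \<partial>M)"
    and fin: "(\<integral>\<^sup>+x. f x \<partial>M) < \<infinity>"
  shows "AE x in M. f x = g x"
proof -
  have "(\<integral>\<^sup>+x. g x - f x \<partial>M) = (\<integral>\<^sup>+x. g x \<partial>M) - (\<integral>\<^sup>+x. f x \<partial>M)"
    using fin le by (intro nn_integral_diff) auto
  also have "\<dots> = 0" using eq fin by simp
  finally have "AE x in M. g x - f x = 0" by (subst (asm) nn_integral_0_iff_AE) auto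
  with le show ?thesis
  proof eventually_elim
    case (elim x)
    then show ?case by (meson antisym diff_eq_0_iff_ennreal ennreal_minus_eq_0)
  qed
qed

lemma nn_integral_lborel_translate:
  fixes f :: "'a::euclidean_space \<Rightarrow> ennreal"
  assumes [measurable]: "f \<in> borel_measurable borel"
  shows "(\<integral>\<^sup>+x. f (c + x) \<partial>lborel) = (\<integral>\<^sup>+x. f x \<partial>lborel)"
proof -
  have "(\<integral>\<^sup>+x. f x \<partial>lborel) = (\<integral>\<^sup>+x. f x \<partial>distr lborel borel ((+) c))"
    by (simp only: lborel_distr_plus)
  also have "\<dots> = (\<integral>\<^sup>+x. f (c + x) \<partial>lborel)"
    by (rule nn_integral_distr) auto
  finally show ?thesis ..
qed

lemma nn_integral_lborel_scale:
  fixes f :: "'a::euclidean_space \<Rightarrow> ennreal"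
  assumes [measurable]: "f \<in> borel_measurable borel" and "0 < c"
  shows "(\<integral>\<^sup>+x. f x \<partial>lborel) = ennreal (c ^ DIM('a)) * (\<integral>\<^sup>+x. f (z + c *\<^sub>R x) \<partial>lborel)"
proof -
  have "(\<integral>\<^sup>+x. f x \<partial>lborel) =
      (\<integral>\<^sup>+x. f x \<partial>density (distr lborel borel (\<lambda>x. z + c *\<^sub>R x)) (\<lambda>_. \<bar>c\<bar>^DIM('a)))"
    using \<open>0 < c\<close> by (subst lborel_affine[of c z]) auto
  also have "\<dots> = ennreal (c ^ DIM('a)) * (\<integral>\<^sup>+x. f (z + c *\<^sub>R x) \<partial>lborel)"
    using \<open>0 < c\<close> by (simp add: nn_integral_density nn_integral_distr nn_integral_cmult)
  finally show ?thesis .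
qed

definition gauss_kernel :: "real \<Rightarrow> 'a::euclidean_space \<Rightarrow> 'a \<Rightarrow> real" where
  "gauss_kernel t x z = exp (- t * (dist x z)\<^sup>2)"

text \<open>For t > 0 this is (pi/t)^(n/2). It stays symbolic and acts as a positive finite
  factor.\<close>

definition gauss_mass :: "'a::euclidean_space itself \<Rightarrow> real \<Rightarrow> ennreal" where
  "gauss_mass T t = (\<integral>\<^sup>+w. gauss_kernel t (0::'a) w \<partial>lborel)"

lemma gauss_kernel_commute: "gauss_kernel t x z = gauss_kernel t z x"
  by (simp add: gauss_kernel_def dist_commute)

lemma gauss_kernel_bounds: "0 < gauss_kernel t x z" "0 \<le> t \<Longrightarrow> gauss_kernel t x z \<le> 1"
  by (auto simp: gauss_kernel_def)

lemma measurable_gauss_kernel [measurable (raw)]: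
  assumes [measurable]: "f \<in> borel_measurable M" "g \<in> borel_measurable M" "h \<in> borel_measurable M"
  shows "(\<lambda>x. gauss_kernel (h x) (f x) (g x)) \<in> borel_measurable M"
  unfolding gauss_kernel_def by measurable

lemma nn_integral_gauss_kernel:
  fixes x :: "'a::euclidean_space"
  shows "(\<integral>\<^sup>+w. gauss_kernel t x w \<partial>lborel) = gauss_mass TYPE('a) t"
proof -
  have "(\<integral>\<^sup>+w. gauss_kernel t x w \<partial>lborel) = (\<integral>\<^sup>+w. gauss_kernel t x (x + w) \<partial>lborel)"
    by (rule nn_integral_lborel_translate[symmetric]) measurable
  then show ?thesis by (simp add: gauss_mass_def gauss_kernel_def dist_norm)
qed

lemma gauss_mass_finite:
  assumes "0 < t"
  shows "gauss_mass TYPE('a::euclidean_space) t < \<infinity>"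
proof -
  have 1: "(\<integral>\<^sup>+x. ennreal (exp (- t * x\<^sup>2)) \<partial>(lborel :: real measure)) < \<infinity>"
  proof -
    define sd where "sd = 1 / sqrt (2 * t)"
    have sd: "0 < sd" "2 * sd\<^sup>2 = 1 / t" using assms by (auto simp: sd_def power_divide)
    have "exp (- t * x\<^sup>2) = sqrt (2 * pi * sd\<^sup>2) * normal_density 0 sd x" for x
      using sd assms by (simp add: normal_density_def)
    moreover have "integrable lborel (\<lambda>x. sqrt (2 * pi * sd\<^sup>2) * normal_density 0 sd x)"
      using sd by (intro integrable_mult_right integrable_normal_density) auto
    ultimately have "integrable lborel (\<lambda>x. exp (- t * x\<^sup>2))" by simp
    then show ?thesis by (subst nn_integral_eq_integral) auto
  qed
  have "gauss_kernel t 0 w = (\<Prod>b\<in>Basis. exp (- t * (w \<bullet> b)\<^sup>2))" for w :: 'a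
  proof -
    have "(norm w)\<^sup>2 = (\<Sum>b\<in>Basis. (w \<bullet> b)\<^sup>2)"
      unfolding power2_norm_eq_inner by (subst euclidean_inner) (simp add: power2_eq_square)
    then show ?thesis
      by (simp add: gauss_kernel_def exp_sum[symmetric] sum_distrib_left sum_negf)
  qed
  then have "gauss_mass TYPE('a) t = (\<integral>\<^sup>+w. (\<Prod>b\<in>Basis. ennreal (exp (- t * (w \<bullet> b)\<^sup>2))) \<partial>(lborel :: 'a measure))"
    unfolding gauss_mass_def by (simp add: prod_ennreal)
  also have "\<dots> = (\<Prod>b\<in>(Basis::'a set). (\<integral>\<^sup>+x. ennreal (exp (- t * x\<^sup>2)) \<partial>lborel))"
    by (rule nn_integral_lborel_prod) auto
  also have "\<dots> < \<infinity>" using 1 by (simp add: power_less_top_ennreal)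
  finally show ?thesis .
qed

lemma gauss_mass_pos: "0 < gauss_mass TYPE('a::euclidean_space) t"
proof (rule ccontr)
  assume "\<not> 0 < gauss_mass TYPE('a) t"
  then have "gauss_mass TYPE('a) t = 0" by simp
  then have "AE w in (lborel :: 'a measure). ennreal (gauss_kernel t 0 w) = 0"
    unfolding gauss_mass_def by (subst (asm) nn_integral_0_iff_AE) auto
  then have "AE w in (lborel :: 'a measure). False"
  proof eventually_elim
    case (elim w)
    then show ?case using gauss_kernel_bounds(1)[of t 0 w] by simp
  qed
  then show False by (simp add: AE_iff_measurable[OF _ refl] emeasure_lborel_UNIV)
qed

text \<open>Completing the square in w: the product is a Gaussian of rate s + t about a weighted
  mean of x and z, times a factor that depends on x - z alone. The rate of that factor is harmonic:
  its reciprocal is 1/s + 1/t.\<close>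

lemma gauss_kernel_mult:
  fixes x z w :: "'a::euclidean_space"
  assumes "0 < s" "0 < t"
  shows "gauss_kernel t x w * gauss_kernel s w z =
    gauss_kernel (s * t / (s + t)) x z * gauss_kernel (s + t) ((t / (s + t)) *\<^sub>R x + (s / (s + t)) *\<^sub>R z) w"
proof -
  define m where "m = (t / (s + t)) *\<^sub>R x + (s / (s + t)) *\<^sub>R z"
  define e where "e = m - w"
  define v where "v = x - z"
  have N: "s + t \<noteq> 0" using assms by simp
  have st: "t / (s + t) = 1 - s / (s + t)" using N by (simp add: field_simps)
  have xw: "x - w = (s / (s + t)) *\<^sub>R v + e"
    unfolding e_def m_def v_def st by (simp add: algebra_simps)
  have wz: "w - z = (t / (s + t)) *\<^sub>R v - e"
    unfolding e_def m_def v_def st by (simp add: algebra_simps)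
  have sq: "(norm (a *\<^sub>R v + e))\<^sup>2 = a\<^sup>2 * (v \<bullet> v) + 2 * a * (v \<bullet> e) + e \<bullet> e"
    "(norm (a *\<^sub>R v - e))\<^sup>2 = a\<^sup>2 * (v \<bullet> v) - 2 * a * (v \<bullet> e) + e \<bullet> e" for a
    unfolding power2_norm_eq_inner
    by (simp_all add: inner_simps inner_commute power2_eq_square algebra_simps)
  \<comment> \<open>In terms of the offset \<open>e\<close> from the weighted mean, the mixed terms
    have opposite coefficients of size 2st/(s+t) and cancel.\<close>
  have "t * (norm (x - w))\<^sup>2 + s * (norm (w - z))\<^sup>2 =
      t * ((s / (s + t))\<^sup>2 * (v \<bullet> v) + 2 * (s / (s + t)) * (v \<bullet> e) + e \<bullet> e)
    + s * ((t / (s + t))\<^sup>2 * (v \<bullet> v) - 2 * (t / (s + t)) * (v \<bullet> e) + e \<bullet> e)"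
    unfolding xw wz sq ..
  also have "\<dots> = (t * (s / (s + t))\<^sup>2 + s * (t / (s + t))\<^sup>2) * (v \<bullet> v) + (s + t) * (e \<bullet> e)"
    by (simp add: algebra_simps)
  also have "t * (s / (s + t))\<^sup>2 + s * (t / (s + t))\<^sup>2 = s * t / (s + t)"
  proof -
    have "t * s\<^sup>2 + s * t\<^sup>2 = (s * t) * (s + t)" by (simp add: power2_eq_square algebra_simps)
    then have "(t * s\<^sup>2 + s * t\<^sup>2) / (s + t)\<^sup>2 = s * t / (s + t)"
      using N by (simp add: power2_eq_square)
    then show ?thesis by (simp add: power_divide add_divide_distrib)
  qed
  finally have eq: "t * (norm (x - w))\<^sup>2 + s * (norm (w - z))\<^sup>2 =
      s * t / (s + t) * (v \<bullet> v) + (s + t) * (e \<bullet> e)" .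
  have "gauss_kernel t x w * gauss_kernel s w z = exp (- (t * (norm (x - w))\<^sup>2 + s * (norm (w - z))\<^sup>2))"
    by (simp add: gauss_kernel_def dist_norm mult_exp_exp)
  also have "\<dots> = exp (- (s * t / (s + t) * (v \<bullet> v))) * exp (- ((s + t) * (e \<bullet> e)))"
    by (simp only: eq minus_add_distrib exp_add)
  also have "exp (- ((s + t) * (e \<bullet> e))) = gauss_kernel (s + t) m w"
    by (simp only: gauss_kernel_def dist_norm power2_norm_eq_inner e_def mult_minus_left)
  also have "exp (- (s * t / (s + t) * (v \<bullet> v))) = gauss_kernel (s * t / (s + t)) x z"
    by (simp only: gauss_kernel_def dist_norm power2_norm_eq_inner v_def mult_minus_left)
  finally show ?thesis unfolding m_def .
qed

lemma gauss_kernel_convolution: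
  fixes x z :: "'a::euclidean_space"
  assumes "0 < s" "0 < t"
  shows "(\<integral>\<^sup>+w. ennreal (gauss_kernel t x w) * ennreal (gauss_kernel s w z) \<partial>lborel) =
    gauss_mass TYPE('a) (s + t) * ennreal (gauss_kernel (s * t / (s + t)) x z)"
proof -
  define m where "m = (t / (s + t)) *\<^sub>R x + (s / (s + t)) *\<^sub>R z"
  have "(\<integral>\<^sup>+w. ennreal (gauss_kernel t x w) * ennreal (gauss_kernel s w z) \<partial>lborel) =
      (\<integral>\<^sup>+w. ennreal (gauss_kernel (s * t / (s + t)) x z) * ennreal (gauss_kernel (s + t) m w) \<partial>lborel)"
    using gauss_kernel_mult[OF assms, of x _ z] gauss_kernel_bounds(1)
    by (intro nn_integral_cong)
      (simp only: m_def ennreal_mult'[symmetric, OF less_imp_le[OF gauss_kernel_bounds(1)]])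
  also have "\<dots> = ennreal (gauss_kernel (s * t / (s + t)) x z) * gauss_mass TYPE('a) (s + t)"
    by (subst nn_integral_cmult) (auto simp: nn_integral_gauss_kernel)
  finally show ?thesis by (simp add: mult.commute)
qed

text \<open>Rescaling the Gamma integral by r. With b = p/2 and r = |x - z|^2 it presents the Riesz
  kernel as a positive superposition of Gaussians, the source of its positive definiteness.\<close>

lemma Gamma_subordination:
  assumes "0 < b" "0 < r"
  shows "(\<integral>\<^sup>+t. ennreal (indicator {0<..} t * t powr (b - 1) * exp (- t * r)) \<partial>lborel)
    = ennreal (Gamma b) * ennreal (r powr (- b))"
proof -
  have "ennreal (Gamma b) = (\<integral>\<^sup>+t. ennreal (indicator {0..} t * t powr (b - 1) / exp t) \<partial>lborel)"
    by (rule Gamma_conv_nn_integral_real[OF \<open>0 < b\<close>])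
  also have "\<dots> = \<bar>r\<bar> * (\<integral>\<^sup>+t. ennreal (indicator {0..} (0 + r * t) * (0 + r * t) powr (b - 1) / exp (0 + r * t)) \<partial>lborel)"
    using \<open>0 < r\<close> by (intro nn_integral_real_affine) auto
  also have "(\<integral>\<^sup>+t. ennreal (indicator {0..} (0 + r * t) * (0 + r * t) powr (b - 1) / exp (0 + r * t)) \<partial>lborel)
      = (\<integral>\<^sup>+t. ennreal (r powr (b - 1)) * ennreal (indicator {0<..} t * t powr (b - 1) * exp (- t * r)) \<partial>lborel)"
  proof (intro nn_integral_cong)
    fix t
    have "indicator {0..} (0 + r * t) * (0 + r * t) powr (b - 1) / exp (0 + r * t)
      = r powr (b - 1) * (indicator {0<..} t * t powr (b - 1) * exp (- t * r))"
      using \<open>0 < r\<close>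
      by (cases "t = 0") (auto simp: indicator_def powr_mult zero_le_mult_iff exp_minus field_simps)
    then show "ennreal (indicator {0..} (0 + r * t) * (0 + r * t) powr (b - 1) / exp (0 + r * t))
      = ennreal (r powr (b - 1)) * ennreal (indicator {0<..} t * t powr (b - 1) * exp (- t * r))"
      by (simp add: ennreal_mult')
  qed
  also have "\<dots> = ennreal (r powr (b - 1)) * (\<integral>\<^sup>+t. ennreal (indicator {0<..} t * t powr (b - 1) * exp (- t * r)) \<partial>lborel)"
    by (rule nn_integral_cmult) auto
  finally have "ennreal (Gamma b) * ennreal (r powr (- b)) =
      ennreal (\<bar>r\<bar> * r powr (b - 1) * r powr (- b)) * (\<integral>\<^sup>+t. ennreal (indicator {0<..} t * t powr (b - 1) * exp (- t * r)) \<partial>lborel)"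
    by (simp add: ennreal_mult' mult_ac)
  also have "\<bar>r\<bar> * r powr (b - 1) * r powr (- b) = 1"
    using \<open>0 < r\<close> by (simp add: powr_diff powr_minus)
  finally show ?thesis by simp
qed

lemma finite_measure_eqI_continuous:
  fixes \<mu> \<nu> :: "'a::metric_space measure"
  assumes "finite_measure \<mu>" "finite_measure \<nu>" and sets: "sets \<mu> = sets borel" "sets \<nu> = sets borel"
    and eq: "\<And>f :: 'a \<Rightarrow> real. continuous_on UNIV f \<Longrightarrow> (\<And>x. 0 \<le> f x \<and> f x \<le> 1) \<Longrightarrow>
      (\<integral>x. f x \<partial>\<mu>) = (\<integral>x. f x \<partial>\<nu>)"
  shows "\<mu> = \<nu>"
proof -
  interpret \<mu>: finite_measure \<mu> by fact
  interpret \<nu>: finite_measure \<nu> by fact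
  have [measurable_cong]: "sets \<mu> = sets borel" "sets \<nu> = sets borel" by fact+
  have closed_eq: "measure \<mu> C = measure \<nu> C" if C: "closed C" for C
  \<comment> \<open>The distance \<open>infdist\<close> to the empty set is 0 by convention, so the
    approximating functions would be constantly 1 there.\<close>
  proof (cases "C = {}")
    case False
    define f where "f k x = max 0 (1 - real k * infdist x C)" for k :: nat and x
    have cont: "continuous_on UNIV (f k)" for k unfolding f_def by (intro continuous_intros)
    have [measurable]: "f k \<in> borel_measurable borel" for k by (rule borel_measurable_continuous_onI[OF cont])
    have [measurable]: "C \<in> sets borel" using C by auto
    have bound: "0 \<le> f k x \<and> f k x \<le> 1" for k x by (auto simp: f_def infdist_nonneg)
    have lim: "(\<lambda>k. f k x) \<longlonglongrightarrow> indicator C x" for x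
    proof (cases "x \<in> C")
      case True
      then have "f k x = 1" for k by (simp add: f_def)
      with True show ?thesis by simp
    next
      case x: False
      then have "0 < infdist x C" using C False
        by (simp add: in_closed_iff_infdist_zero infdist_pos_not_in_closed)
      then obtain K :: nat where K: "1 < real K * infdist x C" using ex_less_of_nat_mult by blast
      have "f k x = 0" if "k \<ge> K" for k
      proof -
        have "real K * infdist x C \<le> real k * infdist x C"
          using that by (intro mult_right_mono infdist_nonneg) auto
        with K show ?thesis by (simp add: f_def)
      qed
      then show ?thesis using x by (auto intro!: tendsto_eventually eventually_sequentiallyI[of K])
    qed
    have conv: "(\<lambda>k. \<integral>x. f k x \<partial>M) \<longlonglongrightarrow> measure M C"
      if "finite_measure M" and M [measurable_cong]: "sets M = sets borel" for M
    proof -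
      interpret M: finite_measure M by fact
      have "(\<lambda>k. \<integral>x. f k x \<partial>M) \<longlonglongrightarrow> (\<integral>x. indicator C x \<partial>M)"
        by (rule integral_dominated_convergence[where w="\<lambda>_. 1"]) (use lim bound in auto)
      moreover have "space M = UNIV" using sets_eq_imp_space_eq[OF M] by simp
      ultimately show ?thesis by simp
    qed
    show ?thesis
      using LIMSEQ_unique[OF conv[OF assms(1) sets(1)]] conv[OF assms(2) sets(2)] eq[OF cont bound] by simp
  qed auto
  show ?thesis
  proof (rule measure_eqI_generator_eq[where E="{C. closed C}" and \<Omega>=UNIV and A="\<lambda>_. UNIV"])
    show "Int_stable {C::'a set. closed C}" by (auto simp: Int_stable_def)
    show "sets \<mu> = sigma_sets UNIV {C. closed C}" "sets \<nu> = sigma_sets UNIV {C. closed C}"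
      using sets by (simp_all add: borel_eq_closed)
    show "emeasure \<mu> X = emeasure \<nu> X" if "X \<in> {C. closed C}" for X
      using closed_eq that by (simp add: \<mu>.emeasure_eq_measure \<nu>.emeasure_eq_measure)
    show "emeasure \<mu> UNIV \<noteq> \<infinity>" by simp
  qed auto
qed

section \<open>Gaussian smoothing of the Riesz kernel\<close>

context riesz_exponent
begin

lemma ball_borel [measurable]: "ball (z::'a) r \<in> sets borel"
  by simp

lemma AE_lborel_neq: "AE x in lborel. x \<noteq> (z::'a)"
  by (rule AE_I[of _ _ "{z}"]) auto

text \<open>Dyadic shells: where |x - z| is comparable to 2^(-k), the kernel is at most a constant
  times 2^(kp), while the ball has volume of order 2^(-kn). As p = n - \<alpha>, the resulting
  geometric series has ratio 2^(-\<alpha>).\<close>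

lemma kern_locally_integrable: "(\<integral>\<^sup>+x. kern x (z::'a) * indicator (ball z 1) x \<partial>lborel) < \<infinity>"
proof -
  let ?V = "unit_ball_vol (real DIM('a))"
  have "(\<integral>\<^sup>+x. kern x z * indicator (ball z 1) x \<partial>lborel) \<le>
     (\<integral>\<^sup>+x. (\<Sum>k. ennreal (((1/2) ^ Suc k) powr (- p)) * indicator (ball z ((1/2) ^ k)) x) \<partial>lborel)"
  proof (rule nn_integral_mono_AE)
    show "AE x in lborel. kern x z * indicator (ball z 1) x \<le>
      (\<Sum>k. ennreal (((1/2) ^ Suc k) powr (- p)) * indicator (ball z ((1/2) ^ k)) x)"
      using AE_lborel_neq[of z]
    proof eventually_elim
      case (elim x)
      show ?case
      proof (cases "x \<in> ball z 1")
        case True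
        then have d: "0 < dist x z" "dist x z < 1" using elim by (auto simp: dist_commute)
        obtain m where m: "(1/2) ^ m \<le> dist x z"
          using real_arch_pow_inv[OF d(1), of "1/2"] by (auto intro: less_imp_le)
        \<comment> \<open>The index of the shell that contains x. If it is 0, the outer bound is the
          assumption \<open>dist x z < 1\<close>.\<close>
        define k where "k = (LEAST k. (1/2) ^ Suc k \<le> dist x z)"
        have "(1/2) ^ Suc m \<le> dist x z"
          by (rule order_trans[OF power_decreasing m]) auto
        then have k: "(1/2) ^ Suc k \<le> dist x z" unfolding k_def by (rule LeastI)
        have "dist x z < (1/2) ^ k"
        proof (cases k)
          case (Suc j)
          then have "\<not> (1/2) ^ Suc j \<le> dist x z"
            using not_less_Least[of j "\<lambda>k. (1/2) ^ Suc k \<le> dist x z"] unfolding k_def by (metis lessI)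
          then show ?thesis by (simp add: Suc)
        qed (use d in simp)
        then have "x \<in> ball z ((1/2) ^ k)" by (simp add: dist_commute)
        moreover have "kern x z \<le> ennreal (((1/2) ^ Suc k) powr (- p))"
          using elim k p_pos by (simp add: kern_off_diagonal) (intro ennreal_leI powr_mono2', auto)
        ultimately have "kern x z * indicator (ball z 1) x \<le>
            ennreal (((1/2) ^ Suc k) powr (- p)) * indicator (ball z ((1/2) ^ k)) x"
          using True by simp
        also have "\<dots> \<le> (\<Sum>k. ennreal (((1/2) ^ Suc k) powr (- p)) * indicator (ball z ((1/2) ^ k)) x)"
        proof -
          define F where "F i = ennreal (((1/2) ^ Suc i) powr (- p)) * indicator (ball z ((1/2) ^ i)) x" for i
          have "(\<Sum>i\<in>{k}. F i) \<le> (\<Sum>i. F i)" by (rule sum_le_suminf) auto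
          then show ?thesis by (simp only: F_def[symmetric]) simp
        qed
        finally show ?thesis .
      qed simp
    qed
  qed
  also have "\<dots> = (\<Sum>k. (\<integral>\<^sup>+x. ennreal (((1/2) ^ Suc k) powr (- p)) * indicator (ball z ((1/2) ^ k)) x \<partial>lborel))"
    by (rule nn_integral_suminf) measurable
  also have "\<dots> = (\<Sum>k. ennreal (?V * 2 powr p * ((1/2) powr \<alpha>) ^ k))"
  proof (intro suminf_cong)
    fix k :: nat
    have "(\<integral>\<^sup>+x. ennreal (((1/2) ^ Suc k) powr (- p)) * indicator (ball z ((1/2) ^ k)) x \<partial>lborel)
      = ennreal (((1/2) ^ Suc k) powr (- p)) * ennreal (?V * ((1/2) ^ k) ^ DIM('a))"
      by (simp add: nn_integral_cmult emeasure_ball)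
    also have "\<dots> = ennreal (((1/2) ^ Suc k) powr (- p) * (?V * ((1/2) ^ k) ^ DIM('a)))"
      by (rule ennreal_mult'[symmetric]) simp
    also have "((1/2) ^ Suc k) powr (- p) * (?V * ((1/2) ^ k) ^ DIM('a)) = ?V * 2 powr p * ((1/2) powr \<alpha>) ^ k"
    proof -
      have "((1/2::real) ^ Suc k) powr (- p) = (1/2) powr (- p * real (Suc k))"
        by (simp only: powr_realpow[symmetric, of "1/2" "Suc k"] powr_powr mult.commute)
      moreover have "((1/2::real) ^ k) ^ DIM('a) = (1/2) powr (real k * real DIM('a))"
        by (simp add: powr_realpow[symmetric] powr_powr flip: power_mult)
      moreover have "((1/2::real) powr \<alpha>) ^ k = (1/2) powr (\<alpha> * real k)"
        by (simp add: powr_realpow[symmetric] powr_powr)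
      moreover have "(2::real) powr p = (1/2) powr (- p)"
        by (simp add: powr_minus powr_divide)
      moreover have "(1/2::real) powr (- p * real (Suc k)) * (1/2) powr (real k * real DIM('a)) = (1/2) powr (- p) * (1/2) powr (\<alpha> * real k)"
        by (simp add: p_eq algebra_simps flip: powr_add)
      ultimately show ?thesis by (simp add: mult_ac)
    qed
    finally show "(\<integral>\<^sup>+x. ennreal (((1/2) ^ Suc k) powr (- p)) * indicator (ball z ((1/2) ^ k)) x \<partial>lborel)
      = ennreal (?V * 2 powr p * ((1/2) powr \<alpha>) ^ k)" .
  qed
  also have "\<dots> < \<infinity>"
  proof -
    have "(1/2::real) powr \<alpha> < 1 powr \<alpha>" using exponent_pos by (intro powr_less_mono2) auto
    then have "summable (\<lambda>k. ?V * 2 powr p * ((1/2) powr \<alpha>) ^ k)"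
      by (intro summable_mult summable_geometric) simp
    then show ?thesis by (subst suminf_ennreal2) auto
  qed
  finally show ?thesis .
qed

lemma kern_translate: "kern (c + x) (c + z) = kern x z"
  by (simp add: riesz_kernel_def)

lemma nn_integral_kern_ball:
  "(\<integral>\<^sup>+x. kern x z * indicator (ball z r) x \<partial>lborel) = (\<integral>\<^sup>+x. kern x 0 * indicator (ball 0 r) x \<partial>lborel)"
proof -
  have "(\<integral>\<^sup>+x. kern (z + x) z * indicator (ball z r) (z + x) \<partial>lborel) = (\<integral>\<^sup>+x. kern x z * indicator (ball z r) x \<partial>lborel)"
    by (rule nn_integral_lborel_translate) measurable
  moreover have "kern (z + x) z * indicator (ball z r) (z + x) = kern x 0 * indicator (ball 0 r) x" for x
    using kern_translate[of z x 0] by (simp add: indicator_def dist_norm)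
  ultimately show ?thesis by simp
qed

lemma kern_subordination:
  assumes "x \<noteq> z"
  shows "(\<integral>\<^sup>+t. ennreal (indicator {0<..} t * t powr (p / 2 - 1)) * ennreal (gauss_kernel t x z) \<partial>lborel)
    = ennreal (Gamma (p / 2)) * kern x z"
proof -
  have "(\<integral>\<^sup>+t. ennreal (indicator {0<..} t * t powr (p / 2 - 1)) * ennreal (gauss_kernel t x z) \<partial>lborel)
     = (\<integral>\<^sup>+t. ennreal (indicator {0<..} t * t powr (p / 2 - 1) * exp (- t * (dist x z)\<^sup>2)) \<partial>lborel)"
    by (simp add: gauss_kernel_def ennreal_mult')
  also have "\<dots> = ennreal (Gamma (p / 2)) * ennreal (((dist x z)\<^sup>2) powr (- (p / 2)))"
    using p_pos assms by (intro Gamma_subordination) auto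
  also have "((dist x z)\<^sup>2) powr (- (p / 2)) = dist x z powr (- p)"
    using assms by (simp add: powr_powr flip: powr_numeral)
  finally show ?thesis using assms by (simp add: kern_off_diagonal)
qed

text \<open>A Dirac measure has infinite energy for the Riesz kernel itself. Energies are therefore
  compared after convolving the kernel with a Gaussian: the result is bounded and still a positive
  mixture of Gaussians.\<close>

definition smooth_kern :: "real \<Rightarrow> 'a \<Rightarrow> 'a \<Rightarrow> ennreal" where
  "smooth_kern s z w = (\<integral>\<^sup>+x. kern x z * ennreal (gauss_kernel s x w) \<partial>lborel)"

text \<open>The mixing density of the smoothed kernel, up to \<open>Gamma (p / 2)\<close>: the
  subordination density in t times the mass produced by convolving Gaussians of rates s and
  t.\<close>

definition weight :: "real \<Rightarrow> real \<Rightarrow> ennreal" where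
  "weight s t = ennreal (indicator {0<..} t * t powr (p / 2 - 1)) * gauss_mass TYPE('a) (s + t)"

lemma measurable_gauss_mass [measurable]: "gauss_mass TYPE('a) \<in> borel_measurable borel"
  unfolding gauss_mass_def by measurable

lemma measurable_weight [measurable]: "weight s \<in> borel_measurable borel"
  unfolding weight_def by measurable

lemma measurable_smooth_kern [measurable (raw)]:
  assumes [measurable]: "f \<in> borel_measurable M" "g \<in> borel_measurable M"
  shows "(\<lambda>x. smooth_kern s (f x) (g x)) \<in> borel_measurable M"
  unfolding smooth_kern_def by measurable

lemma smooth_kern_mixture:
  assumes "0 < s"
  shows "ennreal (Gamma (p / 2)) * smooth_kern s z w =
    (\<integral>\<^sup>+t. weight s t * ennreal (gauss_kernel (s * t / (s + t)) z w) \<partial>lborel)"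
proof -
  let ?u = "\<lambda>t. ennreal (indicator {0<..} t * t powr (p / 2 - 1))"
  have "ennreal (Gamma (p / 2)) * smooth_kern s z w =
      (\<integral>\<^sup>+x. ennreal (Gamma (p / 2)) * kern x z * ennreal (gauss_kernel s x w) \<partial>lborel)"
    unfolding smooth_kern_def by (simp add: nn_integral_cmult mult.assoc)
  also have "\<dots> = (\<integral>\<^sup>+x. (\<integral>\<^sup>+t. ?u t * ennreal (gauss_kernel t x z) * ennreal (gauss_kernel s x w) \<partial>lborel) \<partial>lborel)"
  \<comment> \<open>Subordination is stated off the diagonal; the pole is a Lebesgue null
    set.\<close>
  proof (rule nn_integral_cong_AE)
    show "AE x in lborel. ennreal (Gamma (p / 2)) * kern x z * ennreal (gauss_kernel s x w) =
      (\<integral>\<^sup>+t. ?u t * ennreal (gauss_kernel t x z) * ennreal (gauss_kernel s x w) \<partial>lborel)"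
      using AE_lborel_neq[of z]
    proof eventually_elim
      case (elim x)
      then show ?case by (subst nn_integral_multc) (simp_all add: kern_subordination)
    qed
  qed
  also have "\<dots> = (\<integral>\<^sup>+t. (\<integral>\<^sup>+x. ?u t * ennreal (gauss_kernel t x z) * ennreal (gauss_kernel s x w) \<partial>lborel) \<partial>lborel)"
    by (rule lborel_pair.Fubini') measurable
  also have "\<dots> = (\<integral>\<^sup>+t. weight s t * ennreal (gauss_kernel (s * t / (s + t)) z w) \<partial>lborel)"
  proof (intro nn_integral_cong)
    fix t
    show "(\<integral>\<^sup>+x. ?u t * ennreal (gauss_kernel t x z) * ennreal (gauss_kernel s x w) \<partial>lborel) =
      weight s t * ennreal (gauss_kernel (s * t / (s + t)) z w)"
    proof (cases "0 < t")
      case True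
      have "(\<integral>\<^sup>+x. ?u t * ennreal (gauss_kernel t x z) * ennreal (gauss_kernel s x w) \<partial>lborel)
        = ?u t * (\<integral>\<^sup>+x. ennreal (gauss_kernel t z x) * ennreal (gauss_kernel s x w) \<partial>lborel)"
        by (subst nn_integral_cmult[symmetric]) (simp_all add: mult.assoc gauss_kernel_commute[of t z])
      then show ?thesis using gauss_kernel_convolution[OF assms True, of z w]
        by (simp add: weight_def mult.assoc)
    qed (simp add: weight_def)
  qed
  finally show ?thesis .
qed

lemma Gamma_p: "0 < Gamma (p / 2)"
  using p_pos by (simp add: Gamma_real_pos)

text \<open>The definition treats the two arguments differently, but in the mixture the symmetry is
  visible.\<close>

lemma smooth_kern_commute:
  assumes "0 < s"
  shows "smooth_kern s z w = smooth_kern s w z"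
proof -
  have "ennreal (Gamma (p / 2)) * smooth_kern s z w = ennreal (Gamma (p / 2)) * smooth_kern s w z"
    unfolding smooth_kern_mixture[OF assms] by (simp add: gauss_kernel_commute)
  then show ?thesis using Gamma_p by (simp add: ennreal_mult_cancel_left)
qed

text \<open>Splitting at the unit ball about the pole: inside, the Gaussian is at most 1 and the
  kernel integrable; outside, the kernel is at most 1 and the Gaussian integrable. Translation
  invariance makes both bounds independent of z and w.\<close>

lemma smooth_kern_bounded:
  assumes "0 < s"
  obtains C where "C < \<infinity>" "\<And>z w. smooth_kern s z w \<le> C"
proof -
  let ?L = "\<integral>\<^sup>+x. kern x (0::'a) * indicator (ball 0 1) x \<partial>lborel"
  show ?thesis
  proof (rule that[of "?L + gauss_mass TYPE('a) s"])
    show "?L + gauss_mass TYPE('a) s < \<infinity>"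
      using kern_locally_integrable[of 0] gauss_mass_finite[OF assms, where 'a='a] by simp
    fix z w :: 'a
    have "smooth_kern s z w \<le> (\<integral>\<^sup>+x. kern x z * indicator (ball z 1) x + ennreal (gauss_kernel s w x) \<partial>lborel)"
      unfolding smooth_kern_def
    proof (intro nn_integral_mono)
      fix x
      have g1: "ennreal (gauss_kernel s x w) \<le> 1" using assms gauss_kernel_bounds(2)[of s x w] by simp
      show "kern x z * ennreal (gauss_kernel s x w) \<le> kern x z * indicator (ball z 1) x + ennreal (gauss_kernel s w x)"
      proof (cases "x \<in> ball z 1")
        case True
        have "kern x z * ennreal (gauss_kernel s x w) \<le> kern x z * 1" by (intro mult_left_mono g1) auto
        with True show ?thesis by (simp add: add_increasing2)
      next
        case False
        then have d: "1 \<le> dist x z" by (simp add: dist_commute)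
        then have "x \<noteq> z" by auto
        have "dist x z powr (- p) \<le> 1 powr (- p)" using d p_pos by (intro powr_mono2') auto
        then have "kern x z \<le> 1" using \<open>x \<noteq> z\<close> by (simp add: kern_off_diagonal)
        then have "kern x z * ennreal (gauss_kernel s x w) \<le> 1 * ennreal (gauss_kernel s x w)"
          by (intro mult_right_mono) auto
        with False show ?thesis by (simp add: gauss_kernel_commute)
      qed
    qed
    also have "\<dots> = ?L + gauss_mass TYPE('a) s"
      by (subst nn_integral_add) (simp_all add: nn_integral_gauss_kernel nn_integral_kern_ball[of z])
    finally show "smooth_kern s z w \<le> ?L + gauss_mass TYPE('a) s" .
  qed
qed

end

subsection \<open>Uniqueness of potentials\<close>

definition gauss_average :: "real \<Rightarrow> 'a::euclidean_space measure \<Rightarrow> 'a \<Rightarrow> ennreal" where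
  "gauss_average r \<nu> x = (\<integral>\<^sup>+z. ennreal (gauss_kernel r x z) \<partial>\<nu>)"

definition gauss_energy :: "real \<Rightarrow> 'a::euclidean_space measure \<Rightarrow> 'a measure \<Rightarrow> ennreal" where
  "gauss_energy r \<mu> \<nu> = (\<integral>\<^sup>+z. gauss_average r \<nu> z \<partial>\<mu>)"

lemma measurable_gauss_average:
  assumes "finite_measure \<nu>" "sets \<nu> = sets borel"
  shows "gauss_average r \<nu> \<in> borel_measurable borel"
proof -
  interpret finite_measure \<nu> by fact
  have [measurable_cong]: "sets \<nu> = sets borel" by fact
  show ?thesis unfolding gauss_average_def by measurable
qed

lemma gauss_average_finite:
  assumes "finite_measure \<nu>" "0 \<le> r"
  shows "gauss_average r \<nu> x < \<infinity>"
proof -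
  interpret finite_measure \<nu> by fact
  have "gauss_average r \<nu> x \<le> (\<integral>\<^sup>+z. 1 \<partial>\<nu>)"
    unfolding gauss_average_def using gauss_kernel_bounds(2)[OF assms(2)]
    by (intro nn_integral_mono) simp
  also have "\<dots> < \<infinity>" by (simp add: less_top[symmetric])
  finally show ?thesis .
qed

lemma gauss_energy_finite:
  assumes "finite_measure \<mu>" "finite_measure \<nu>" "0 \<le> r"
  shows "gauss_energy r \<mu> \<nu> < \<infinity>"
proof -
  interpret \<mu>: finite_measure \<mu> by fact
  interpret \<nu>: finite_measure \<nu> by fact
  have "gauss_average r \<nu> x \<le> (\<integral>\<^sup>+z. 1 \<partial>\<nu>)" for x
    unfolding gauss_average_def using gauss_kernel_bounds(2)[OF assms(3)]
    by (intro nn_integral_mono) simp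
  then have "gauss_energy r \<mu> \<nu> \<le> (\<integral>\<^sup>+z. emeasure \<nu> (space \<nu>) \<partial>\<mu>)"
    unfolding gauss_energy_def by (intro nn_integral_mono) simp
  also have "\<dots> < \<infinity>" by (simp add: ennreal_mult_eq_top_iff less_top[symmetric])
  finally show ?thesis .
qed

text \<open>Up to the factor \<open>gauss_mass TYPE('a) (4 * r)\<close>, the Gaussian of rate r is
  the convolution square of the one of rate 2r, since the harmonic rate of 2r and 2r is r. Gaussian
  energies thereby become inner products in L2.\<close>

lemma gauss_energy_square:
  fixes \<mu> \<nu> :: "'a::euclidean_space measure"
  assumes "finite_measure \<mu>" "sets \<mu> = sets borel" "finite_measure \<nu>" "sets \<nu> = sets borel" and r: "0 < r"
  shows "(\<integral>\<^sup>+x. gauss_average (2 * r) \<mu> x * gauss_average (2 * r) \<nu> x \<partial>lborel)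
    = gauss_mass TYPE('a) (4 * r) * gauss_energy r \<mu> \<nu>"
proof -
  interpret \<mu>: finite_measure \<mu> by fact
  interpret \<nu>: finite_measure \<nu> by fact
  interpret m: pair_sigma_finite \<mu> "lborel :: 'a measure" ..
  interpret n: pair_sigma_finite \<nu> "lborel :: 'a measure" ..
  have [measurable_cong]: "sets \<mu> = sets borel" "sets \<nu> = sets borel" by fact+
  have [measurable]: "gauss_average (2 * r) \<nu> \<in> borel_measurable borel"
    using assms by (intro measurable_gauss_average)
  have "(\<integral>\<^sup>+x. gauss_average (2 * r) \<mu> x * gauss_average (2 * r) \<nu> x \<partial>lborel)
     = (\<integral>\<^sup>+x. (\<integral>\<^sup>+z. ennreal (gauss_kernel (2 * r) x z) * gauss_average (2 * r) \<nu> x \<partial>\<mu>) \<partial>lborel)"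
    unfolding gauss_average_def by (simp add: nn_integral_multc)
  also have "\<dots> = (\<integral>\<^sup>+z. (\<integral>\<^sup>+x. ennreal (gauss_kernel (2 * r) x z) * gauss_average (2 * r) \<nu> x \<partial>lborel) \<partial>\<mu>)"
    by (rule m.Fubini') measurable
  also have "\<dots> = (\<integral>\<^sup>+z. (\<integral>\<^sup>+x. (\<integral>\<^sup>+w. ennreal (gauss_kernel (2 * r) x z) * ennreal (gauss_kernel (2 * r) x w) \<partial>\<nu>) \<partial>lborel) \<partial>\<mu>)"
    unfolding gauss_average_def by (simp add: nn_integral_cmult)
  also have "\<dots> = (\<integral>\<^sup>+z. (\<integral>\<^sup>+w. (\<integral>\<^sup>+x. ennreal (gauss_kernel (2 * r) x z) * ennreal (gauss_kernel (2 * r) x w) \<partial>lborel) \<partial>\<nu>) \<partial>\<mu>)"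
    by (intro nn_integral_cong n.Fubini') measurable
  also have "\<dots> = (\<integral>\<^sup>+z. (\<integral>\<^sup>+w. gauss_mass TYPE('a) (4 * r) * ennreal (gauss_kernel r z w) \<partial>\<nu>) \<partial>\<mu>)"
  proof (intro nn_integral_cong)
    fix z w :: 'a
    have "2 * r * (2 * r) / (2 * r + 2 * r) = r" using r by (simp add: field_simps)
    then show "(\<integral>\<^sup>+x. ennreal (gauss_kernel (2 * r) x z) * ennreal (gauss_kernel (2 * r) x w) \<partial>lborel)
      = gauss_mass TYPE('a) (4 * r) * ennreal (gauss_kernel r z w)"
      using gauss_kernel_convolution[of "2 * r" "2 * r" z w] r
      by (simp add: gauss_kernel_commute[of "2 * r" z])
  qed
  also have "\<dots> = gauss_mass TYPE('a) (4 * r) * gauss_energy r \<mu> \<nu>"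
    unfolding gauss_energy_def gauss_average_def by (simp add: nn_integral_cmult)
  finally show ?thesis .
qed

lemma ennreal_two_mult_le_squares:
  fixes a b :: ennreal
  assumes "a < \<infinity>" "b < \<infinity>"
  shows "2 * (a * b) \<le> a * a + b * b" "2 * (a * b) = a * a + b * b \<Longrightarrow> a = b"
proof -
  from assms obtain x where x: "a = ennreal x" "0 \<le> x" by (cases a) auto
  from assms obtain y where y: "b = ennreal y" "0 \<le> y" by (cases b) auto
  have eqs: "2 * (a * b) = ennreal (2 * (x * y))" "a * a + b * b = ennreal (x * x + y * y)"
    using x y by (simp_all add: ennreal_mult ennreal_plus)
  have sq: "x * x + y * y - 2 * (x * y) = (x - y)\<^sup>2" by (simp add: power2_eq_square algebra_simps)
  have le: "2 * (x * y) \<le> x * x + y * y" using sq zero_le_power2[of "x - y"] by linarith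
  then show "2 * (a * b) \<le> a * a + b * b" unfolding eqs by (rule ennreal_leI)
  assume "2 * (a * b) = a * a + b * b"
  then have "2 * (x * y) = x * x + y * y" unfolding eqs using x y by (subst (asm) ennreal_inj) auto
  with sq have "(x - y)\<^sup>2 = 0" by linarith
  then show "a = b" using x y by simp
qed

text \<open>This is nonnegativity of the Gaussian energy of \<mu> - \<nu>, phrased without
  subtraction to stay in \<open>ennreal\<close>. Up to a positive factor the defect is the squared
  L2 distance of the averages, so equality forces them to agree almost everywhere.\<close>

lemma gauss_energy_polarization:
  fixes \<mu> \<nu> :: "'a::euclidean_space measure"
  assumes fin: "finite_measure \<mu>" "finite_measure \<nu>" and sets: "sets \<mu> = sets borel" "sets \<nu> = sets borel"
    and r: "0 < r"
  shows "2 * gauss_energy r \<mu> \<nu> \<le> gauss_energy r \<mu> \<mu> + gauss_energy r \<nu> \<nu>"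
    and "2 * gauss_energy r \<mu> \<nu> = gauss_energy r \<mu> \<mu> + gauss_energy r \<nu> \<nu> \<Longrightarrow>
      AE x in lborel. gauss_average (2 * r) \<mu> x = gauss_average (2 * r) \<nu> x"
proof -
  let ?a = "gauss_average (2 * r) \<mu>" and ?b = "gauss_average (2 * r) \<nu>" and ?m = "gauss_mass TYPE('a) (4 * r)"
  have [measurable]: "?a \<in> borel_measurable borel" "?b \<in> borel_measurable borel"
    using fin sets by (auto intro: measurable_gauss_average)
  have ab: "?a x < \<infinity>" "?b x < \<infinity>" for x
    using gauss_average_finite[OF fin(1), of "2 * r" x] gauss_average_finite[OF fin(2), of "2 * r" x] r by simp_all
  have m: "0 < ?m" "?m < \<infinity>" using r gauss_mass_finite[of "4 * r", where 'a='a] by (auto intro!: gauss_mass_pos)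
  note sq = gauss_energy_square[OF _ _ _ _ r]
  have 1: "(\<integral>\<^sup>+x. 2 * (?a x * ?b x) \<partial>lborel) = ?m * (2 * gauss_energy r \<mu> \<nu>)"
    using sq[OF fin(1) sets(1) fin(2) sets(2)] by (subst nn_integral_cmult) (auto simp: mult.left_commute)
  have 2: "(\<integral>\<^sup>+x. ?a x * ?a x + ?b x * ?b x \<partial>lborel) = ?m * (gauss_energy r \<mu> \<mu> + gauss_energy r \<nu> \<nu>)"
    using sq[OF fin(1) sets(1) fin(1) sets(1)] sq[OF fin(2) sets(2) fin(2) sets(2)]
    by (simp add: nn_integral_add distrib_left)
  have "?m * (2 * gauss_energy r \<mu> \<nu>) \<le> ?m * (gauss_energy r \<mu> \<mu> + gauss_energy r \<nu> \<nu>)"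
    unfolding 1[symmetric] 2[symmetric]
    using ennreal_two_mult_le_squares(1)[OF ab] by (intro nn_integral_mono) auto
  then show "2 * gauss_energy r \<mu> \<nu> \<le> gauss_energy r \<mu> \<mu> + gauss_energy r \<nu> \<nu>"
    using m by (subst (asm) ennreal_mult_le_mult_iff) auto
  assume eq: "2 * gauss_energy r \<mu> \<nu> = gauss_energy r \<mu> \<mu> + gauss_energy r \<nu> \<nu>"
  have "AE x in lborel. 2 * (?a x * ?b x) = ?a x * ?a x + ?b x * ?b x"
  proof (rule AE_eq_of_nn_integral_eq)
    show "(\<integral>\<^sup>+x. 2 * (?a x * ?b x) \<partial>lborel) < \<infinity>"
      unfolding 1 using m gauss_energy_finite[OF fin less_imp_le[OF r]]
      by (simp add: ennreal_mult_less_top)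
  qed (use ennreal_two_mult_le_squares(1)[OF ab] 1 2 eq in auto)
  then show "AE x in lborel. ?a x = ?b x"
    by eventually_elim (rule ennreal_two_mult_le_squares(2)[OF ab])
qed

text \<open>Gaussians form an approximate identity: after substituting z + v / sqrt r, the factor
  sqrt(r)^n compensates the Jacobian and f is evaluated ever closer to z. Averages at large rates
  thus determine the measure.\<close>

lemma gauss_average_approximates:
  fixes f :: "'a::euclidean_space \<Rightarrow> real" and \<nu> :: "'a measure"
  assumes "finite_measure \<nu>" "sets \<nu> = sets borel" and cont: "continuous_on UNIV f"
    and f01: "\<And>x. 0 \<le> f x \<and> f x \<le> 1" and rpos: "\<And>k. 0 < r k" and rlim: "filterlim r at_top sequentially"
  shows "(\<lambda>k. ennreal (sqrt (r k) ^ DIM('a)) * (\<integral>\<^sup>+x. ennreal (f x) * gauss_average (r k) \<nu> x \<partial>lborel))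
    \<longlonglongrightarrow> gauss_mass TYPE('a) 1 * (\<integral>\<^sup>+x. ennreal (f x) \<partial>\<nu>)"
proof -
  interpret finite_measure \<nu> by fact
  interpret pair_sigma_finite \<nu> "lborel :: 'a measure" ..
  have [measurable_cong]: "sets \<nu> = sets borel" by fact
  have [measurable]: "f \<in> borel_measurable borel" by (rule borel_measurable_continuous_onI[OF cont])
  let ?F = "\<lambda>k z v. ennreal (f (z + (1 / sqrt (r k)) *\<^sub>R v)) * ennreal (gauss_kernel 1 0 v)"
  have eq: "ennreal (sqrt (r k) ^ DIM('a)) * (\<integral>\<^sup>+x. ennreal (f x) * gauss_average (r k) \<nu> x \<partial>lborel)
    = (\<integral>\<^sup>+z. (\<integral>\<^sup>+v. ?F k z v \<partial>lborel) \<partial>\<nu>)" for k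
  proof -
    have "(\<integral>\<^sup>+x. ennreal (f x) * gauss_average (r k) \<nu> x \<partial>lborel)
      = (\<integral>\<^sup>+x. (\<integral>\<^sup>+z. ennreal (f x) * ennreal (gauss_kernel (r k) x z) \<partial>\<nu>) \<partial>lborel)"
      unfolding gauss_average_def by (simp add: nn_integral_cmult)
    also have "\<dots> = (\<integral>\<^sup>+z. (\<integral>\<^sup>+x. ennreal (f x) * ennreal (gauss_kernel (r k) x z) \<partial>lborel) \<partial>\<nu>)"
      by (rule Fubini') measurable
    also have "\<dots> = (\<integral>\<^sup>+z. ennreal ((1 / sqrt (r k)) ^ DIM('a)) * (\<integral>\<^sup>+v. ?F k z v \<partial>lborel) \<partial>\<nu>)"
    proof (intro nn_integral_cong)
      fix z :: 'a
      have "(1 / sqrt (r k))\<^sup>2 = 1 / r k" using rpos[of k] by (simp add: power_divide)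
      then have g: "gauss_kernel (r k) (z + (1 / sqrt (r k)) *\<^sub>R v) z = gauss_kernel 1 0 v" for v :: 'a
        using rpos[of k] by (simp add: gauss_kernel_def dist_norm power_divide)
      have "(\<integral>\<^sup>+x. ennreal (f x) * ennreal (gauss_kernel (r k) x z) \<partial>lborel) = ennreal ((1 / sqrt (r k)) ^ DIM('a)) *
        (\<integral>\<^sup>+v. ennreal (f (z + (1 / sqrt (r k)) *\<^sub>R v)) * ennreal (gauss_kernel (r k) (z + (1 / sqrt (r k)) *\<^sub>R v) z) \<partial>lborel)"
        by (rule nn_integral_lborel_scale) (use rpos in auto)
      then show "(\<integral>\<^sup>+x. ennreal (f x) * ennreal (gauss_kernel (r k) x z) \<partial>lborel) =
          ennreal ((1 / sqrt (r k)) ^ DIM('a)) * (\<integral>\<^sup>+v. ?F k z v \<partial>lborel)" by (simp only: g)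
    qed
    also have "\<dots> = ennreal ((1 / sqrt (r k)) ^ DIM('a)) * (\<integral>\<^sup>+z. (\<integral>\<^sup>+v. ?F k z v \<partial>lborel) \<partial>\<nu>)"
      by (rule nn_integral_cmult) measurable
    finally have "ennreal (sqrt (r k) ^ DIM('a)) * (\<integral>\<^sup>+x. ennreal (f x) * gauss_average (r k) \<nu> x \<partial>lborel) =
      ennreal (sqrt (r k) ^ DIM('a) * (1 / sqrt (r k)) ^ DIM('a)) * (\<integral>\<^sup>+z. (\<integral>\<^sup>+v. ?F k z v \<partial>lborel) \<partial>\<nu>)"
      using rpos[of k] by (simp add: ennreal_mult' mult.assoc)
    also have "sqrt (r k) ^ DIM('a) * (1 / sqrt (r k)) ^ DIM('a) = 1"
      using rpos[of k] by (simp flip: power_mult_distrib)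
    finally show ?thesis by simp
  qed
  have F_le: "?F k z v \<le> ennreal (gauss_kernel 1 0 v)" for k z v
    using mult_right_mono[of "ennreal (f (z + (1 / sqrt (r k)) *\<^sub>R v))" 1] f01 by simp
  have inv: "(\<lambda>k. 1 / sqrt (r k)) \<longlonglongrightarrow> 0"
  proof -
    have "filterlim (\<lambda>k. sqrt (r k)) at_top sequentially"
      by (rule filterlim_compose[OF sqrt_at_top rlim])
    from tendsto_inverse_0_at_top[OF this] show ?thesis by (simp add: inverse_eq_divide)
  qed
  have mass: "(\<integral>\<^sup>+v. ennreal (gauss_kernel 1 (0::'a) v) \<partial>lborel) = gauss_mass TYPE('a) 1"
    by (simp add: gauss_mass_def)
  have inner: "(\<lambda>k. \<integral>\<^sup>+v. ?F k z v \<partial>lborel) \<longlonglongrightarrow> ennreal (f z) * gauss_mass TYPE('a) 1" for z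
  proof -
    have "(\<lambda>k. \<integral>\<^sup>+v. ?F k z v \<partial>lborel) \<longlonglongrightarrow> (\<integral>\<^sup>+v. ennreal (f z) * ennreal (gauss_kernel 1 (0::'a) v) \<partial>lborel)"
    proof (rule nn_integral_dominated_convergence[where w="\<lambda>v. ennreal (gauss_kernel 1 0 v)"])
      show "AE v in lborel. (\<lambda>k. ?F k z v) \<longlonglongrightarrow> ennreal (f z) * ennreal (gauss_kernel 1 0 v)"
      proof (intro always_eventually allI)
        fix v
        have "(\<lambda>k. z + (1 / sqrt (r k)) *\<^sub>R v) \<longlonglongrightarrow> z + 0 *\<^sub>R v" by (intro tendsto_intros inv)
        then have "(\<lambda>k. f (z + (1 / sqrt (r k)) *\<^sub>R v)) \<longlonglongrightarrow> f z"
          using continuous_on_tendsto_compose[OF cont, of _ z] by simp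
        then have "(\<lambda>k. ennreal (f (z + (1 / sqrt (r k)) *\<^sub>R v) * gauss_kernel 1 0 v)) \<longlonglongrightarrow> ennreal (f z * gauss_kernel 1 0 v)"
          by (intro tendsto_ennrealI tendsto_mult tendsto_const)
        then show "(\<lambda>k. ?F k z v) \<longlonglongrightarrow> ennreal (f z) * ennreal (gauss_kernel 1 0 v)"
          using f01 by (simp add: ennreal_mult')
      qed
      show "(\<integral>\<^sup>+v. ennreal (gauss_kernel 1 (0::'a) v) \<partial>lborel) < \<infinity>"
        unfolding mass by (rule gauss_mass_finite) simp
    qed (use F_le in auto)
    then show ?thesis by (simp add: nn_integral_cmult mass)
  qed
  have "(\<lambda>k. \<integral>\<^sup>+z. (\<integral>\<^sup>+v. ?F k z v \<partial>lborel) \<partial>\<nu>) \<longlonglongrightarrow> (\<integral>\<^sup>+z. ennreal (f z) * gauss_mass TYPE('a) 1 \<partial>\<nu>)"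
  proof (rule nn_integral_dominated_convergence[where w="\<lambda>_. gauss_mass TYPE('a) 1"])
    show "AE z in \<nu>. (\<integral>\<^sup>+v. ?F k z v \<partial>lborel) \<le> gauss_mass TYPE('a) 1" for k
      unfolding mass[symmetric] using F_le by (intro always_eventually allI nn_integral_mono) auto
    show "(\<integral>\<^sup>+z. gauss_mass TYPE('a) 1 \<partial>\<nu>) < \<infinity>"
      using gauss_mass_finite[of 1, where 'a='a] by (simp add: ennreal_mult_eq_top_iff less_top[symmetric])
    show "AE z in \<nu>. (\<lambda>k. \<integral>\<^sup>+v. ?F k z v \<partial>lborel) \<longlonglongrightarrow> ennreal (f z) * gauss_mass TYPE('a) 1"
      using inner by (intro always_eventually allI)
  qed measurable
  then show ?thesis unfolding eq by (simp add: nn_integral_multc mult.commute)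
qed

section \<open>Energies for the smoothed kernel and the uniqueness theorem\<close>

context riesz_exponent
begin

definition smooth_energy :: "real \<Rightarrow> 'a measure \<Rightarrow> 'a measure \<Rightarrow> ennreal" where
  "smooth_energy s \<mu> \<nu> = (\<integral>\<^sup>+z. (\<integral>\<^sup>+w. smooth_kern s z w \<partial>\<nu>) \<partial>\<mu>)"

lemma smooth_energy_commute:
  assumes "finite_measure \<mu>" "finite_measure \<nu>" "sets \<mu> = sets borel" "sets \<nu> = sets borel" "0 < s"
  shows "smooth_energy s \<mu> \<nu> = smooth_energy s \<nu> \<mu>"
proof -
  interpret \<mu>: finite_measure \<mu> by fact
  interpret \<nu>: finite_measure \<nu> by fact
  interpret pair_sigma_finite \<mu> \<nu> ..
  have [measurable_cong]: "sets \<mu> = sets borel" "sets \<nu> = sets borel" by fact+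
  have "smooth_energy s \<nu> \<mu> = (\<integral>\<^sup>+w. (\<integral>\<^sup>+z. smooth_kern s z w \<partial>\<mu>) \<partial>\<nu>)"
    unfolding smooth_energy_def by (intro nn_integral_cong smooth_kern_commute \<open>0 < s\<close>)
  also have "\<dots> = smooth_energy s \<mu> \<nu>"
    unfolding smooth_energy_def by (rule Fubini') measurable
  finally show ?thesis ..
qed

text \<open>Moving the Gaussian from the kernel onto \<nu> leaves \<mu> only through its potential,
  so measures with equal potentials have equal mutual energies with any third measure.\<close>

lemma smooth_energy_eq_potential:
  assumes "finite_measure \<mu>" "finite_measure \<nu>" "sets \<mu> = sets borel" "sets \<nu> = sets borel"
  shows "smooth_energy s \<mu> \<nu> = (\<integral>\<^sup>+x. pot \<mu> x * gauss_average s \<nu> x \<partial>lborel)"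
proof -
  interpret \<mu>: finite_measure \<mu> by fact
  interpret \<nu>: finite_measure \<nu> by fact
  interpret m: pair_sigma_finite \<mu> "lborel :: 'a measure" ..
  interpret n: pair_sigma_finite "lborel :: 'a measure" \<nu> ..
  have [measurable_cong]: "sets \<mu> = sets borel" "sets \<nu> = sets borel" by fact+
  have [measurable]: "gauss_average s \<nu> \<in> borel_measurable borel"
    using assms by (intro measurable_gauss_average)
  have "smooth_energy s \<mu> \<nu> = (\<integral>\<^sup>+z. (\<integral>\<^sup>+x. (\<integral>\<^sup>+w. kern x z * ennreal (gauss_kernel s x w) \<partial>\<nu>) \<partial>lborel) \<partial>\<mu>)"
    unfolding smooth_energy_def smooth_kern_def by (intro nn_integral_cong n.Fubini') measurable
  also have "\<dots> = (\<integral>\<^sup>+z. (\<integral>\<^sup>+x. kern x z * gauss_average s \<nu> x \<partial>lborel) \<partial>\<mu>)"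
    unfolding gauss_average_def by (simp add: nn_integral_cmult)
  also have "\<dots> = (\<integral>\<^sup>+x. (\<integral>\<^sup>+z. kern x z * gauss_average s \<nu> x \<partial>\<mu>) \<partial>lborel)"
    by (rule m.Fubini'[symmetric]) measurable
  also have "\<dots> = (\<integral>\<^sup>+x. pot \<mu> x * gauss_average s \<nu> x \<partial>lborel)"
    unfolding potential_def by (simp add: nn_integral_multc)
  finally show ?thesis .
qed

lemma smooth_energy_mixture:
  assumes "finite_measure \<mu>" "finite_measure \<nu>" "sets \<mu> = sets borel" "sets \<nu> = sets borel" "0 < s"
  shows "ennreal (Gamma (p / 2)) * smooth_energy s \<mu> \<nu> =
    (\<integral>\<^sup>+t. weight s t * gauss_energy (s * t / (s + t)) \<mu> \<nu> \<partial>lborel)"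
proof -
  interpret \<mu>: finite_measure \<mu> by fact
  interpret \<nu>: finite_measure \<nu> by fact
  interpret m: pair_sigma_finite \<mu> "lborel :: real measure" ..
  interpret n: pair_sigma_finite \<nu> "lborel :: real measure" ..
  have [measurable_cong]: "sets \<mu> = sets borel" "sets \<nu> = sets borel" by fact+
  let ?g = "\<lambda>t z w. weight s t * ennreal (gauss_kernel (s * t / (s + t)) z w)"
  have "ennreal (Gamma (p / 2)) * smooth_energy s \<mu> \<nu> =
      (\<integral>\<^sup>+z. (\<integral>\<^sup>+w. ennreal (Gamma (p / 2)) * smooth_kern s z w \<partial>\<nu>) \<partial>\<mu>)"
    unfolding smooth_energy_def by (simp add: nn_integral_cmult)
  also have "\<dots> = (\<integral>\<^sup>+z. (\<integral>\<^sup>+w. (\<integral>\<^sup>+t. ?g t z w \<partial>lborel) \<partial>\<nu>) \<partial>\<mu>)"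
    by (simp only: smooth_kern_mixture[OF \<open>0 < s\<close>])
  also have "\<dots> = (\<integral>\<^sup>+z. (\<integral>\<^sup>+t. (\<integral>\<^sup>+w. ?g t z w \<partial>\<nu>) \<partial>lborel) \<partial>\<mu>)"
    by (intro nn_integral_cong n.Fubini'[symmetric]) measurable
  also have "\<dots> = (\<integral>\<^sup>+t. (\<integral>\<^sup>+z. (\<integral>\<^sup>+w. ?g t z w \<partial>\<nu>) \<partial>\<mu>) \<partial>lborel)"
    by (intro m.Fubini'[symmetric]) measurable
  also have "\<dots> = (\<integral>\<^sup>+t. weight s t * gauss_energy (s * t / (s + t)) \<mu> \<nu> \<partial>lborel)"
    unfolding gauss_energy_def gauss_average_def by (simp add: nn_integral_cmult)
  finally show ?thesis .
qed

lemma smooth_energy_finite: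
  assumes "finite_measure \<mu>" "finite_measure \<nu>" "0 < s"
  shows "smooth_energy s \<mu> \<nu> < \<infinity>"
proof -
  interpret \<mu>: finite_measure \<mu> by fact
  interpret \<nu>: finite_measure \<nu> by fact
  obtain C where C: "C < \<infinity>" "\<And>z w. smooth_kern s z w \<le> C" using smooth_kern_bounded[OF \<open>0 < s\<close>] by blast
  have "smooth_energy s \<mu> \<nu> \<le> (\<integral>\<^sup>+z. (\<integral>\<^sup>+w. C \<partial>\<nu>) \<partial>\<mu>)"
    unfolding smooth_energy_def using C by (intro nn_integral_mono) auto
  also have "\<dots> < \<infinity>" using C by (simp add: ennreal_mult_eq_top_iff less_top[symmetric])
  finally show ?thesis .
qed

text \<open>Equal potentials make the three mutual energies of \<mu> and \<nu> coincide, so the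
  polarization inequality, integrated over the mixture, is an equality. The integral being finite,
  equality holds for almost every t, and the equality case gives agreement of the averages.\<close>

lemma gauss_averages_eq:
  assumes fin: "finite_measure \<mu>" "finite_measure \<nu>" and sets: "sets \<mu> = sets borel" "sets \<nu> = sets borel"
    and eq: "\<And>x. pot \<mu> x = pot \<nu> x" and s: "0 < s"
  shows "\<exists>r\<ge>s. AE x in lborel. gauss_average r \<mu> x = gauss_average r \<nu> x"
proof -
  interpret \<mu>: finite_measure \<mu> by fact
  interpret \<nu>: finite_measure \<nu> by fact
  have [measurable_cong]: "sets \<mu> = sets borel" "sets \<nu> = sets borel" by fact+
  let ?G = "ennreal (Gamma (p / 2))" and ?r = "\<lambda>t. s * t / (s + t)"
  let ?f = "\<lambda>t. weight s t * (2 * gauss_energy (?r t) \<mu> \<nu>)"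
  let ?g = "\<lambda>t. weight s t * (gauss_energy (?r t) \<mu> \<mu> + gauss_energy (?r t) \<nu> \<nu>)"
  have [measurable]: "(\<lambda>t. gauss_energy (?r t) \<mu> \<nu>) \<in> borel_measurable borel"
     "(\<lambda>t. gauss_energy (?r t) \<mu> \<mu>) \<in> borel_measurable borel"
     "(\<lambda>t. gauss_energy (?r t) \<nu> \<nu>) \<in> borel_measurable borel"
    unfolding gauss_energy_def gauss_average_def by measurable
  have E: "smooth_energy s \<mu> \<tau> = smooth_energy s \<nu> \<tau>" if "finite_measure \<tau>" "sets \<tau> = sets borel" for \<tau>
    using that fin sets eq by (simp add: smooth_energy_eq_potential)
  have E1: "smooth_energy s \<mu> \<mu> = smooth_energy s \<mu> \<nu>"
    using E[OF fin(1) sets(1)] smooth_energy_commute[OF fin sets s] by simp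
  have E2: "smooth_energy s \<nu> \<nu> = smooth_energy s \<mu> \<nu>" using E[OF fin(2) sets(2)] by simp
  have If: "(\<integral>\<^sup>+t. ?f t \<partial>lborel) = 2 * (?G * smooth_energy s \<mu> \<nu>)"
    unfolding smooth_energy_mixture[OF fin sets s] by (subst nn_integral_cmult[symmetric]) (measurable, simp add: mult.left_commute)
  have Ig: "(\<integral>\<^sup>+t. ?g t \<partial>lborel) = ?G * smooth_energy s \<mu> \<mu> + ?G * smooth_energy s \<nu> \<nu>"
    unfolding smooth_energy_mixture[OF fin(1,1) sets(1,1) s] smooth_energy_mixture[OF fin(2,2) sets(2,2) s]
    by (subst nn_integral_add[symmetric]) (simp_all add: distrib_left)
  have AE_eq: "AE t in lborel. ?f t = ?g t"
  proof (rule AE_eq_of_nn_integral_eq)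
    show "AE t in lborel. ?f t \<le> ?g t"
    proof (intro always_eventually allI)
      fix t :: real
      show "?f t \<le> ?g t"
      proof (cases "0 < t")
        case True
        then have "0 < ?r t" using s by simp
        then show ?thesis
          by (intro mult_left_mono gauss_energy_polarization(1) fin sets) auto
      qed (simp add: weight_def)
    qed
    show "(\<integral>\<^sup>+t. ?f t \<partial>lborel) = (\<integral>\<^sup>+t. ?g t \<partial>lborel)" unfolding If Ig E1 E2 by (simp add: mult_2)
    show "(\<integral>\<^sup>+t. ?f t \<partial>lborel) < \<infinity>"
      unfolding If using smooth_energy_finite[OF fin s] by (simp add: ennreal_mult_less_top)
  qed measurable
  have not_null: "\<not> (AE t in lborel. t \<notin> {s<..<s + 1 :: real})"
  proof
    assume "AE t in lborel. t \<notin> {s<..<s + 1 :: real}"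
    then have "emeasure lborel {s<..<s + 1 :: real} = 0"
      by (subst (asm) AE_iff_measurable[of "{s<..<s + 1}"]) auto
    then show False by simp
  qed
  \<comment> \<open>An interval of positive length meets every set of full measure. It starts at s
    because t > s makes the rate 2st/(s+t) of the averages at least s.\<close>
  have "\<exists>t\<in>{s<..<s + 1}. ?f t = ?g t"
  proof (rule ccontr)
    assume no: "\<not> ?thesis"
    have "AE t in lborel. t \<notin> {s<..<s + 1}" using AE_eq
    proof eventually_elim
      case (elim t)
      with no show ?case by blast
    qed
    with not_null show False by blast
  qed
  then obtain t where t: "s < t" and ft: "?f t = ?g t" by auto
  define r where "r = ?r t"
  have r: "0 < r" using s t by (simp add: r_def)
  have "s * (s + t) \<le> s * (2 * t)" using s t by (intro mult_left_mono) auto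
  then have "s \<le> 2 * r" using s t by (simp add: r_def field_simps)
  have "0 < weight s t" "weight s t < \<infinity>"
    using s t gauss_mass_pos[of "s + t", where 'a='a] gauss_mass_finite[of "s + t", where 'a='a]
    by (simp_all add: weight_def ennreal_zero_less_mult_iff ennreal_mult_less_top)
  with ft have "2 * gauss_energy r \<mu> \<nu> = gauss_energy r \<mu> \<mu> + gauss_energy r \<nu> \<nu>"
    unfolding r_def[symmetric] by (subst (asm) ennreal_mult_cancel_left) auto
  from gauss_energy_polarization(2)[OF fin sets r this] \<open>s \<le> 2 * r\<close> show ?thesis by blast
qed

text \<open>The averages agree at rates tending to infinity, and in the limit they recover the
  integrals of all test functions.\<close>

theorem potential_unique:
  assumes fin: "finite_measure \<mu>" "finite_measure \<nu>" and sets: "sets \<mu> = sets borel" "sets \<nu> = sets borel"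
    and eq: "\<And>x. pot \<mu> x = pot \<nu> x"
  shows "\<mu> = \<nu>"
proof (rule finite_measure_eqI_continuous[OF fin sets])
  fix f :: "'a \<Rightarrow> real" assume cont: "continuous_on UNIV f" and f01: "\<And>x. 0 \<le> f x \<and> f x \<le> 1"
  have [measurable]: "f \<in> borel_measurable borel" by (rule borel_measurable_continuous_onI[OF cont])
  have "\<forall>k. \<exists>r. real (Suc k) \<le> r \<and> (AE x in lborel. gauss_average r \<mu> x = gauss_average r \<nu> x)"
    using gauss_averages_eq[OF fin sets eq] by (metis of_nat_0_less_iff zero_less_Suc)
  then obtain r where r: "\<And>k. real (Suc k) \<le> r k"
    and r_eq: "\<And>k. AE x in lborel. gauss_average (r k) \<mu> x = gauss_average (r k) \<nu> x"
    by metis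
  have rpos: "0 < r k" for k using r[of k] by simp
  have rlim: "filterlim r at_top sequentially"
  proof (rule filterlim_at_top_mono[OF filterlim_real_sequentially])
    have "real k \<le> r k" for k using r[of k] by simp
    then show "\<forall>\<^sub>F k in sequentially. real k \<le> r k" by simp
  qed
  have [measurable]: "gauss_average (r k) \<mu> \<in> borel_measurable borel" "gauss_average (r k) \<nu> \<in> borel_measurable borel" for k
    using fin sets by (auto intro: measurable_gauss_average)
  have "(\<integral>\<^sup>+x. ennreal (f x) * gauss_average (r k) \<mu> x \<partial>lborel) = (\<integral>\<^sup>+x. ennreal (f x) * gauss_average (r k) \<nu> x \<partial>lborel)" for k
    by (rule nn_integral_cong_AE) (use r_eq[of k] in \<open>auto elim!: eventually_mono\<close>)
  with LIMSEQ_unique[OF gauss_average_approximates[OF fin(1) sets(1) cont f01 rpos rlim]]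
    gauss_average_approximates[OF fin(2) sets(2) cont f01 rpos rlim]
  have "gauss_mass TYPE('a) 1 * (\<integral>\<^sup>+x. ennreal (f x) \<partial>\<mu>) = gauss_mass TYPE('a) 1 * (\<integral>\<^sup>+x. ennreal (f x) \<partial>\<nu>)"
    by simp
  then have "(\<integral>\<^sup>+x. ennreal (f x) \<partial>\<mu>) = (\<integral>\<^sup>+x. ennreal (f x) \<partial>\<nu>)"
    using gauss_mass_pos[of 1, where 'a='a] gauss_mass_finite[of 1, where 'a='a]
    by (subst (asm) ennreal_mult_cancel_left) auto
  moreover have "f \<in> borel_measurable \<mu>" "f \<in> borel_measurable \<nu>"
    using sets by (simp_all cong: measurable_cong_sets)
  ultimately show "(\<integral>x. f x \<partial>\<mu>) = (\<integral>x. f x \<partial>\<nu>)"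
    using f01 by (simp add: integral_eq_nn_integral)
qed

end

subsection \<open>Measures with continuous potential\<close>

lemma radon_measure_sigma_finite:
  fixes \<mu> :: "'a::euclidean_space measure"
  assumes "radon_measure \<mu>"
  shows "sigma_finite_measure \<mu>"
proof
  have sets: "sets \<mu> = sets borel" and fin: "\<And>K. compact K \<Longrightarrow> emeasure \<mu> K < \<infinity>"
    using assms by (auto simp: radon_measure_def)
  have "(\<Union>n. cball (0::'a) (real n)) = UNIV" by (auto simp: real_arch_simple)
  then show "\<exists>C. countable C \<and> C \<subseteq> sets \<mu> \<and> \<Union>C = space \<mu> \<and> (\<forall>a\<in>C. emeasure \<mu> a \<noteq> \<infinity>)"
    using fin[OF compact_cball] sets sets_eq_imp_space_eq[OF sets]
    by (intro exI[of _ "range (\<lambda>n. cball 0 (real n))"]) (auto simp: less_top)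
qed

lemma emeasure_Int_cball_pos:
  fixes \<mu> :: "'a::euclidean_space measure"
  assumes "sets \<mu> = sets borel" "B \<in> sets borel" "0 < emeasure \<mu> B"
  obtains n :: nat where "0 < emeasure \<mu> (B \<inter> cball 0 (real n))"
proof (rule ccontr)
  assume no: "\<not> thesis"
  have B: "(\<Union>n. B \<inter> cball 0 (real n)) = B" by (auto simp: real_arch_simple)
  have "emeasure \<mu> (\<Union>n. B \<inter> cball 0 (real n)) = 0"
  proof (rule emeasure_UN_eq_0)
    show "emeasure \<mu> (B \<inter> cball 0 (real n)) = 0" for n
    proof (rule ccontr)
      assume "emeasure \<mu> (B \<inter> cball 0 (real n)) \<noteq> 0"
      then have "0 < emeasure \<mu> (B \<inter> cball 0 (real n))" by (simp add: zero_less_iff_neq_zero)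
      from no that[OF this] show False by (rule notE)
    qed
    show "range (\<lambda>n. B \<inter> cball 0 (real n)) \<subseteq> sets \<mu>"
      unfolding assms(1) by (intro image_subsetI sets.Int assms(2) borel_closed closed_cball)
  qed
  then show False using assms(3) unfolding B by simp
qed

context riesz_exponent
begin

text \<open>The Kato-type condition makes the potential a uniform limit of potentials of truncated kernels.\<close>

definition kato :: "'a measure \<Rightarrow> bool" where
  "kato \<mu> \<longleftrightarrow> (\<forall>\<epsilon>>0. \<exists>\<delta>>0. \<forall>x. (\<integral>\<^sup>+z. kern x z * indicator (ball x \<delta>) z \<partial>\<mu>) \<le> ennreal \<epsilon>)"

definition trunc :: "real \<Rightarrow> 'a \<Rightarrow> 'a \<Rightarrow> real" where
  "trunc \<delta> x z = max \<delta> (dist x z) powr (- p)"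

lemma trunc_bounds: "0 \<le> trunc \<delta> x z" "0 < \<delta> \<Longrightarrow> trunc \<delta> x z \<le> \<delta> powr (- p)"
  using p_pos by (auto simp: trunc_def intro!: powr_mono2')

lemma trunc_le_kern: "0 < \<delta> \<Longrightarrow> ennreal (trunc \<delta> x z) \<le> kern x z"
proof (cases "x = z")
  case False
  assume "0 < \<delta>"
  with False p_pos show ?thesis
    unfolding kern_off_diagonal[OF False] trunc_def by (intro ennreal_leI powr_mono2') auto
qed (simp add: riesz_kernel_def)

lemma kern_le_trunc:
  assumes "0 < \<delta>"
  shows "kern x z \<le> ennreal (trunc \<delta> x z) + kern x z * indicator (ball x \<delta>) z"
proof (cases "dist x z < \<delta>")
  case False
  with assms have "x \<noteq> z" by auto
  with False show ?thesis by (simp add: kern_off_diagonal trunc_def max_def)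
qed simp

lemma continuous_trunc: "0 < \<delta> \<Longrightarrow> continuous_on UNIV (\<lambda>x. trunc \<delta> x z)"
  unfolding trunc_def by (intro continuous_intros) auto

lemma measurable_trunc [measurable]: "trunc \<delta> x \<in> borel_measurable borel"
  unfolding trunc_def by measurable

text \<open>Allows such a potential to serve as a test function for weak convergence. The potential
  lies between \<open>g \<delta> x\<close> and \<open>g \<delta> x\<close> plus a small error,
  uniformly in x.\<close>

lemma kato_potential_continuous:
  assumes fin: "finite_measure \<mu>" and sets: "sets \<mu> = sets borel" and kato: "kato \<mu>"
  obtains f where "continuous_on UNIV f" "bounded (range f)" "\<And>x. 0 \<le> f x" "\<And>x. pot \<mu> x = ennreal (f x)"
proof -
  interpret finite_measure \<mu> by fact
  have [measurable_cong]: "sets \<mu> = sets borel" by fact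
  define g where "g \<delta> x = (\<integral>z. trunc \<delta> x z \<partial>\<mu>)" for \<delta> x
  have int: "integrable \<mu> (trunc \<delta> x)" if "0 < \<delta>" for \<delta> x
    using trunc_bounds that by (intro integrable_const_bound[of _ "\<delta> powr (- p)"]) auto
  have g_nn: "ennreal (g \<delta> x) = (\<integral>\<^sup>+z. ennreal (trunc \<delta> x z) \<partial>\<mu>)" if "0 < \<delta>" for \<delta> x
    unfolding g_def using int[OF that] trunc_bounds by (intro nn_integral_eq_integral[symmetric]) auto
  have g_nonneg: "0 \<le> g \<delta> x" for \<delta> x unfolding g_def using trunc_bounds by (intro Bochner_Integration.integral_nonneg) auto
  have g_le: "g \<delta> x \<le> \<delta> powr (- p) * measure \<mu> (space \<mu>)" if "0 < \<delta>" for \<delta> x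
  proof -
    have "g \<delta> x \<le> (\<integral>z. \<delta> powr (- p) \<partial>\<mu>)"
      unfolding g_def using int[OF that] trunc_bounds that by (intro Bochner_Integration.integral_mono) auto
    then show ?thesis by (simp add: mult.commute)
  qed
  have g_cont: "continuous_on UNIV (g \<delta>)" if \<delta>: "0 < \<delta>" for \<delta>
    unfolding continuous_on_sequentially
  proof (intro allI ballI impI, elim conjE)
    fix X and a :: 'a assume X: "X \<longlonglongrightarrow> a"
    show "(g \<delta> \<circ> X) \<longlonglongrightarrow> g \<delta> a"
      unfolding comp_def g_def
    proof (rule integral_dominated_convergence[where w="\<lambda>_. \<delta> powr (- p)"])
      show "AE z in \<mu>. (\<lambda>i. trunc \<delta> (X i) z) \<longlonglongrightarrow> trunc \<delta> a z"
        using continuous_on_tendsto_compose[OF continuous_trunc[OF \<delta>] X] by (intro always_eventually) auto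
    qed (use trunc_bounds \<delta> in auto)
  qed
  have lower: "ennreal (g \<delta> x) \<le> pot \<mu> x" if "0 < \<delta>" for \<delta> x
    unfolding g_nn[OF that] potential_def using trunc_le_kern[OF that] by (intro nn_integral_mono) auto
  have upper: "pot \<mu> x \<le> ennreal (g \<delta> x) + (\<integral>\<^sup>+z. kern x z * indicator (ball x \<delta>) z \<partial>\<mu>)" if "0 < \<delta>" for \<delta> x
    unfolding g_nn[OF that] potential_def
    by (subst nn_integral_add[symmetric]) (auto intro!: nn_integral_mono kern_le_trunc that)
  have "\<forall>n. \<exists>\<delta>>0. \<forall>x. (\<integral>\<^sup>+z. kern x z * indicator (ball x \<delta>) z \<partial>\<mu>) \<le> ennreal (1 / real (Suc n))"
    using kato unfolding kato_def by simp
  then obtain \<delta> where \<delta>: "\<And>n. 0 < \<delta> n"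
    and small: "\<And>n x. (\<integral>\<^sup>+z. kern x z * indicator (ball x (\<delta> n)) z \<partial>\<mu>) \<le> ennreal (1 / real (Suc n))"
    by metis
  have up: "pot \<mu> x \<le> ennreal (g (\<delta> n) x + 1 / real (Suc n))" for n x
  proof -
    have "pot \<mu> x \<le> ennreal (g (\<delta> n) x) + ennreal (1 / real (Suc n))"
      using upper[OF \<delta>, of x n] small[of x n] by (meson add_left_mono order_trans)
    then show ?thesis using g_nonneg by (simp add: ennreal_plus)
  qed
  define f where "f x = enn2real (pot \<mu> x)" for x
  have pot_fin: "pot \<mu> x < \<infinity>" for x using up[of x 0] by (rule le_less_trans) simp
  then have pf: "pot \<mu> x = ennreal (f x)" for x by (simp add: f_def)
  have f_nonneg: "0 \<le> f x" for x by (simp add: f_def)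
  have f_lo: "g (\<delta> n) x \<le> f x" for n x using lower[OF \<delta>, of n x] f_nonneg unfolding pf by simp
  have f_up: "f x \<le> g (\<delta> n) x + 1 / real (Suc n)" for n x
    using up[of x n] g_nonneg[of "\<delta> n" x] unfolding pf by (subst (asm) ennreal_le_iff) auto
  have "uniform_limit UNIV (\<lambda>n. g (\<delta> n)) f sequentially"
  proof (rule uniform_limitI)
    fix e :: real assume "0 < e"
    then obtain N where N: "1 / real (Suc N) < e" using nat_approx_posE by blast
    have "dist (g (\<delta> n) x) (f x) < e" if "N \<le> n" for n x
    proof -
      have "1 / real (Suc n) \<le> 1 / real (Suc N)" using that by (intro divide_left_mono) auto
      then show ?thesis using f_lo[of n x] f_up[of x n] N by (simp add: dist_real_def)
    qed
    then show "\<forall>\<^sub>F n in sequentially. \<forall>x\<in>UNIV. dist (g (\<delta> n) x) (f x) < e"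
      by (auto intro!: eventually_sequentiallyI[of N])
  qed
  then have "continuous_on UNIV f"
    by (rule uniform_limit_theorem[rotated]) (use g_cont \<delta> in auto)
  moreover have "bounded (range f)"
  proof (rule boundedI)
    fix y assume "y \<in> range f"
    then obtain x where y: "y = f x" by auto
    show "norm y \<le> \<delta> 0 powr (- p) * measure \<mu> (space \<mu>) + 1"
      using f_up[of x 0] g_le[OF \<delta>, of 0 x] f_nonneg[of x] by (simp add: y)
  qed
  ultimately show ?thesis using that f_nonneg pf by blast
qed

lemma radon_potential_measurable [measurable]:
  "radon_measure \<mu> \<Longrightarrow> pot \<mu> \<in> borel_measurable borel"
  by (rule measurable_potential[OF radon_measure_sigma_finite]) (auto simp: radon_measure_def)

lemma energy_density_le:
  fixes \<mu> :: "'a measure"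
  assumes "radon_measure \<mu>" "B \<in> sets borel"
  shows "energy \<alpha> (density \<mu> (\<lambda>x. ennreal c * indicator B x)) \<le> ennreal c * (ennreal c * energy \<alpha> \<mu>)"
proof -
  have [measurable_cong]: "sets \<mu> = sets borel" using assms by (simp add: radon_measure_def)
  have [measurable]: "B \<in> sets borel" by fact
  have [measurable]: "pot \<mu> \<in> borel_measurable borel" using assms by measurable
  interpret sigma_finite_measure \<mu> using assms(1) by (rule radon_measure_sigma_finite)
  let ?d = "density \<mu> (\<lambda>x. ennreal c * indicator B x)"
  have pot_eq: "pot ?d x = (\<integral>\<^sup>+z. ennreal c * indicator B z * kern x z \<partial>\<mu>)" for x
    unfolding potential_def by (rule nn_integral_density) measurable
  have pot_le: "pot ?d x \<le> ennreal c * pot \<mu> x" for x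
  proof -
    have "(\<integral>\<^sup>+z. ennreal c * indicator B z * kern x z \<partial>\<mu>) \<le> (\<integral>\<^sup>+z. ennreal c * kern x z \<partial>\<mu>)"
      by (intro nn_integral_mono) (auto simp: indicator_def)
    also have "\<dots> = ennreal c * pot \<mu> x" unfolding potential_def by (rule nn_integral_cmult) measurable
    finally show ?thesis unfolding pot_eq .
  qed
  have [measurable]: "pot ?d \<in> borel_measurable borel" unfolding pot_eq[abs_def] by measurable
  have "energy \<alpha> ?d = (\<integral>\<^sup>+x. ennreal c * indicator B x * pot ?d x \<partial>\<mu>)"
    unfolding energy_def by (rule nn_integral_density) measurable
  also have "\<dots> \<le> (\<integral>\<^sup>+x. ennreal c * (ennreal c * pot \<mu> x) \<partial>\<mu>)"
    by (intro nn_integral_mono) (auto split: split_indicator intro!: mult_left_mono pot_le)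
  also have "\<dots> = ennreal c * (ennreal c * energy \<alpha> \<mu>)"
    unfolding energy_def by (simp add: nn_integral_cmult)
  finally show ?thesis .
qed

text \<open>Trades one possibly nonmeasurable exceptional set for statements about single measures.
  If a finite-energy measure concentrated on A charges the Borel set where P fails, a normalized
  piece of it gives the exceptional set positive capacity. If none does, the part of A where P fails
  carries no unit measure of finite energy.\<close>

lemma nearly_everywhere_iff_AE:
  assumes P: "{x::'a. P x} \<in> sets borel"
  shows "nearly_everywhere \<alpha> A P \<longleftrightarrow> (\<forall>\<mu>\<in>finite_energy_on \<alpha> A. AE x in \<mu>. P x)"
proof
  assume "nearly_everywhere \<alpha> A P"
  then obtain E where E: "E \<subseteq> A" "inner_capacity \<alpha> E = 0" "\<And>x. x \<in> A - E \<Longrightarrow> P x"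
    unfolding nearly_everywhere_def by blast
  show "\<forall>\<mu>\<in>finite_energy_on \<alpha> A. AE x in \<mu>. P x"
  proof (rule ballI, rule ccontr)
    fix \<mu> assume \<mu>: "\<mu> \<in> finite_energy_on \<alpha> A" and no: "\<not> (AE x in \<mu>. P x)"
    have radon: "radon_measure \<mu>" and en: "energy \<alpha> \<mu> < \<infinity>" and conc: "concentrated_on \<mu> A"
      using \<mu> by (auto simp: finite_energy_on_def)
    have sets: "sets \<mu> = sets borel" using radon by (simp add: radon_measure_def)
    note [measurable_cong] = sets
    have sp: "space \<mu> = UNIV" using sets_eq_imp_space_eq[OF sets] by simp
    obtain N where N: "N \<in> sets borel" "- A \<subseteq> N" "emeasure \<mu> N = 0"
      using conc by (auto simp: concentrated_on_def)
    let ?Q = "- {x. P x}"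
    have Q: "?Q \<in> sets borel" using P by auto
    have "0 < emeasure \<mu> ?Q"
    proof (rule ccontr)
      assume "\<not> 0 < emeasure \<mu> ?Q"
      then have "AE x in \<mu>. P x"
        using Q sets by (intro AE_I[of _ _ ?Q]) (auto simp: not_gr_zero)
      with no show False by simp
    qed
    \<comment> \<open>Cutting down to a ball gives the charged set finite mass, so that it can be
      normalized.\<close>
    then obtain n :: nat where n: "0 < emeasure \<mu> (?Q \<inter> cball 0 (real n))"
      using emeasure_Int_cball_pos[OF sets Q] by blast
    define B where "B = ?Q \<inter> cball 0 (real n)"
    have B [measurable]: "B \<in> sets borel" using Q by (auto simp: B_def)
    have "emeasure \<mu> B \<le> emeasure \<mu> (cball 0 (real n))"
      by (rule emeasure_mono) (auto simp: B_def sets)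
    also have "\<dots> < \<infinity>" using radon by (simp add: radon_measure_def)
    finally have Bfin: "emeasure \<mu> B < \<infinity>" .
    define b where "b = enn2real (emeasure \<mu> B)"
    have eb: "emeasure \<mu> B = ennreal b" using Bfin by (simp add: b_def)
    with n have b: "0 < b" by (simp add: B_def)
    define \<mu>' where "\<mu>' = density \<mu> (\<lambda>x. ennreal (1 / b) * indicator B x)"
    have em: "emeasure \<mu>' X = ennreal (1 / b) * emeasure \<mu> (B \<inter> X)" if "X \<in> sets borel" for X
    proof -
      have "emeasure \<mu>' X = (\<integral>\<^sup>+x. ennreal (1 / b) * indicator B x * indicator X x \<partial>\<mu>)"
        unfolding \<mu>'_def using that sets by (intro emeasure_density) auto
      also have "\<dots> = (\<integral>\<^sup>+x. ennreal (1 / b) * indicator (B \<inter> X) x \<partial>\<mu>)"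
        by (intro nn_integral_cong) (auto simp: indicator_def)
      also have "\<dots> = ennreal (1 / b) * emeasure \<mu> (B \<inter> X)"
        using that sets B by (intro nn_integral_cmult_indicator) auto
      finally show ?thesis .
    qed
    have mass: "emeasure \<mu>' UNIV = 1"
      using b em[of UNIV] by (simp add: eb flip: ennreal_mult)
    have sets': "sets \<mu>' = sets borel" by (simp add: \<mu>'_def sets)
    have "radon_measure \<mu>'"
      unfolding radon_measure_def
    proof (intro conjI allI impI sets')
      fix K :: "'a set"
      have "emeasure \<mu>' K \<le> emeasure \<mu>' (space \<mu>')" by (rule emeasure_space)
      also have "space \<mu>' = UNIV" using sets_eq_imp_space_eq[OF sets'] by simp
      finally show "emeasure \<mu>' K < \<infinity>" unfolding mass by (rule le_less_trans) simp
    qed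
    moreover have "energy \<alpha> \<mu>' < \<infinity>"
      unfolding \<mu>'_def
      by (rule le_less_trans[OF energy_density_le[OF radon B]]) (use en in \<open>auto simp: ennreal_mult_less_top\<close>)
    moreover have "concentrated_on \<mu>' E"
      unfolding concentrated_on_def
    proof (intro bexI conjI)
      show "N \<union> - B \<in> sets borel" using N B by auto
      show "- E \<subseteq> N \<union> - B" using E(3) N(2) by (auto simp: B_def)
      have "emeasure \<mu> (B \<inter> (N \<union> - B)) \<le> emeasure \<mu> N"
        using N sets by (intro emeasure_mono) auto
      then show "emeasure \<mu>' (N \<union> - B) = 0" using N B by (subst em) auto
    qed
    ultimately have mem: "\<mu>' \<in> {\<mu> \<in> finite_energy_on \<alpha> E. emeasure \<mu> UNIV = 1}" and fin: "energy \<alpha> \<mu>' < \<infinity>"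
      using mass by (auto simp: finite_energy_on_def)
    have "(INF \<mu>\<in>{\<mu> \<in> finite_energy_on \<alpha> E. emeasure \<mu> UNIV = 1}. energy \<alpha> \<mu>) \<le> energy \<alpha> \<mu>'"
      by (rule INF_lower[OF mem])
    with fin E(2) show False unfolding inner_capacity_def by (simp add: top_unique)
  qed
next
  assume AE: "\<forall>\<mu>\<in>finite_energy_on \<alpha> A. AE x in \<mu>. P x"
  define E where "E = {x \<in> A. \<not> P x}"
  have "{\<mu> \<in> finite_energy_on \<alpha> E. emeasure \<mu> UNIV = 1} = {}"
  proof (rule ccontr)
    assume "\<not> ?thesis"
    then obtain \<mu> where \<mu>: "\<mu> \<in> finite_energy_on \<alpha> E" and mass: "emeasure \<mu> UNIV = 1" by blast
    have sets: "sets \<mu> = sets borel" using \<mu> by (simp add: finite_energy_on_def radon_measure_def)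
    have sp: "space \<mu> = UNIV" using sets_eq_imp_space_eq[OF sets] by simp
    obtain N where N: "N \<in> sets borel" "- E \<subseteq> N" "emeasure \<mu> N = 0"
      using \<mu> by (auto simp: finite_energy_on_def concentrated_on_def)
    have "concentrated_on \<mu> A" unfolding concentrated_on_def
      using N by (intro bexI[of _ N]) (auto simp: E_def)
    then have "\<mu> \<in> finite_energy_on \<alpha> A" using \<mu> by (auto simp: finite_energy_on_def)
    then have "AE x in \<mu>. P x" using AE by blast
    moreover have "AE x in \<mu>. x \<notin> N" using N sets by (intro AE_not_in) (auto simp: null_sets_def)
    ultimately have "AE x in \<mu>. False"
      by eventually_elim (use N in \<open>auto simp: E_def\<close>)
    then have "emeasure \<mu> (space \<mu>) = 0" by (simp add: AE_iff_measurable[OF _ refl])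
    then show False using mass sp by simp
  qed
  \<comment> \<open>The infimum over the empty set is \<infinity>, and its inverse is 0.\<close>
  then have "inner_capacity \<alpha> E = 0" unfolding inner_capacity_def by (simp only: image_empty Inf_empty ennreal_inverse_top)
  then show "nearly_everywhere \<alpha> A P"
    unfolding nearly_everywhere_def by (intro exI[of _ E]) (auto simp: E_def)
qed

lemma measurable_near_potential:
  fixes \<mu> :: "'a measure"
  assumes "radon_measure \<mu>"
  shows "(\<lambda>x. \<integral>\<^sup>+z. kern x z * indicator (ball x \<delta>) z \<partial>\<mu>) \<in> borel_measurable borel"
proof -
  interpret sigma_finite_measure \<mu> using assms by (rule radon_measure_sigma_finite)
  have [measurable_cong]: "sets \<mu> = sets borel" using assms by (simp add: radon_measure_def)
  have "indicator (ball x \<delta>) z = (indicator {..<\<delta>} (dist x z) :: ennreal)" for x z :: 'a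
    by (simp add: indicator_def)
  then show ?thesis by simp
qed

text \<open>A finite potential at x rules out an atom there, so dominated convergence applies with
  the kernel itself as majorant.\<close>

lemma near_potential_tendsto_0:
  fixes \<mu> :: "'a measure"
  assumes "radon_measure \<mu>" "pot \<mu> x < \<infinity>"
  shows "(\<lambda>m. \<integral>\<^sup>+z. kern x z * indicator (ball x (1 / real (Suc m))) z \<partial>\<mu>) \<longlonglongrightarrow> 0"
proof -
  have [measurable_cong]: "sets \<mu> = sets borel" using assms by (simp add: radon_measure_def)
  have "AE z in \<mu>. kern x z \<noteq> \<infinity>"
    using assms(2) unfolding potential_def by (intro nn_integral_PInf_AE) auto
  then have "AE z in \<mu>. x \<noteq> z" by eventually_elim (auto simp: riesz_kernel_def)
  then have lim: "AE z in \<mu>. (\<lambda>m. kern x z * indicator (ball x (1 / real (Suc m))) z) \<longlonglongrightarrow> 0"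
  proof eventually_elim
    case (elim z)
    then obtain M where M: "1 / real (Suc M) < dist x z" using nat_approx_posE[of "dist x z"] by auto
    have "kern x z * indicator (ball x (1 / real (Suc m))) z = 0" if "M \<le> m" for m
    proof -
      have "1 / real (Suc m) \<le> 1 / real (Suc M)" using that by (intro divide_left_mono) auto
      with M show ?thesis by simp
    qed
    then show ?case by (intro tendsto_eventually eventually_sequentiallyI[of M])
  qed
  have "(\<lambda>m. \<integral>\<^sup>+z. kern x z * indicator (ball x (1 / real (Suc m))) z \<partial>\<mu>) \<longlonglongrightarrow> (\<integral>\<^sup>+z. 0 \<partial>\<mu>)"
  proof (rule nn_integral_dominated_convergence[where w="kern x"])
    show "AE z in \<mu>. kern x z * indicator (ball x (1 / real (Suc m))) z \<le> kern x z" for m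
      by (intro always_eventually allI) (simp split: split_indicator)
    show "(\<integral>\<^sup>+z. kern x z \<partial>\<mu>) < \<infinity>" using assms(2) by (simp add: potential_def)
  qed (use lim in auto)
  then show ?thesis by simp
qed

text \<open>Egorov's argument, applied to the potentials of the kernel cut off to small balls, gives
  smallness at the points of a compact set \<open>K\<close>. Comparing an arbitrary point with a nearest point
  of \<open>K\<close> extends it to the whole space.\<close>

lemma finite_energy_charges_kato:
  fixes \<mu> :: "'a measure"
  assumes radon: "radon_measure \<mu>" and en: "energy \<alpha> \<mu> < \<infinity>" and B: "B \<in> sets borel" "0 < emeasure \<mu> B"
  obtains K where "compact K" "K \<subseteq> B" "0 < emeasure \<mu> K" "kato (density \<mu> (indicator K))"
proof -
  have sets: "sets \<mu> = sets borel" using radon by (simp add: radon_measure_def)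
  note [measurable_cong] = sets
  have sp: "space \<mu> = UNIV" using sets_eq_imp_space_eq[OF sets] by simp
  have [measurable]: "pot \<mu> \<in> borel_measurable borel" using radon by (rule radon_potential_measurable)
  have [measurable]: "B \<in> sets borel" by fact
  obtain n :: nat where n: "0 < emeasure \<mu> (B \<inter> cball 0 (real n))"
    using emeasure_Int_cball_pos[OF sets B] by blast
  define X where "X = {x. x \<in> B \<inter> cball 0 (real n) \<and> pot \<mu> x < \<infinity>}"
  have [measurable]: "cball (0::'a) (real n) \<in> sets borel" by simp
  have X [measurable]: "X \<in> sets borel" unfolding X_def by measurable
  have "AE x in \<mu>. pot \<mu> x \<noteq> \<infinity>"
    using en unfolding energy_def by (intro nn_integral_PInf_AE) auto
  then have "emeasure \<mu> X = emeasure \<mu> (B \<inter> cball 0 (real n))"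
    by (intro emeasure_eq_AE) (auto simp: X_def less_top elim!: eventually_mono)
  with n have Xpos: "0 < emeasure \<mu> X" by simp
  have "emeasure \<mu> X \<le> emeasure \<mu> (cball 0 (real n))"
    by (rule emeasure_mono) (auto simp: X_def sets)
  also have "\<dots> < \<infinity>" using radon by (simp add: radon_measure_def)
  finally have Xfin: "emeasure \<mu> X < \<infinity>" .
  define c where "c = enn2real (emeasure \<mu> X)"
  have ec: "emeasure \<mu> X = ennreal c" using Xfin by (simp add: c_def)
  with Xpos have c: "0 < c" by simp
  define h where "h m x = (\<integral>\<^sup>+z. kern x z * indicator (ball x (1 / real (Suc m))) z \<partial>\<mu>)" for m x
  have h [measurable]: "h m \<in> borel_measurable borel" for m
    unfolding h_def using radon by (rule measurable_near_potential)
  have h_mono: "h m' x \<le> h m x" if "m \<le> m'" for m m' x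
  proof -
    have "1 / real (Suc m') \<le> 1 / real (Suc m)" using that by (intro divide_left_mono) auto
    then have "ball x (1 / real (Suc m')) \<subseteq> ball x (1 / real (Suc m))" by (rule subset_ball)
    then show ?thesis unfolding h_def
      by (intro nn_integral_mono) (auto split: split_indicator)
  qed
  \<comment> \<open>Bad sets: the points where the mass within radius 1/(m+1) still contributes more
    than 1/(j+1) to the potential. For fixed j they decrease to the empty set as m grows.\<close>
  define S where "S j m = {x \<in> X. ennreal (1 / real (Suc j)) < h m x}" for j m
  have S [measurable]: "S j m \<in> sets borel" for j m unfolding S_def by measurable
  have "\<exists>m. emeasure \<mu> (S j m) < ennreal (c * (1/2) ^ Suc (Suc j))" for j
  proof -
    have "(\<lambda>m. emeasure \<mu> (S j m)) \<longlonglongrightarrow> emeasure \<mu> (\<Inter>m. S j m)"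
    proof (rule Lim_emeasure_decseq)
      show "range (S j) \<subseteq> sets \<mu>" unfolding sets using S by auto
      show "decseq (S j)" unfolding decseq_def S_def using h_mono by (auto intro: less_le_trans)
      show "emeasure \<mu> (S j m) \<noteq> \<infinity>" for m
      proof -
        have "emeasure \<mu> (S j m) \<le> emeasure \<mu> X" by (rule emeasure_mono) (auto simp: S_def sets X)
        with Xfin show ?thesis by (auto simp: top_unique)
      qed
    qed
    moreover have "(\<Inter>m. S j m) = {}"
    proof (rule ccontr)
      assume "(\<Inter>m. S j m) \<noteq> {}"
      then obtain x where x: "\<And>m. x \<in> S j m" by blast
      then have "pot \<mu> x < \<infinity>" by (auto simp: S_def X_def)
      from near_potential_tendsto_0[OF radon this] have "(\<lambda>m. h m x) \<longlonglongrightarrow> 0" by (simp add: h_def)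
      from order_tendstoD(2)[OF this, of "ennreal (1 / real (Suc j))"]
      obtain m where "h m x < ennreal (1 / real (Suc j))" by (auto simp: eventually_sequentially)
      with x[of m] show False unfolding S_def by (auto dest: less_asym)
    qed
    ultimately have "(\<lambda>m. emeasure \<mu> (S j m)) \<longlonglongrightarrow> 0" by simp
    from order_tendstoD(2)[OF this, of "ennreal (c * (1/2) ^ Suc (Suc j))"] c
    show ?thesis by (auto simp: eventually_sequentially)
  qed
  \<comment> \<open>These bounds add up to c/2, so removing all the chosen bad sets leaves a set
    \<open>Y\<close> of positive mass.\<close>
  then obtain m where m: "\<And>j. emeasure \<mu> (S j (m j)) < ennreal (c * (1/2) ^ Suc (Suc j))" by metis
  define Y where "Y = X - (\<Union>j. S j (m j))"
  have Y [measurable]: "Y \<in> sets borel" unfolding Y_def by measurable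
  have Ypos: "0 < emeasure \<mu> Y"
  proof (rule ccontr)
    assume "\<not> 0 < emeasure \<mu> Y"
    then have Y0: "emeasure \<mu> Y = 0" by simp
    have "emeasure \<mu> (\<Union>j. S j (m j)) \<le> (\<Sum>j. emeasure \<mu> (S j (m j)))"
      by (rule emeasure_subadditive_countably) (unfold sets, use S in blast)
    also have "\<dots> \<le> (\<Sum>j. ennreal (c * (1/2) ^ Suc (Suc j)))"
      using m by (intro suminf_le) (auto intro: less_imp_le)
    also have "\<dots> = ennreal (c / 2)"
    proof -
      have "(\<lambda>j. (c / 4) * (1/2) ^ j) sums ((c / 4) * (1 / (1 - 1/2)))"
        by (intro sums_mult geometric_sums) auto
      then have "(\<lambda>j. c * (1/2) ^ Suc (Suc j)) sums (c / 2)" by simp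
      then show ?thesis using c by (intro suminf_ennreal_eq) auto
    qed
    finally have U: "emeasure \<mu> (\<Union>j. S j (m j)) \<le> ennreal (c / 2)" .
    have "ennreal c = emeasure \<mu> X" by (simp add: ec)
    also have "\<dots> \<le> emeasure \<mu> (Y \<union> (\<Union>j. S j (m j)))"
      by (rule emeasure_mono, force simp: Y_def, unfold sets, measurable)
    also have "\<dots> \<le> emeasure \<mu> Y + emeasure \<mu> (\<Union>j. S j (m j))"
      by (rule emeasure_subadditive; unfold sets; measurable)
    also have "\<dots> \<le> ennreal (c / 2)" using U Y0 by simp
    finally show False using c by (simp add: ennreal_le_iff)
  qed
  \<comment> \<open>Inner regularity is applied to a finite measure, hence the restriction to
    \<open>X\<close>.\<close>
  define M where "M = density \<mu> (indicator X)"
  have M_eq: "emeasure M Z = emeasure \<mu> (X \<inter> Z)" if "Z \<in> sets borel" for Z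
    unfolding M_def using that sets by (simp add: emeasure_density nn_integral_indicator flip: indicator_inter_arith)
  have "emeasure M Y = (SUP K\<in>{K. K \<subseteq> Y \<and> compact K}. emeasure M K)"
  proof (rule inner_regular)
    show "sets M = sets borel" by (simp add: M_def sets)
    show "emeasure M (space M) \<noteq> \<infinity>" using M_eq[of UNIV] Xfin by (simp add: M_def sp)
  qed (rule Y)
  moreover have "emeasure M Y = emeasure \<mu> Y"
    using M_eq[OF Y] by (simp add: Y_def Int_absorb1)
  ultimately obtain K where K: "K \<subseteq> Y" "compact K" "0 < emeasure M K"
    using Ypos by (auto simp: less_SUP_iff)
  have Kb [measurable]: "K \<in> sets borel" using K(2) by (simp add: borel_compact)
  have "K \<subseteq> X" using K(1) by (auto simp: Y_def)
  then have Kpos: "0 < emeasure \<mu> K" using K(3) M_eq[OF Kb] by (simp add: Int_absorb1)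
  have Kne: "K \<noteq> {}" using Kpos by auto
  have "kato (density \<mu> (indicator K))"
    unfolding kato_def
  proof (intro allI impI)
    fix \<epsilon> :: real assume \<epsilon>: "0 < \<epsilon>"
    \<comment> \<open>Passing to the nearest point of \<open>K\<close> costs the factor 2^p and
      doubles the radius; the choices of \<open>j\<close> and \<open>\<delta>\<close> absorb
      both.\<close>
    then obtain j where j: "1 / real (Suc j) < \<epsilon> / 2 powr p"
      using nat_approx_posE[of "\<epsilon> / 2 powr p"] by auto
    define \<delta> where "\<delta> = 1 / (2 * real (Suc (m j)))"
    have \<delta>: "0 < \<delta>" "2 * \<delta> = 1 / real (Suc (m j))" by (simp_all add: \<delta>_def field_simps)
    have "(\<integral>\<^sup>+z. kern x z * indicator (ball x \<delta>) z \<partial>density \<mu> (indicator K)) \<le> ennreal \<epsilon>" for x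
    proof -
      obtain x' where x': "x' \<in> K" "\<And>z. z \<in> K \<Longrightarrow> dist x x' \<le> dist x z"
        using distance_attains_inf[OF compact_imp_closed[OF K(2)] Kne, of x] by auto
      have "(\<integral>\<^sup>+z. kern x z * indicator (ball x \<delta>) z \<partial>density \<mu> (indicator K)) =
          (\<integral>\<^sup>+z. indicator K z * (kern x z * indicator (ball x \<delta>) z) \<partial>\<mu>)"
        by (rule nn_integral_density) measurable
      also have "\<dots> \<le> (\<integral>\<^sup>+z. ennreal (2 powr p) * (kern x' z * indicator (ball x' (1 / real (Suc (m j)))) z) \<partial>\<mu>)"
      proof (intro nn_integral_mono)
        fix z
        show "indicator K z * (kern x z * indicator (ball x \<delta>) z) \<le>
          ennreal (2 powr p) * (kern x' z * indicator (ball x' (1 / real (Suc (m j)))) z)"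
        proof (cases "z \<in> K \<and> dist x z < \<delta>")
          case True
          then have d: "dist x' z \<le> 2 * dist x z"
            using x'(2)[of z] dist_triangle[of x' z x] by (simp add: dist_commute)
          then have "dist x' z < 1 / real (Suc (m j))" using True \<delta> by simp
          moreover have "kern x z \<le> ennreal (2 powr p) * kern x' z"
            using kern_scale_mono[OF _ d] by simp
          ultimately show ?thesis using True by simp
        qed (auto split: split_indicator)
      qed
      also have "\<dots> = ennreal (2 powr p) * h (m j) x'"
        unfolding h_def by (rule nn_integral_cmult) measurable
      also have "h (m j) x' \<le> ennreal (1 / real (Suc j))"
        using x'(1) K(1) by (auto simp: Y_def S_def not_less)
      also have "ennreal (2 powr p) * ennreal (1 / real (Suc j)) = ennreal (2 powr p * (1 / real (Suc j)))"
        by (rule ennreal_mult'[symmetric]) simp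
      also have "\<dots> \<le> ennreal \<epsilon>"
        using j by (intro ennreal_leI) (simp add: field_simps)
      finally show ?thesis by (simp add: mult_left_mono)
    qed
    with \<delta> show "\<exists>\<delta>>0. \<forall>x. (\<integral>\<^sup>+z. kern x z * indicator (ball x \<delta>) z \<partial>density \<mu> (indicator K)) \<le> ennreal \<epsilon>" by blast
  qed
  moreover have "K \<subseteq> B" using \<open>K \<subseteq> X\<close> by (auto simp: X_def)
  ultimately show ?thesis using that K(2) Kpos by blast
qed

lemma kato_weak_limit:
  fixes \<tau> \<rho> :: "'a measure" and \<rho>' :: "nat \<Rightarrow> 'a measure"
  assumes \<tau>: "finite_measure \<tau>" "sets \<tau> = sets borel" "kato \<tau>"
    and \<rho>': "\<And>j. prob_space (\<rho>' j)" "\<And>j. sets (\<rho>' j) = sets borel" and \<rho>: "prob_space \<rho>" "sets \<rho> = sets borel"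
    and conv: "\<And>f :: 'a \<Rightarrow> real. continuous_on UNIV f \<Longrightarrow> bounded (range f) \<Longrightarrow>
       (\<lambda>j. \<integral>x. f x \<partial>\<rho>' j) \<longlonglongrightarrow> (\<integral>x. f x \<partial>\<rho>)"
  shows "(\<lambda>j. \<integral>\<^sup>+x. pot \<tau> x \<partial>\<rho>' j) \<longlonglongrightarrow> (\<integral>\<^sup>+x. pot \<tau> x \<partial>\<rho>)" "(\<integral>\<^sup>+x. pot \<tau> x \<partial>\<rho>) < \<infinity>"
proof -
  obtain f where f: "continuous_on UNIV f" "bounded (range f)" "\<And>x. 0 \<le> f x" "\<And>x. pot \<tau> x = ennreal (f x)"
    using kato_potential_continuous[OF \<tau>] by blast
  have [measurable]: "f \<in> borel_measurable borel" by (rule borel_measurable_continuous_onI[OF f(1)])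
  obtain C where C: "\<And>x. norm (f x) \<le> C" using f(2) by (auto simp: bounded_iff)
  have eq: "(\<integral>\<^sup>+x. pot \<tau> x \<partial>M) = ennreal (\<integral>x. f x \<partial>M)" if M: "prob_space M" "sets M = sets borel" for M
  proof -
    interpret prob_space M by fact
    have [measurable_cong]: "sets M = sets borel" by fact
    have "integrable M f" using C by (intro integrable_const_bound[of _ C]) auto
    then show ?thesis unfolding f(4) using f(3) by (intro nn_integral_eq_integral) auto
  qed
  show "(\<lambda>j. \<integral>\<^sup>+x. pot \<tau> x \<partial>\<rho>' j) \<longlonglongrightarrow> (\<integral>\<^sup>+x. pot \<tau> x \<partial>\<rho>)"
    unfolding eq[OF \<rho>] eq[OF \<rho>'] by (intro tendsto_ennrealI conv f)
  show "(\<integral>\<^sup>+x. pot \<tau> x \<partial>\<rho>) < \<infinity>" unfolding eq[OF \<rho>] by simp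
qed

text \<open>Semicontinuity bounds \<open>pot \<rho>\<close> from above by the lower limit of the
  \<open>pot (\<rho>' j)\<close>, the wrong direction here. If the inequality fails on a set charged
  by \<mu>, it is integrated against a restriction \<open>\<tau>\<close> of \<mu> with continuous
  potential. By reciprocity the integral of \<open>pot (\<rho>' j)\<close> against
  \<open>\<tau>\<close> is that of the test function \<open>pot \<tau>\<close> against
  \<open>\<rho>' j\<close>, and so it converges.\<close>

lemma weak_limit_dominates_AE:
  fixes \<mu> \<rho> :: "'a measure" and \<rho>' :: "nat \<Rightarrow> 'a measure" and N :: real
  assumes radon: "radon_measure \<mu>" and en: "energy \<alpha> \<mu> < \<infinity>"
    and \<rho>': "\<And>j. prob_space (\<rho>' j)" "\<And>j. sets (\<rho>' j) = sets borel" and \<rho>: "prob_space \<rho>" "sets \<rho> = sets borel"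
    and conv: "\<And>f :: 'a \<Rightarrow> real. continuous_on UNIV f \<Longrightarrow> bounded (range f) \<Longrightarrow>
       (\<lambda>j. \<integral>x. f x \<partial>\<rho>' j) \<longlonglongrightarrow> (\<integral>x. f x \<partial>\<rho>)"
    and y: "Y \<longlonglongrightarrow> y" and dom: "\<And>j. AE x in \<mu>. kern x (Y j) \<le> ennreal N * pot (\<rho>' j) x"
  shows "AE x in \<mu>. kern x y \<le> ennreal N * pot \<rho> x"
proof (rule ccontr)
  assume no: "\<not> ?thesis"
  have sets: "sets \<mu> = sets borel" using radon by (simp add: radon_measure_def)
  note [measurable_cong] = sets
  have sp: "space \<mu> = UNIV" using sets_eq_imp_space_eq[OF sets] by simp
  have sf: "sigma_finite_measure M" if "prob_space M" for M :: "'a measure"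
  proof -
    interpret prob_space M by fact
    show ?thesis by unfold_locales
  qed
  have [measurable]: "pot \<rho> \<in> borel_measurable borel" "pot (\<rho>' j) \<in> borel_measurable borel" for j
    using \<rho> \<rho>' sf by (auto intro: measurable_potential)
  define B where "B = {x. ennreal N * pot \<rho> x < kern x y}"
  have B: "B \<in> sets borel" unfolding B_def by measurable
  have "0 < emeasure \<mu> B"
  proof (rule ccontr)
    assume "\<not> 0 < emeasure \<mu> B"
    then have "AE x in \<mu>. kern x y \<le> ennreal N * pot \<rho> x"
      using B sets by (intro AE_I[of _ _ B]) (auto simp: B_def not_le)
    with no show False by simp
  qed
  from finite_energy_charges_kato[OF radon en B this]
  obtain K where K: "compact K" "K \<subseteq> B" "0 < emeasure \<mu> K" "kato (density \<mu> (indicator K))" by blast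
  have Kb [measurable]: "K \<in> sets borel" using K(1) by (simp add: borel_compact)
  define \<tau> where "\<tau> = density \<mu> (indicator K)"
  have \<tau>_sets: "sets \<tau> = sets borel" by (simp add: \<tau>_def sets)
  note [measurable_cong] = \<tau>_sets
  have \<tau>_mass: "emeasure \<tau> (space \<tau>) = emeasure \<mu> K"
    by (simp add: \<tau>_def emeasure_density sp sets)
  have \<tau>_fin: "finite_measure \<tau>"
  proof
    have "emeasure \<mu> K < \<infinity>" using radon K(1) by (simp add: radon_measure_def)
    then show "emeasure \<tau> (space \<tau>) \<noteq> \<infinity>" unfolding \<tau>_mass by simp
  qed
  interpret \<tau>: finite_measure \<tau> by (rule \<tau>_fin)
  have \<tau>_sf: "sigma_finite_measure \<tau>" by unfold_locales
  have AE_\<tau>: "AE x in \<tau>. P x" if "AE x in \<mu>. P x" for P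
    unfolding \<tau>_def using that by (subst AE_density) (auto elim!: eventually_mono)
  have AE_K: "AE x in \<tau>. x \<in> K"
    unfolding \<tau>_def by (subst AE_density) (auto split: split_indicator)
  have kato: "kato \<tau>" using K(4) by (simp add: \<tau>_def)
  note lim = kato_weak_limit[OF \<tau>_fin \<tau>_sets kato \<rho>' \<rho> conv]
  have swap: "(\<integral>\<^sup>+x. ennreal N * pot M x \<partial>\<tau>) = ennreal N * (\<integral>\<^sup>+x. pot \<tau> x \<partial>M)"
    if M: "prob_space M" "sets M = sets borel" for M
  proof -
    have [measurable]: "pot M \<in> borel_measurable borel" using M sf by (auto intro: measurable_potential)
    show ?thesis
      by (subst nn_integral_cmult)
        (auto simp: nn_integral_potential_swap[OF \<tau>_sf sf[OF M(1)] \<tau>_sets M(2)])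
  qed
  \<comment> \<open>Fatou handles the moving pole: the kernels converge pointwise, the value
    \<infinity> at x = y included.\<close>
  have "(\<integral>\<^sup>+x. kern x y \<partial>\<tau>) = (\<integral>\<^sup>+x. liminf (\<lambda>j. kern x (Y j)) \<partial>\<tau>)"
  proof (intro nn_integral_cong)
    fix x
    have "(\<lambda>j. kern x (Y j)) \<longlonglongrightarrow> kern x y" by (intro tendsto_kern tendsto_const y)
    then show "kern x y = liminf (\<lambda>j. kern x (Y j))" by (simp add: lim_imp_Liminf)
  qed
  also have "\<dots> \<le> liminf (\<lambda>j. \<integral>\<^sup>+x. kern x (Y j) \<partial>\<tau>)"
    by (rule nn_integral_liminf) measurable
  also have "\<dots> \<le> liminf (\<lambda>j. ennreal N * (\<integral>\<^sup>+x. pot \<tau> x \<partial>\<rho>' j))"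
  proof (intro Liminf_mono always_eventually allI)
    fix j
    have "(\<integral>\<^sup>+x. kern x (Y j) \<partial>\<tau>) \<le> (\<integral>\<^sup>+x. ennreal N * pot (\<rho>' j) x \<partial>\<tau>)"
      by (intro nn_integral_mono_AE AE_\<tau> dom)
    then show "(\<integral>\<^sup>+x. kern x (Y j) \<partial>\<tau>) \<le> ennreal N * (\<integral>\<^sup>+x. pot \<tau> x \<partial>\<rho>' j)" unfolding swap[OF \<rho>'] .
  qed
  also have "\<dots> = ennreal N * (\<integral>\<^sup>+x. pot \<tau> x \<partial>\<rho>)"
    by (intro lim_imp_Liminf ennreal_tendsto_cmult lim) auto
  also have "\<dots> = (\<integral>\<^sup>+x. ennreal N * pot \<rho> x \<partial>\<tau>)" by (rule swap[OF \<rho>, symmetric])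
  finally have le: "(\<integral>\<^sup>+x. kern x y \<partial>\<tau>) \<le> (\<integral>\<^sup>+x. ennreal N * pot \<rho> x \<partial>\<tau>)" .
  have less: "AE x in \<tau>. ennreal N * pot \<rho> x < kern x y"
    using AE_K by eventually_elim (use K(2) in \<open>auto simp: B_def\<close>)
  \<comment> \<open>The integrals are ordered against the pointwise strict inequality. As the
    integral of the smaller function is finite, the two agree almost everywhere, which is absurd
    since \<open>\<tau>\<close> has positive mass.\<close>
  have "AE x in \<tau>. ennreal N * pot \<rho> x = kern x y"
  proof (rule AE_eq_of_nn_integral_eq)
    show le': "AE x in \<tau>. ennreal N * pot \<rho> x \<le> kern x y" using less by eventually_elim simp
    show "(\<integral>\<^sup>+x. ennreal N * pot \<rho> x \<partial>\<tau>) = (\<integral>\<^sup>+x. kern x y \<partial>\<tau>)"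
      by (intro antisym le nn_integral_mono_AE le')
    show "(\<integral>\<^sup>+x. ennreal N * pot \<rho> x \<partial>\<tau>) < \<infinity>"
      unfolding swap[OF \<rho>] using lim(2) by (simp add: ennreal_mult_less_top)
  qed measurable
  with less have "AE x in \<tau>. False" by eventually_elim simp
  then have "emeasure \<tau> (space \<tau>) = 0" by (simp add: AE_iff_measurable[OF _ refl])
  with \<tau>_mass K(3) show False by simp
qed

end

subsection \<open>Averages over Lebesgue balls\<close>

text \<open>Serves to add a point mass to a truncated witness.\<close>

lemma ex_measure_add:
  fixes \<mu> \<nu> :: "'b measure"
  assumes sets: "sets \<nu> = sets \<mu>"
  obtains \<tau> where "sets \<tau> = sets \<mu>" "\<And>X. X \<in> sets \<mu> \<Longrightarrow> emeasure \<tau> X = emeasure \<mu> X + emeasure \<nu> X"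
    "\<And>f. f \<in> borel_measurable \<mu> \<Longrightarrow> (\<integral>\<^sup>+x. f x \<partial>\<tau>) = (\<integral>\<^sup>+x. f x \<partial>\<mu>) + (\<integral>\<^sup>+x. f x \<partial>\<nu>)"
proof -
  define \<tau> where "\<tau> = measure_of (space \<mu>) (sets \<mu>) (\<lambda>X. emeasure \<mu> X + emeasure \<nu> X)"
  have s: "sets \<tau> = sets \<mu>" by (simp add: \<tau>_def)
  have em: "emeasure \<tau> X = emeasure \<mu> X + emeasure \<nu> X" if "X \<in> sets \<mu>" for X
    unfolding \<tau>_def
  proof (rule emeasure_measure_of_sigma)
    show "sigma_algebra (space \<mu>) (sets \<mu>)" by (rule sets.sigma_algebra_axioms)
    show "positive (sets \<mu>) (\<lambda>X. emeasure \<mu> X + emeasure \<nu> X)" by (simp add: positive_def)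
    show "countably_additive (sets \<mu>) (\<lambda>X. emeasure \<mu> X + emeasure \<nu> X)"
    proof (rule countably_additiveI)
      fix A :: "nat \<Rightarrow> 'b set" assume A: "range A \<subseteq> sets \<mu>" "disjoint_family A" "\<Union> (range A) \<in> sets \<mu>"
      then have "range A \<subseteq> sets \<nu>" by (simp add: sets)
      with A show "(\<Sum>i. emeasure \<mu> (A i) + emeasure \<nu> (A i)) = emeasure \<mu> (\<Union> (range A)) + emeasure \<nu> (\<Union> (range A))"
        by (simp add: suminf_add[symmetric] suminf_emeasure)
    qed
  qed (rule that)
  have "(\<integral>\<^sup>+x. f x \<partial>\<tau>) = (\<integral>\<^sup>+x. f x \<partial>\<mu>) + (\<integral>\<^sup>+x. f x \<partial>\<nu>)" if "f \<in> borel_measurable \<mu>" for f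
    using that
  proof (induction f rule: borel_measurable_induct)
    case (cong f g)
    have "space \<tau> = space \<mu>" "space \<nu> = space \<mu>"
      using sets_eq_imp_space_eq[OF s] sets_eq_imp_space_eq[OF sets] by auto
    with cong show ?case by (simp cong: nn_integral_cong_simp)
  next
    case (set A)
    then show ?case using em s sets by simp
  next
    case (mult u c)
    then have "u \<in> borel_measurable \<nu>" "u \<in> borel_measurable \<tau>"
      using s sets by (simp_all cong: measurable_cong_sets)
    with mult show ?case by (simp add: nn_integral_cmult distrib_left)
  next
    case (add u v)
    then have "u \<in> borel_measurable \<nu>" "u \<in> borel_measurable \<tau>" "v \<in> borel_measurable \<nu>" "v \<in> borel_measurable \<tau>"
      using s sets by (simp_all cong: measurable_cong_sets)
    with add show ?case by (simp add: nn_integral_add add_ac)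
  next
    case (seq U)
    then have m: "\<And>i. U i \<in> borel_measurable \<nu>" "\<And>i. U i \<in> borel_measurable \<tau>"
      using s sets by (simp_all cong: measurable_cong_sets)
    have inc: "incseq (\<lambda>i. integral\<^sup>N M (U i))" for M :: "'b measure"
      using seq(3) by (auto simp: incseq_def le_fun_def intro!: nn_integral_mono)
    have "(\<integral>\<^sup>+x. (SUP i. U i x) \<partial>\<tau>) = (SUP i. integral\<^sup>N \<mu> (U i) + integral\<^sup>N \<nu> (U i))"
      using nn_integral_monotone_convergence_SUP[OF seq(3) m(2)] seq.IH by simp
    also have "\<dots> = (SUP i. integral\<^sup>N \<mu> (U i)) + (SUP i. integral\<^sup>N \<nu> (U i))"
      by (rule ennreal_SUP_add[OF inc inc])
    also have "\<dots> = (\<integral>\<^sup>+x. (SUP i. U i x) \<partial>\<mu>) + (\<integral>\<^sup>+x. (SUP i. U i x) \<partial>\<nu>)"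
      using nn_integral_monotone_convergence_SUP[OF seq(3)] seq(1) m(1) by simp
    finally show ?case by (simp add: image_image SUP_apply)
  qed
  with s em that show ?thesis by blast
qed

context riesz_exponent
begin

text \<open>Left unnormalized: in a strict inequality between averages both sides carry the same
  volume factor.\<close>

definition leb_ball :: "nat \<Rightarrow> 'a measure" where
  "leb_ball k = density lborel (indicator (ball 0 (1 / real (Suc k))))"

lemma sets_leb_ball [simp, measurable_cong]: "sets (leb_ball k) = sets borel"
  by (simp add: leb_ball_def)

lemma nn_integral_leb_ball:
  assumes [measurable]: "f \<in> borel_measurable borel"
  shows "(\<integral>\<^sup>+w. f w \<partial>leb_ball k) = (\<integral>\<^sup>+w. indicator (ball 0 (1 / real (Suc k))) w * f w \<partial>lborel)"
  unfolding leb_ball_def by (rule nn_integral_density) measurable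

lemma finite_leb_ball: "finite_measure (leb_ball k)"
proof
  have "emeasure (leb_ball k) (space (leb_ball k)) = emeasure lborel (ball (0::'a) (1 / real (Suc k)))"
    by (simp add: leb_ball_def emeasure_density)
  also have "\<dots> \<noteq> \<infinity>" by (simp add: emeasure_ball)
  finally show "emeasure (leb_ball k) (space (leb_ball k)) \<noteq> \<infinity>" .
qed

lemma radon_finite_measure: "finite_measure \<mu> \<Longrightarrow> sets \<mu> = sets borel \<Longrightarrow> radon_measure (\<mu> :: 'a measure)"
proof -
  assume "finite_measure \<mu>" "sets \<mu> = sets borel"
  interpret finite_measure \<mu> by fact
  show ?thesis using \<open>sets \<mu> = sets borel\<close> by (auto simp: radon_measure_def less_top[symmetric])
qed

text \<open>By translation invariance the Lebesgue integral of the kernel over a ball about its pole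
  does not depend on the pole, so smallness at the origin suffices. There it follows from local
  integrability.\<close>

lemma kato_leb_ball: "kato (leb_ball k)"
  unfolding kato_def
proof (intro allI impI)
  fix \<epsilon> :: real assume \<epsilon>: "0 < \<epsilon>"
  have "pot (leb_ball 0) 0 < \<infinity>"
    using kern_locally_integrable[of 0] unfolding potential_def
    by (subst nn_integral_leb_ball) (simp_all add: mult.commute riesz_kernel_commute[of \<alpha> 0])
  from near_potential_tendsto_0[OF radon_finite_measure[OF finite_leb_ball sets_leb_ball] this]
  have "(\<lambda>m. \<integral>\<^sup>+z. kern 0 z * indicator (ball 0 (1 / real (Suc m))) z \<partial>leb_ball 0) \<longlonglongrightarrow> 0" .
  from order_tendstoD(2)[OF this, of "ennreal \<epsilon>"] \<epsilon>
  obtain m where m: "(\<integral>\<^sup>+z. kern 0 z * indicator (ball 0 (1 / real (Suc m))) z \<partial>leb_ball 0) < ennreal \<epsilon>"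
    by (auto simp: eventually_sequentially)
  let ?d = "1 / real (Suc m)"
  have sub: "ball (0::'a) ?d \<subseteq> ball 0 1" by (rule subset_ball) simp
  have "(\<integral>\<^sup>+z. kern x z * indicator (ball x ?d) z \<partial>leb_ball k) \<le> ennreal \<epsilon>" for x
  proof -
    have "(\<integral>\<^sup>+z. kern x z * indicator (ball x ?d) z \<partial>leb_ball k) \<le> (\<integral>\<^sup>+z. kern z x * indicator (ball x ?d) z \<partial>lborel)"
      by (subst nn_integral_leb_ball)
        (auto intro!: nn_integral_mono simp: riesz_kernel_commute[of \<alpha> x] split: split_indicator)
    also have "\<dots> = (\<integral>\<^sup>+z. kern z 0 * indicator (ball 0 ?d) z \<partial>lborel)" by (rule nn_integral_kern_ball)
    also have "\<dots> = (\<integral>\<^sup>+z. kern 0 z * indicator (ball 0 ?d) z \<partial>leb_ball 0)"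
      using sub by (subst nn_integral_leb_ball)
        (auto intro!: nn_integral_cong simp: riesz_kernel_commute[of \<alpha> 0] split: split_indicator)
    finally show ?thesis using m by simp
  qed
  moreover have "0 < ?d" by simp
  ultimately show "\<exists>\<delta>>0. \<forall>x. (\<integral>\<^sup>+z. kern x z * indicator (ball x \<delta>) z \<partial>leb_ball k) \<le> ennreal \<epsilon>" by blast
qed

text \<open>By symmetry of the kernel, \<open>avg k (z - q)\<close> is the integral of the kernel
  with pole z over the ball of radius 1/(k+1) about q.\<close>

definition avg :: "nat \<Rightarrow> 'a \<Rightarrow> real" where "avg k z = enn2real (pot (leb_ball k) z)"

lemma avg_properties:
  "continuous_on UNIV (avg k)" "bounded (range (avg k))" "0 \<le> avg k z" "pot (leb_ball k) z = ennreal (avg k z)"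
proof -
  obtain f where f: "continuous_on UNIV f" "bounded (range f)" "\<And>x. 0 \<le> f x" "\<And>x. pot (leb_ball k) x = ennreal (f x)"
    using kato_potential_continuous[OF finite_leb_ball sets_leb_ball kato_leb_ball] by blast
  have "avg k = f" using f by (auto simp: avg_def)
  with f show "continuous_on UNIV (avg k)" "bounded (range (avg k))" "0 \<le> avg k z"
    "pot (leb_ball k) z = ennreal (avg k z)" by auto
qed

lemma measurable_avg [measurable]: "avg k \<in> borel_measurable borel"
  by (rule borel_measurable_continuous_onI[OF avg_properties(1)])

lemma avg_shift: "ennreal (avg k (z - q)) = (\<integral>\<^sup>+w. kern (q + w) z \<partial>leb_ball k)"
proof -
  have "kern (z - q) w = kern (q + w) z" for w
    using kern_translate[of q "z - q" w] by (simp add: riesz_kernel_commute)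
  then show ?thesis by (simp add: avg_properties(4)[symmetric] potential_def)
qed

lemma integrable_avg:
  assumes "finite_measure \<rho>" "sets \<rho> = sets borel"
  shows "integrable \<rho> (\<lambda>z. avg k (z - q))"
proof -
  interpret finite_measure \<rho> by fact
  have [measurable_cong]: "sets \<rho> = sets borel" by fact
  obtain C where "\<And>z. norm (avg k z) \<le> C" using avg_properties(2)[of k] by (auto simp: bounded_iff)
  then show ?thesis by (intro integrable_const_bound[of _ C]) auto
qed

lemma nn_integral_avg:
  assumes "finite_measure \<rho>" "sets \<rho> = sets borel"
  shows "ennreal (\<integral>z. avg k (z - q) \<partial>\<rho>) = (\<integral>\<^sup>+w. pot \<rho> (q + w) \<partial>leb_ball k)"
proof -
  interpret finite_measure \<rho> by fact
  interpret L: finite_measure "leb_ball k" by (rule finite_leb_ball)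
  interpret pair_sigma_finite \<rho> "leb_ball k" ..
  have [measurable_cong]: "sets \<rho> = sets borel" by fact
  have "ennreal (\<integral>z. avg k (z - q) \<partial>\<rho>) = (\<integral>\<^sup>+z. ennreal (avg k (z - q)) \<partial>\<rho>)"
    using avg_properties(3) by (intro nn_integral_eq_integral[symmetric] integrable_avg assms) auto
  also have "\<dots> = (\<integral>\<^sup>+z. (\<integral>\<^sup>+w. kern (q + w) z \<partial>leb_ball k) \<partial>\<rho>)" by (simp only: avg_shift)
  also have "\<dots> = (\<integral>\<^sup>+w. (\<integral>\<^sup>+z. kern (q + w) z \<partial>\<rho>) \<partial>leb_ball k)"
    by (rule Fubini'[symmetric]) measurable
  finally show ?thesis by (simp only: potential_def)
qed

lemma average_less_imp_less:
  fixes \<rho> :: "'a measure"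
  assumes \<rho>: "finite_measure \<rho>" "sets \<rho> = sets borel" and "0 \<le> N"
    and less: "N * (\<integral>z. avg k (z - q) \<partial>\<rho>) < avg k (y - q)"
  shows "\<exists>x. ennreal N * pot \<rho> x < kern x y"
proof (rule ccontr)
  assume "\<not> ?thesis"
  then have le: "kern x y \<le> ennreal N * pot \<rho> x" for x by (simp add: not_less)
  interpret finite_measure \<rho> by fact
  have [measurable]: "pot \<rho> \<in> borel_measurable borel"
    by (rule radon_potential_measurable[OF radon_finite_measure[OF \<rho>]])
  have "ennreal (avg k (y - q)) \<le> (\<integral>\<^sup>+w. ennreal N * pot \<rho> (q + w) \<partial>leb_ball k)"
    unfolding avg_shift by (intro nn_integral_mono le)
  also have "\<dots> = ennreal N * (\<integral>\<^sup>+w. pot \<rho> (q + w) \<partial>leb_ball k)"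
    by (rule nn_integral_cmult) measurable
  also have "\<dots> = ennreal (N * (\<integral>z. avg k (z - q) \<partial>\<rho>))"
    unfolding nn_integral_avg[OF \<rho>, symmetric] using \<open>0 \<le> N\<close> by (simp add: ennreal_mult')
  finally have "avg k (y - q) \<le> N * (\<integral>z. avg k (z - q) \<partial>\<rho>)"
    using \<open>0 \<le> N\<close> avg_properties(3)
    by (subst (asm) ennreal_le_iff) (auto intro!: mult_nonneg_nonneg Bochner_Integration.integral_nonneg)
  with less show False by simp
qed

text \<open>A bound uniform in r, which supplies the majorant when averages are integrated against a
  measure. For r small compared with |x - z| the kernel grows by at most the factor 2^p on the ball.
  For larger r, rescaling by 1/r leaves a local integral of the kernel, and r^(-p) is at most 2^p |x
  - z|^(-p).\<close>

lemma nn_integral_kern_ball_le: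
  obtains C where "0 < C" "\<And>x z r. 0 < r \<Longrightarrow>
    (\<integral>\<^sup>+v. indicator (ball 0 1) v * kern (x + r *\<^sub>R v) z \<partial>lborel) \<le> ennreal C * kern x z"
proof -
  define L where "L = enn2real (\<integral>\<^sup>+v. kern v (0::'a) * indicator (ball 0 1) v \<partial>lborel)"
  have L: "(\<integral>\<^sup>+v. kern v (0::'a) * indicator (ball 0 1) v \<partial>lborel) = ennreal L" "0 \<le> L"
    using kern_locally_integrable[of 0] by (simp_all add: L_def)
  define V where "V = unit_ball_vol (real DIM('a))"
  have V: "0 < V" "emeasure lborel (ball (0::'a) 1) = ennreal V" by (simp_all add: V_def emeasure_ball)
  show ?thesis
  proof (rule that[of "2 powr p * (L + V)"])
    show "0 < 2 powr p * (L + V)" using L V by simp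
    fix x z :: 'a and r :: real assume r: "0 < r"
    show "(\<integral>\<^sup>+v. indicator (ball 0 1) v * kern (x + r *\<^sub>R v) z \<partial>lborel) \<le> ennreal (2 powr p * (L + V)) * kern x z"
    proof (cases "x = z")
      case True
      have "ennreal (2 powr p * (L + V)) * kern x z = \<infinity>"
        using True L V by (simp add: riesz_kernel_def ennreal_mult_eq_top_iff)
      then show ?thesis by simp
    next
      case neq: False
      show ?thesis
      proof (cases "2 * r \<le> dist x z")
        case True
        have "(\<integral>\<^sup>+v. indicator (ball 0 1) v * kern (x + r *\<^sub>R v) z \<partial>lborel)
          \<le> (\<integral>\<^sup>+v. (ennreal (2 powr p) * kern x z) * indicator (ball (0::'a) 1) v \<partial>lborel)"
        proof (intro nn_integral_mono)
          fix v :: 'a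
          show "indicator (ball 0 1) v * kern (x + r *\<^sub>R v) z \<le> (ennreal (2 powr p) * kern x z) * indicator (ball 0 1) v"
          proof (cases "norm v < 1")
            case v: True
            have "dist x z \<le> dist x (x + r *\<^sub>R v) + dist (x + r *\<^sub>R v) z" by (rule dist_triangle)
            moreover have "dist x (x + r *\<^sub>R v) \<le> r" using v r by (simp add: dist_norm mult_left_le)
            ultimately have "dist x z \<le> 2 * dist (x + r *\<^sub>R v) z" using True by linarith
            then have "kern (x + r *\<^sub>R v) z \<le> ennreal (2 powr p) * kern x z"
              by (intro kern_scale_mono) auto
            with v show ?thesis by simp
          qed simp
        qed
        also have "\<dots> = ennreal (2 powr p) * kern x z * ennreal V"
          by (subst nn_integral_cmult_indicator) (auto simp: V)
        also have "\<dots> = ennreal (2 powr p * V) * kern x z" using V by (simp add: ennreal_mult' mult_ac)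
        also have "\<dots> \<le> ennreal (2 powr p * (L + V)) * kern x z"
          using L V by (intro mult_right_mono ennreal_leI) auto
        finally show ?thesis .
      next
        case False
        \<comment> \<open>The pole z as seen after translating x to 0 and rescaling by 1/r.\<close>
        define u where "u = (1 / r) *\<^sub>R (z - x)"
        have "kern (x + r *\<^sub>R v) z \<le> ennreal ((1 / r) powr p) * kern v u" for v
        proof (rule kern_scale_mono)
          have "v - u = (1 / r) *\<^sub>R (x + r *\<^sub>R v - z)"
            using r by (simp add: u_def algebra_simps)
          then show "dist v u \<le> 1 / r * dist (x + r *\<^sub>R v) z"
            using r by (simp add: dist_norm)
        qed (use r in simp)
        then have "(\<integral>\<^sup>+v. indicator (ball 0 1) v * kern (x + r *\<^sub>R v) z \<partial>lborel)
          \<le> (\<integral>\<^sup>+v. ennreal ((1 / r) powr p) * (kern v u * indicator (ball u 1) v + indicator (ball 0 1) v) \<partial>lborel)"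
        proof (intro nn_integral_mono)
          fix v :: 'a
          assume le: "\<And>v. kern (x + r *\<^sub>R v) z \<le> ennreal ((1 / r) powr p) * kern v u"
          have "indicator (ball 0 1) v * kern v u \<le> kern v u * indicator (ball u 1) v + indicator (ball 0 1) v"
          proof (cases "v \<in> ball u 1")
            case False
            then have d: "1 \<le> dist v u" by (simp add: dist_commute)
            then have "v \<noteq> u" by auto
            have "dist v u powr (- p) \<le> 1 powr (- p)" using d p_pos by (intro powr_mono2') auto
            then have "kern v u \<le> 1" using \<open>v \<noteq> u\<close> by (simp add: kern_off_diagonal)
            then show ?thesis by (simp split: split_indicator)
          qed (simp split: split_indicator)
          then have "ennreal ((1 / r) powr p) * (indicator (ball 0 1) v * kern v u) \<le>
            ennreal ((1 / r) powr p) * (kern v u * indicator (ball u 1) v + indicator (ball 0 1) v)"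
            by (rule mult_left_mono) simp
          moreover have "indicator (ball 0 1) v * kern (x + r *\<^sub>R v) z \<le> indicator (ball 0 1) v * (ennreal ((1 / r) powr p) * kern v u)"
            by (intro mult_left_mono le) simp
          ultimately show "indicator (ball 0 1) v * kern (x + r *\<^sub>R v) z \<le>
            ennreal ((1 / r) powr p) * (kern v u * indicator (ball u 1) v + indicator (ball 0 1) v)"
            by (simp add: mult.left_commute)
        qed
        also have "\<dots> = ennreal ((1 / r) powr p) * (ennreal L + ennreal V)"
          using L(1) V(2) nn_integral_kern_ball[of u 1] by (simp add: nn_integral_cmult nn_integral_add)
        also have "\<dots> = ennreal ((1 / r) powr p * (L + V))" using L V by (simp add: ennreal_mult' ennreal_plus)
        also have "\<dots> \<le> ennreal (2 powr p * (L + V) * dist x z powr (- p))"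
        proof (rule ennreal_leI)
          have "(1 / r) powr p = 2 powr p * (2 * r) powr (- p)"
            using r by (simp add: powr_minus powr_mult powr_divide field_simps)
          also have "\<dots> \<le> 2 powr p * dist x z powr (- p)"
            using False neq p_pos by (intro mult_left_mono powr_mono2') auto
          finally have "(1 / r) powr p * (L + V) \<le> 2 powr p * dist x z powr (- p) * (L + V)"
            using L V by (intro mult_right_mono) auto
          then show "(1 / r) powr p * (L + V) \<le> 2 powr p * (L + V) * dist x z powr (- p)" by (simp add: mult_ac)
        qed
        also have "\<dots> = ennreal (2 powr p * (L + V)) * kern x z"
          using L V neq by (simp add: kern_off_diagonal ennreal_mult')
        finally show ?thesis .
      qed
    qed
  qed
qed

lemma avg_eq_scaled:
  "ennreal (avg k (z - x)) = ennreal ((1 / real (Suc k)) ^ DIM('a)) *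
    (\<integral>\<^sup>+v. indicator (ball 0 1) v * kern (x + (1 / real (Suc k)) *\<^sub>R v) z \<partial>lborel)"
proof -
  let ?r = "1 / real (Suc k)"
  have r: "0 < ?r" by simp
  have ind: "indicator (ball 0 ?r) (?r *\<^sub>R v) = (indicator (ball 0 1) v :: ennreal)" for v :: 'a
  proof -
    have "norm (?r *\<^sub>R v) = ?r * norm v" by simp
    then have "norm (?r *\<^sub>R v) < ?r \<longleftrightarrow> norm v < 1" using mult_less_cancel_left_pos[OF r, of "norm v" 1] by simp
    then show ?thesis by (simp add: indicator_def)
  qed
  have "ennreal (avg k (z - x)) = (\<integral>\<^sup>+w. indicator (ball 0 ?r) w * kern (x + w) z \<partial>lborel)"
    unfolding avg_shift by (rule nn_integral_leb_ball) measurable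
  also have "\<dots> = ennreal (?r ^ DIM('a)) * (\<integral>\<^sup>+v. indicator (ball 0 ?r) (0 + ?r *\<^sub>R v) * kern (x + (0 + ?r *\<^sub>R v)) z \<partial>lborel)"
    by (rule nn_integral_lborel_scale[OF _ r]) measurable
  finally show ?thesis by (simp only: ind add_0)
qed

text \<open>The balls about x are shrunk and rescaled to the unit ball, of volume V. The averages of
  \<open>pot \<rho>\<close> then tend to V times its value at x by dominated convergence, while
  those of the kernel with pole y are asymptotically at least V times \<open>kern x y\<close> by
  Fatou.\<close>

lemma less_imp_average_less:
  fixes \<rho> :: "'a measure"
  assumes \<rho>: "finite_measure \<rho>" "sets \<rho> = sets borel" and N: "0 < N"
    and less: "ennreal N * pot \<rho> x < kern x y"
  shows "\<exists>k. N * (\<integral>z. avg k (z - x) \<partial>\<rho>) < avg k (y - x)"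
proof -
  interpret finite_measure \<rho> by fact
  interpret pair_sigma_finite \<rho> "lborel :: 'a measure" ..
  have [measurable_cong]: "sets \<rho> = sets borel" by fact
  define r where "r k = 1 / real (Suc k)" for k
  have r: "0 < r k" for k by (simp add: r_def)
  have rlim: "r \<longlonglongrightarrow> 0" unfolding r_def using LIMSEQ_inverse_real_of_nat by (simp add: inverse_eq_divide)
  define G where "G k z = (\<integral>\<^sup>+v. indicator (ball 0 1) v * kern (x + r k *\<^sub>R v) z \<partial>lborel)" for k z
  have [measurable]: "G k \<in> borel_measurable borel" for k unfolding G_def by measurable
  define V where "V = emeasure lborel (ball (0::'a) 1)"
  have V: "0 < V" "V < \<infinity>" by (simp_all add: V_def emeasure_ball)
  obtain C where C: "0 < C" "\<And>k z. G k z \<le> ennreal C * kern x z"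
    using nn_integral_kern_ball_le r unfolding G_def by metis
  have pfin: "pot \<rho> x < \<infinity>"
  proof (rule ccontr)
    assume "\<not> pot \<rho> x < \<infinity>"
    then have "pot \<rho> x = \<top>" by (simp add: less_top[symmetric])
    with less N show False by (simp add: ennreal_mult_top)
  qed
  have klim: "(\<lambda>k. kern (x + r k *\<^sub>R v) z) \<longlonglongrightarrow> kern x z" for v z
  proof (rule tendsto_kern)
    have "(\<lambda>k. x + r k *\<^sub>R v) \<longlonglongrightarrow> x + 0 *\<^sub>R v" by (intro tendsto_intros rlim)
    then show "(\<lambda>k. x + r k *\<^sub>R v) \<longlonglongrightarrow> x" by simp
  qed simp
  have indlim: "(\<lambda>k. indicator (ball 0 1) v * kern (x + r k *\<^sub>R v) z) \<longlonglongrightarrow> indicator (ball 0 1) v * kern x z" for v z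
    using klim[of v z] by (cases "v \<in> ball 0 1") auto
  have Vk: "(\<integral>\<^sup>+v. indicator (ball (0::'a) 1) v * kern x z \<partial>lborel) = V * kern x z" for z
    by (subst nn_integral_multc) (auto simp: V_def)
  have Glim: "(\<lambda>k. G k z) \<longlonglongrightarrow> V * kern x z" if z: "x \<noteq> z" for z
  proof -
    \<comment> \<open>In the tail with radius at most |x - z| / 2, points of the ball keep at least
      half the distance from z, which gives the majorant with factor 2^p.\<close>
    obtain M where "1 / real (Suc M) < dist x z / 2" using nat_approx_posE[of "dist x z / 2"] z by auto
    then have M: "r (k + M) \<le> dist x z / 2" for k
    proof -
      have "r (k + M) \<le> 1 / real (Suc M)" unfolding r_def by (intro divide_left_mono) auto
      then show ?thesis using \<open>1 / real (Suc M) < dist x z / 2\<close> by simp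
    qed
    have "(\<lambda>k. G (k + M) z) \<longlonglongrightarrow> (\<integral>\<^sup>+v. indicator (ball (0::'a) 1) v * kern x z \<partial>lborel)"
      unfolding G_def
    proof (rule nn_integral_dominated_convergence[where w="\<lambda>v. indicator (ball 0 1) v * (ennreal (2 powr p) * kern x z)"])
      show "AE v in lborel. indicator (ball 0 1) v * kern (x + r (k + M) *\<^sub>R v) z \<le>
        indicator (ball 0 1) v * (ennreal (2 powr p) * kern x z)" for k
      proof (intro always_eventually allI)
        fix v
        show "indicator (ball 0 1) v * kern (x + r (k + M) *\<^sub>R v) z \<le> indicator (ball 0 1) v * (ennreal (2 powr p) * kern x z)"
        proof (cases "norm v < 1")
          case v: True
          have "dist x z \<le> dist x (x + r (k + M) *\<^sub>R v) + dist (x + r (k + M) *\<^sub>R v) z" by (rule dist_triangle)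
          moreover have "dist x (x + r (k + M) *\<^sub>R v) \<le> r (k + M)"
            using v r[of "k + M"] by (simp add: dist_norm mult_left_le)
          ultimately have "dist x z \<le> 2 * dist (x + r (k + M) *\<^sub>R v) z" using M[of k] by linarith
          then have "kern (x + r (k + M) *\<^sub>R v) z \<le> ennreal (2 powr p) * kern x z"
            by (intro kern_scale_mono) auto
          with v show ?thesis by simp
        qed simp
      qed
      show "(\<integral>\<^sup>+v. indicator (ball (0::'a) 1) v * (ennreal (2 powr p) * kern x z) \<partial>lborel) < \<infinity>"
        using V z by (subst nn_integral_multc) (auto simp: V_def[symmetric] kern_off_diagonal ennreal_mult_less_top)
      show "AE v in lborel. (\<lambda>k. indicator (ball 0 1) v * kern (x + r (k + M) *\<^sub>R v) z) \<longlonglongrightarrow>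
          indicator (ball 0 1) v * kern x z"
        using LIMSEQ_ignore_initial_segment[OF indlim] by (intro always_eventually allI)
    qed measurable
    then show ?thesis unfolding Vk by (rule LIMSEQ_offset)
  qed
  have "AE z in \<rho>. kern x z \<noteq> \<infinity>"
    using pfin unfolding potential_def by (intro nn_integral_PInf_AE) auto
  then have neq: "AE z in \<rho>. x \<noteq> z" by eventually_elim (auto simp: riesz_kernel_def)
  have "(\<lambda>k. \<integral>\<^sup>+z. G k z \<partial>\<rho>) \<longlonglongrightarrow> (\<integral>\<^sup>+z. V * kern x z \<partial>\<rho>)"
  proof (rule nn_integral_dominated_convergence[where w="\<lambda>z. ennreal C * kern x z"])
    show "AE z in \<rho>. (\<lambda>k. G k z) \<longlonglongrightarrow> V * kern x z" using neq by eventually_elim (rule Glim)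
    have "(\<integral>\<^sup>+z. ennreal C * kern x z \<partial>\<rho>) = ennreal C * pot \<rho> x"
      unfolding potential_def by (rule nn_integral_cmult) measurable
    then show "(\<integral>\<^sup>+z. ennreal C * kern x z \<partial>\<rho>) < \<infinity>" using pfin by (simp add: ennreal_mult_less_top)
  qed (use C in auto)
  also have "(\<integral>\<^sup>+z. V * kern x z \<partial>\<rho>) = V * pot \<rho> x"
    unfolding potential_def by (rule nn_integral_cmult) measurable
  finally have "(\<lambda>k. ennreal N * (\<integral>\<^sup>+z. G k z \<partial>\<rho>)) \<longlonglongrightarrow> ennreal N * (V * pot \<rho> x)"
    by (intro ennreal_tendsto_cmult) auto
  then have lim: "(\<lambda>k. ennreal N * (\<integral>\<^sup>+z. G k z \<partial>\<rho>)) \<longlonglongrightarrow> V * (ennreal N * pot \<rho> x)"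
    by (simp add: mult.left_commute)
  have "V * (ennreal N * pot \<rho> x) < V * kern x y"
    using less V by (intro ennreal_mult_strict_left_mono) (auto simp: less_top)
  \<comment> \<open>For x = y the right-hand side is \<infinity>, so the two limits are separated by
    an intermediate value and not by a difference.\<close>
  then obtain c where c: "V * (ennreal N * pot \<rho> x) < c" "c < V * kern x y" using dense by blast
  have "V * kern x y = (\<integral>\<^sup>+v. liminf (\<lambda>k. indicator (ball 0 1) v * kern (x + r k *\<^sub>R v) y) \<partial>lborel)"
    unfolding Vk[symmetric] by (intro nn_integral_cong lim_imp_Liminf[symmetric] indlim) simp
  also have "\<dots> \<le> liminf (\<lambda>k. G k y)" unfolding G_def by (rule nn_integral_liminf) measurable
  finally have "c < liminf (\<lambda>k. G k y)" using c(2) by (rule less_le_trans[rotated])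
  then have "\<forall>\<^sub>F k in sequentially. c < G k y" by (rule less_LiminfD)
  moreover have "\<forall>\<^sub>F k in sequentially. ennreal N * (\<integral>\<^sup>+z. G k z \<partial>\<rho>) < c"
    using order_tendstoD(2)[OF lim c(1)] .
  ultimately have "\<forall>\<^sub>F k in sequentially. ennreal N * (\<integral>\<^sup>+z. G k z \<partial>\<rho>) < G k y"
    by eventually_elim (rule less_trans)
  then obtain k where k: "ennreal N * (\<integral>\<^sup>+z. G k z \<partial>\<rho>) < G k y" by (auto simp: eventually_sequentially)
  let ?c = "ennreal (r k ^ DIM('a))"
  have avgG: "ennreal (avg k (z - x)) = ?c * G k z" for z
    unfolding G_def r_def by (rule avg_eq_scaled)
  have "ennreal (N * (\<integral>z. avg k (z - x) \<partial>\<rho>)) = ennreal N * (\<integral>\<^sup>+z. ennreal (avg k (z - x)) \<partial>\<rho>)"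
    using N avg_properties(3) nn_integral_eq_integral[OF integrable_avg[OF \<rho>, of k x]] by (simp add: ennreal_mult')
  also have "\<dots> = ?c * (ennreal N * (\<integral>\<^sup>+z. G k z \<partial>\<rho>))"
    unfolding avgG by (subst nn_integral_cmult) (auto simp: mult.left_commute)
  also have "\<dots> < ?c * G k y"
    using k r[of k] by (intro ennreal_mult_strict_left_mono) auto
  also have "\<dots> = ennreal (avg k (y - x))" by (simp add: avgG)
  finally have "N * (\<integral>z. avg k (z - x) \<partial>\<rho>) < avg k (y - x)"
    using avg_properties(3)[of k "y - x"] by (subst (asm) ennreal_less_iff)
      (use N avg_properties(3) in \<open>auto intro!: mult_nonneg_nonneg Bochner_Integration.integral_nonneg\<close>)
  then show ?thesis by blast
qed

text \<open>Makes the strict inequality between averages an open condition on the centre q, which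
  can thus be chosen in a countable dense set.\<close>

lemma continuous_avg_integral:
  fixes \<rho> :: "'a measure"
  assumes \<rho>: "finite_measure \<rho>" "sets \<rho> = sets borel"
  shows "continuous_on UNIV (\<lambda>q. \<integral>z. avg k (z - q) \<partial>\<rho>)"
  unfolding continuous_on_sequentially
proof (intro allI ballI impI, elim conjE)
  interpret finite_measure \<rho> by fact
  have [measurable_cong]: "sets \<rho> = sets borel" by fact
  obtain C where C: "\<And>z. norm (avg k z) \<le> C" using avg_properties(2)[of k] by (auto simp: bounded_iff)
  fix X and a :: 'a assume X: "X \<longlonglongrightarrow> a"
  show "((\<lambda>q. \<integral>z. avg k (z - q) \<partial>\<rho>) \<circ> X) \<longlonglongrightarrow> (\<integral>z. avg k (z - a) \<partial>\<rho>)"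
    unfolding comp_def
  proof (rule integral_dominated_convergence[where w="\<lambda>_. C"])
    show "AE z in \<rho>. (\<lambda>i. avg k (z - X i)) \<longlonglongrightarrow> avg k (z - a)"
    proof (intro always_eventually allI)
      fix z
      have "(\<lambda>i. z - X i) \<longlonglongrightarrow> z - a" by (intro tendsto_intros X)
      then show "(\<lambda>i. avg k (z - X i)) \<longlonglongrightarrow> avg k (z - a)"
        using continuous_on_tendsto_compose[OF avg_properties(1)] by auto
    qed
  qed (use C in auto)
qed

end

subsection \<open>Borel measurability of the set of irregular points\<close>

context riesz_exponent
begin

definition irregular_at :: "'a set \<Rightarrow> 'a \<Rightarrow> bool" where
  "irregular_at A y \<longleftrightarrow> (\<exists>\<nu>\<in>Mplus \<alpha>. nearly_everywhere \<alpha> A (\<lambda>x. kern x y \<le> pot \<nu> x) \<and> (\<exists>x. pot \<nu> x < kern x y))"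

lemma nearly_everywhere_mono:
  assumes "nearly_everywhere \<alpha> A P" "\<And>x. P x \<Longrightarrow> Q x"
  shows "nearly_everywhere \<alpha> (A :: 'a set) Q"
  using assms unfolding nearly_everywhere_def by blast

text \<open>The mass of a witness outside a large ball is replaced by a point mass on the sphere of radius
  \<open>R\<close> about the point where the witness is small. The size of the point mass is chosen so that its
  potential beats that of the removed mass inside the ball and the kernel outside, while at the
  centre it tends to \<open>0\<close> as \<open>R\<close> grows.\<close>

lemma irregular_witness_compact:
  assumes \<nu>: "\<nu> \<in> Mplus \<alpha>" and ne: "nearly_everywhere \<alpha> A (\<lambda>x. kern x y \<le> pot \<nu> x)"
    and less: "pot \<nu> x0 < kern x0 y"
  obtains N R :: nat and \<rho> where "0 < N" "prob_space \<rho>" "sets \<rho> = sets borel" "AE x in \<rho>. x \<in> cball 0 (real R)"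
    "nearly_everywhere \<alpha> A (\<lambda>x. kern x y \<le> ennreal (real N) * pot \<rho> x)" "ennreal (real N) * pot \<rho> x0 < kern x0 y"
proof -
  have radon: "radon_measure \<nu>" using \<nu> by (simp add: Mplus_def)
  have sets: "sets \<nu> = sets borel" using radon by (simp add: radon_measure_def)
  note [measurable_cong] = sets
  have sp: "space \<nu> = UNIV" using sets_eq_imp_space_eq[OF sets] by simp
  have [measurable]: "cball c s \<in> sets borel" for c :: 'a and s by simp
  define C where "C = (2::real) powr p"
  have C: "1 \<le> C" using p_pos unfolding C_def by (intro ge_one_powr_ge_zero) auto
  have C4: "(4::real) powr p = C * C"
    unfolding C_def using powr_mult[of 2 2 p] by simp
  have pfin: "pot \<nu> x0 < \<infinity>" using less by (rule less_le_trans) simp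
  define T where "T m = (\<integral>\<^sup>+z. kern x0 z * indicator (- cball x0 (2 * real m)) z \<partial>\<nu>)" for m :: nat
  have Tlim: "T \<longlonglongrightarrow> 0"
  proof -
    have "T \<longlonglongrightarrow> (\<integral>\<^sup>+z. 0 \<partial>\<nu>)"
      unfolding T_def
    proof (rule nn_integral_dominated_convergence[where w="kern x0"])
      show "AE z in \<nu>. (\<lambda>m. kern x0 z * indicator (- cball x0 (2 * real m)) z) \<longlonglongrightarrow> 0"
      proof (intro always_eventually allI)
        fix z
        obtain M :: nat where M: "dist x0 z \<le> real M" using real_arch_simple by blast
        have "kern x0 z * indicator (- cball x0 (2 * real m)) z = 0" if "M \<le> m" for m
        proof -
          have "real M \<le> 2 * real m" using that by simp
          then show ?thesis using M by simp
        qed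
        then show "(\<lambda>m. kern x0 z * indicator (- cball x0 (2 * real m)) z) \<longlonglongrightarrow> 0"
          by (intro tendsto_eventually eventually_sequentiallyI[of M])
      qed
      show "AE z in \<nu>. kern x0 z * indicator (- cball x0 (2 * real m)) z \<le> kern x0 z" for m
        by (intro always_eventually allI) (simp split: split_indicator)
      show "(\<integral>\<^sup>+z. kern x0 z \<partial>\<nu>) < \<infinity>" using pfin by (simp add: potential_def)
    qed measurable
    then show ?thesis by simp
  qed
  have plim: "(\<lambda>m. real m powr (- p)) \<longlonglongrightarrow> 0"
    using tendsto_neg_powr[OF _ filterlim_real_sequentially, of "- p"] p_pos by simp
  \<comment> \<open>The bracket anticipates the point mass added below: with R = m and t =
    \<open>T m\<close> its weight is at most C t (2R)^p + C^2 + 1, and the kernel between its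
    position and \<open>x0\<close> is R^(-p).\<close>
  have "(\<lambda>m. pot \<nu> x0 + (ennreal (C * C) * T m + ennreal ((C * C + 1) * real m powr (- p))))
     \<longlonglongrightarrow> pot \<nu> x0 + (ennreal (C * C) * 0 + ennreal ((C * C + 1) * 0))"
    by (intro tendsto_add tendsto_const ennreal_tendsto_cmult Tlim tendsto_ennrealI tendsto_mult plim) simp
  then have "\<forall>\<^sub>F m in sequentially. pot \<nu> x0 + (ennreal (C * C) * T m + ennreal ((C * C + 1) * real m powr (- p))) < kern x0 y"
    using less by (intro order_tendstoD(2)) auto
  moreover have "\<forall>\<^sub>F m in sequentially. 2 * dist x0 y + 1 \<le> real m"
    by (meson eventually_sequentiallyI le_trans nat_ceiling_le_eq)
  ultimately have "\<forall>\<^sub>F m in sequentially. pot \<nu> x0 + (ennreal (C * C) * T m + ennreal ((C * C + 1) * real m powr (- p))) < kern x0 y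
     \<and> 2 * dist x0 y + 1 \<le> real m" by (rule eventually_conj)
  then obtain m where m: "pot \<nu> x0 + (ennreal (C * C) * T m + ennreal ((C * C + 1) * real m powr (- p))) < kern x0 y"
    and m_ge: "2 * dist x0 y + 1 \<le> real m" by (auto simp: eventually_sequentially)
  define R where "R = real m"
  have R: "1 \<le> R" "2 * dist x0 y \<le> R" using m_ge zero_le_dist[of x0 y] unfolding R_def by linarith+
  have "T m \<le> pot \<nu> x0"
    unfolding T_def potential_def by (intro nn_integral_mono) (simp split: split_indicator)
  then have "T m < \<infinity>" using pfin by (rule le_less_trans)
  define t where "t = enn2real (T m)"
  have t: "T m = ennreal t" "0 \<le> t" using \<open>T m < \<infinity>\<close> by (simp_all add: t_def)
  define a where "a = enn2real (emeasure \<nu> (cball x0 (2 * R)))"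
  have "emeasure \<nu> (cball x0 (2 * R)) < \<infinity>" using radon by (simp add: radon_measure_def)
  then have a: "emeasure \<nu> (cball x0 (2 * R)) = ennreal a" "0 \<le> a" by (simp_all add: a_def)
  \<comment> \<open>The first term pays for the removed mass at points x of the ball, whose distance
    from \<open>b\<close> is at most 2R. The second pays for the kernel outside, where x is at most
    four times as far from \<open>b\<close> as from y, and C^2 = 4^p.\<close>
  define m0 where "m0 = C * t * (2 * R) powr p + C * C"
  have m0: "1 \<le> m0" unfolding m0_def using C t mult_mono[of 1 C 1 C] by (simp add: add_increasing)
  \<comment> \<open>Rounding the total mass up to an integer keeps the possible masses countable;
    the point mass \<open>M\<close> exceeds \<open>m0\<close> by at most 1.\<close>
  define N where "N = nat \<lceil>a + m0\<rceil>"
  define M where "M = real N - a"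
  have N_real: "real N = of_int \<lceil>a + m0\<rceil>" using a m0 by (simp add: N_def)
  have M: "m0 \<le> M" "M \<le> m0 + 1" unfolding M_def N_real by linarith+
  have N: "0 < N" using M m0 a by (simp add: M_def)
  obtain e :: 'a where e: "e \<in> Basis" using nonempty_Basis by blast
  define b where "b = x0 + R *\<^sub>R e"
  have b: "dist x0 b = R" using e R by (simp add: b_def dist_norm)
  have "x0 \<noteq> b" using b R by auto
  define \<nu>1 where "\<nu>1 = density \<nu> (indicator (cball x0 (2 * R)))"
  have s1: "sets \<nu>1 = sets borel" by (simp add: \<nu>1_def sets)
  have em1: "emeasure \<nu>1 X = emeasure \<nu> (cball x0 (2 * R) \<inter> X)" if "X \<in> sets borel" for X
    unfolding \<nu>1_def using that sets by (simp add: emeasure_density nn_integral_indicator flip: indicator_inter_arith)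
  have pot1: "pot \<nu>1 x = (\<integral>\<^sup>+z. indicator (cball x0 (2 * R)) z * kern x z \<partial>\<nu>)" for x
    unfolding potential_def \<nu>1_def by (rule nn_integral_density) measurable
  have "sets (scale_measure (ennreal M) (return borel b)) = sets \<nu>1" by (simp add: s1)
  then obtain \<tau> where \<tau>: "sets \<tau> = sets \<nu>1"
    "\<And>X. X \<in> sets \<nu>1 \<Longrightarrow> emeasure \<tau> X = emeasure \<nu>1 X + emeasure (scale_measure (ennreal M) (return borel b)) X"
    "\<And>f. f \<in> borel_measurable \<nu>1 \<Longrightarrow> (\<integral>\<^sup>+x. f x \<partial>\<tau>) = (\<integral>\<^sup>+x. f x \<partial>\<nu>1) + (\<integral>\<^sup>+x. f x \<partial>scale_measure (ennreal M) (return borel b))"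
    using ex_measure_add[of "scale_measure (ennreal M) (return borel b)" \<nu>1] by blast
  have s\<tau>: "sets \<tau> = sets borel" using \<tau>(1) s1 by simp
  have em\<tau>: "emeasure \<tau> X = emeasure \<nu> (cball x0 (2 * R) \<inter> X) + ennreal M * indicator X b" if "X \<in> sets borel" for X
    using \<tau>(2)[of X] that s1 em1[OF that] by simp
  have pot\<tau>: "pot \<tau> x = pot \<nu>1 x + ennreal M * kern x b" for x
  proof -
    have "kern x \<in> borel_measurable \<nu>1" using s1 by (simp cong: measurable_cong_sets)
    from \<tau>(3)[OF this] have "pot \<tau> x = pot \<nu>1 x + pot (scale_measure (ennreal M) (return borel b)) x"
      by (simp add: potential_def)
    then show ?thesis by (simp add: potential_scale potential_dirac)
  qed
  define \<rho> where "\<rho> = scale_measure (ennreal (1 / real N)) \<tau>"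
  have s\<rho>: "sets \<rho> = sets borel" by (simp add: \<rho>_def s\<tau>)
  have sp\<rho>: "space \<rho> = UNIV" using sets_eq_imp_space_eq[OF s\<rho>] by simp
  have "emeasure \<tau> UNIV = ennreal (real N)"
    using em\<tau>[of UNIV] a M m0 by (simp add: M_def flip: ennreal_plus)
  then have "emeasure \<rho> UNIV = 1" using N by (simp add: \<rho>_def flip: ennreal_mult)
  then have prob: "prob_space \<rho>" by (intro prob_spaceI) (simp only: sp\<rho>)
  have pot\<rho>: "ennreal (real N) * pot \<rho> x = pot \<tau> x" for x
  proof -
    have "ennreal (real N) * pot \<rho> x = (ennreal (real N) * ennreal (1 / real N)) * pot \<tau> x"
      unfolding \<rho>_def potential_scale[OF s\<tau>] by (simp add: mult.assoc)
    also have "ennreal (real N) * ennreal (1 / real N) = 1" using N by (simp flip: ennreal_mult)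
    finally show ?thesis by simp
  qed
  define R' where "R' = nat \<lceil>norm x0 + 2 * R\<rceil>"
  have R': "norm x0 + 2 * R \<le> real R'" unfolding R'_def using R by linarith
  have in_cball: "z \<in> cball 0 (real R')" if "dist x0 z \<le> 2 * R" for z
    using norm_triangle_ineq2[of z x0] that R' by (simp add: dist_norm norm_minus_commute)
  have "emeasure \<tau> (- cball 0 (real R')) = 0"
  proof -
    have "cball x0 (2 * R) \<inter> - cball 0 (real R') = {}" using in_cball by auto
    moreover have "b \<in> cball 0 (real R')" using in_cball b R by simp
    ultimately show ?thesis by (subst em\<tau>) auto
  qed
  then have "emeasure \<rho> (- cball 0 (real R')) = 0" by (simp add: \<rho>_def)
  then have AE: "AE x in \<rho>. x \<in> cball 0 (real R')"
    by (intro AE_I[of _ _ "- cball 0 (real R')"]) (auto simp: s\<rho>)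
  have dom: "kern x y \<le> pot \<tau> x" if x: "kern x y \<le> pot \<nu> x" for x
  proof (cases "dist x x0 \<le> R")
    case True
    \<comment> \<open>The removed mass lies beyond radius 2R, so its points are at least half as far
      from x as from \<open>x0\<close>, and its potential at x is at most
      \<open>ennreal C * T m\<close>.\<close>
    have "pot \<nu> x \<le> (\<integral>\<^sup>+z. indicator (cball x0 (2 * R)) z * kern x z + ennreal C * (kern x0 z * indicator (- cball x0 (2 * R)) z) \<partial>\<nu>)"
      unfolding potential_def
    proof (intro nn_integral_mono)
      fix z
      show "kern x z \<le> indicator (cball x0 (2 * R)) z * kern x z + ennreal C * (kern x0 z * indicator (- cball x0 (2 * R)) z)"
      proof (cases "z \<in> cball x0 (2 * R)")
        case False
        have "dist x0 z \<le> dist x x0 + dist x z" by (metis dist_commute dist_triangle)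
        with False True have "dist x0 z \<le> 2 * dist x z" by simp
        then have "kern x z \<le> ennreal C * kern x0 z" unfolding C_def by (intro kern_scale_mono) auto
        with False show ?thesis by simp
      qed simp
    qed
    also have "\<dots> = pot \<nu>1 x + ennreal C * T m"
      unfolding pot1 T_def R_def by (simp add: nn_integral_add nn_integral_cmult)
    also have "ennreal C * T m \<le> ennreal M * kern x b"
    proof (cases "x = b")
      case True
      then show ?thesis using M m0 by (simp add: riesz_kernel_def ennreal_mult_top)
    next
      case False
      have "dist x b \<le> 2 * R" using dist_triangle[of x b x0] True b by simp
      then have "(2 * R) powr (- p) \<le> dist x b powr (- p)" using False p_pos by (intro powr_mono2') auto
      moreover have "C * t * (2 * R) powr p \<le> M"
        using M(1) zero_le_square[of C] unfolding m0_def by linarith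
      ultimately have "(C * t * (2 * R) powr p) * (2 * R) powr (- p) \<le> M * dist x b powr (- p)"
        using M m0 C t by (intro mult_mono) auto
      moreover have "(2 * R) powr p * (2 * R) powr (- p) = 1" using R by (simp flip: powr_add)
      ultimately have "C * t \<le> M * dist x b powr (- p)" by (simp only: mult.assoc mult_1_right)
      then have "ennreal (C * t) \<le> ennreal (M * dist x b powr (- p))" by (rule ennreal_leI)
      then show ?thesis using C M m0 False by (simp add: t ennreal_mult' kern_off_diagonal)
    qed
    finally show ?thesis using x unfolding pot\<tau> by (meson add_left_mono order_trans)
  next
    case False
    \<comment> \<open>Outside the ball the point mass alone dominates the kernel: as R is at least
      twice |x0 - y|, the distances of x from y, \<open>x0\<close> and \<open>b\<close> are
      comparable.\<close>
    have "dist x x0 \<le> dist x y + dist x0 y" by (metis dist_commute dist_triangle)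
    then have "dist x x0 \<le> 2 * dist x y" using False R by simp
    moreover have "dist x b \<le> dist x x0 + R" using dist_triangle[of x b x0] b by simp
    ultimately have "dist x b \<le> 4 * dist x y" using False by simp
    then have "kern x y \<le> ennreal (C * C) * kern x b" unfolding C4[symmetric] by (intro kern_scale_mono) auto
    also have "\<dots> \<le> ennreal M * kern x b"
    proof (intro mult_right_mono ennreal_leI)
      have "0 \<le> C * t * (2 * R) powr p" using C t by simp
      then show "C * C \<le> M" using M(1) unfolding m0_def by linarith
    qed simp
    finally show ?thesis unfolding pot\<tau> by (simp add: add_increasing)
  qed
  have "pot \<tau> x0 < kern x0 y"
  proof -
    have "pot \<nu>1 x0 \<le> pot \<nu> x0"
      unfolding pot1 unfolding potential_def by (intro nn_integral_mono) (simp split: split_indicator)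
    moreover have "ennreal M * kern x0 b \<le> ennreal (C * C) * T m + ennreal ((C * C + 1) * real m powr (- p))"
    proof -
      have "M * R powr (- p) \<le> (m0 + 1) * R powr (- p)" using M by (intro mult_right_mono) auto
      also have "\<dots> = C * t * (2 * R) powr p * R powr (- p) + (C * C + 1) * R powr (- p)"
        by (simp add: m0_def algebra_simps)
      also have "C * t * (2 * R) powr p * R powr (- p) = C * C * t"
      proof -
        have "(2 * R) powr p * R powr (- p) = C * (R powr p * R powr (- p))"
          using R by (simp add: C_def powr_mult)
        also have "R powr p * R powr (- p) = 1" using R by (simp flip: powr_add)
        finally show ?thesis by simp
      qed
      finally have "ennreal (M * R powr (- p)) \<le> ennreal (C * C * t + (C * C + 1) * R powr (- p))" by (rule ennreal_leI)
      then show ?thesis using C M m0 t b \<open>x0 \<noteq> b\<close> by (simp add: kern_off_diagonal ennreal_mult' ennreal_plus R_def)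
    qed
    ultimately have "pot \<tau> x0 \<le> pot \<nu> x0 + (ennreal (C * C) * T m + ennreal ((C * C + 1) * real m powr (- p)))"
      unfolding pot\<tau> by (rule add_mono)
    then show ?thesis using m by (rule le_less_trans)
  qed
  moreover have "nearly_everywhere \<alpha> A (\<lambda>x. kern x y \<le> pot \<tau> x)"
    using ne by (rule nearly_everywhere_mono) (rule dom)
  ultimately show ?thesis
    using that[of N \<rho> R'] N prob s\<rho> AE unfolding pot\<rho> by blast
qed

text \<open>The gap 1/(m+1) replaces the strict inequality, so that a limit of such points still has
  a strict one.\<close>

definition irregular_piece :: "'a set \<Rightarrow> nat \<Rightarrow> nat \<Rightarrow> nat \<Rightarrow> nat \<Rightarrow> 'a \<Rightarrow> 'a set" where
  "irregular_piece A N R k m q = {y. \<exists>\<rho>. prob_space \<rho> \<and> sets \<rho> = sets borel \<and> (AE x in \<rho>. x \<in> cball 0 (real R)) \<and>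
     nearly_everywhere \<alpha> A (\<lambda>x. kern x y \<le> ennreal (real N) * pot \<rho> x) \<and>
     real N * (\<integral>z. avg k (z - q) \<partial>\<rho>) + 1 / real (Suc m) \<le> avg k (y - q)}"

lemma irregular_at_in_piece:
  assumes D: "\<And>X :: 'a set. open X \<Longrightarrow> X \<noteq> {} \<Longrightarrow> \<exists>d\<in>D. d \<in> X" and y: "irregular_at A y"
  shows "\<exists>N R k m. \<exists>q\<in>D. y \<in> irregular_piece A N R k m q"
proof -
  obtain \<nu> x where \<nu>: "\<nu> \<in> Mplus \<alpha>" "nearly_everywhere \<alpha> A (\<lambda>x. kern x y \<le> pot \<nu> x)" "pot \<nu> x < kern x y"
    using y unfolding irregular_at_def by blast
  obtain N R :: nat and \<rho> where N: "0 < N" and \<rho>: "prob_space \<rho>" "sets \<rho> = sets borel"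
    and supp: "AE x in \<rho>. x \<in> cball 0 (real R)"
    and ne: "nearly_everywhere \<alpha> A (\<lambda>x. kern x y \<le> ennreal (real N) * pot \<rho> x)"
    and less: "ennreal (real N) * pot \<rho> x < kern x y"
    by (rule irregular_witness_compact[OF \<nu>])
  have fin: "finite_measure \<rho>" using \<rho>(1) by (rule prob_space.finite_measure)
  obtain k where k: "real N * (\<integral>z. avg k (z - x) \<partial>\<rho>) < avg k (y - x)"
    using less_imp_average_less[OF fin \<rho>(2) _ less] N by auto
  have "open {q. real N * (\<integral>z. avg k (z - q) \<partial>\<rho>) < avg k (y - q)}"
    by (intro open_Collect_less continuous_intros continuous_avg_integral[OF fin \<rho>(2)]
        continuous_on_compose2[OF avg_properties(1)]) auto
  then obtain q where q: "q \<in> D" "real N * (\<integral>z. avg k (z - q) \<partial>\<rho>) < avg k (y - q)"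
    using D[of "{q. real N * (\<integral>z. avg k (z - q) \<partial>\<rho>) < avg k (y - q)}"] k by blast
  then have "0 < avg k (y - q) - real N * (\<integral>z. avg k (z - q) \<partial>\<rho>)" by simp
  then obtain m where "1 / real (Suc m) < avg k (y - q) - real N * (\<integral>z. avg k (z - q) \<partial>\<rho>)"
    by (rule nat_approx_posE)
  then have "real N * (\<integral>z. avg k (z - q) \<partial>\<rho>) + 1 / real (Suc m) \<le> avg k (y - q)" by simp
  then have "y \<in> irregular_piece A N R k m q"
    unfolding irregular_piece_def using \<rho> supp ne by blast
  then show ?thesis using q(1) by blast
qed

text \<open>It is enough that limits of a piece are irregular, whether or not they belong to the
  piece: the union of the closures is then still the set of irregular points.\<close>

lemma closure_irregular_piece:
  assumes "y \<in> closure (irregular_piece A N R k m q)"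
  shows "irregular_at A y"
proof -
  obtain Y where Y: "\<And>j. Y j \<in> irregular_piece A N R k m q" and Ylim: "Y \<longlonglongrightarrow> y"
    using assms unfolding closure_sequential by blast
  have "\<forall>j. \<exists>\<rho>. prob_space \<rho> \<and> sets \<rho> = sets borel \<and> (AE x in \<rho>. x \<in> cball 0 (real R)) \<and>
     nearly_everywhere \<alpha> A (\<lambda>x. kern x (Y j) \<le> ennreal (real N) * pot \<rho> x) \<and>
     real N * (\<integral>z. avg k (z - q) \<partial>\<rho>) + 1 / real (Suc m) \<le> avg k (Y j - q)"
    using Y unfolding irregular_piece_def by blast
  from choice[OF this] obtain \<rho>' where all: "\<forall>j. prob_space (\<rho>' j) \<and> sets (\<rho>' j) = sets borel \<and>
     (AE x in \<rho>' j. x \<in> cball 0 (real R)) \<and>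
     nearly_everywhere \<alpha> A (\<lambda>x. kern x (Y j) \<le> ennreal (real N) * pot (\<rho>' j) x) \<and>
     real N * (\<integral>z. avg k (z - q) \<partial>\<rho>' j) + 1 / real (Suc m) \<le> avg k (Y j - q)"
    by (elim exE)
  have \<rho>': "\<And>j. prob_space (\<rho>' j)" "\<And>j. sets (\<rho>' j) = sets borel" "\<And>j. AE x in \<rho>' j. x \<in> cball 0 (real R)"
    and ne': "\<And>j. nearly_everywhere \<alpha> A (\<lambda>x. kern x (Y j) \<le> ennreal (real N) * pot (\<rho>' j) x)"
    and avg': "\<And>j. real N * (\<integral>z. avg k (z - q) \<partial>\<rho>' j) + 1 / real (Suc m) \<le> avg k (Y j - q)"
    using all by blast+
  have "\<exists>(r :: nat \<Rightarrow> nat) \<rho>. strict_mono r \<and> prob_space \<rho> \<and> sets \<rho> = sets borel \<and>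
     (\<forall>f :: 'a \<Rightarrow> real. continuous_on UNIV f \<longrightarrow> bounded (range f) \<longrightarrow>
       (\<lambda>j. \<integral>x. f x \<partial>\<rho>' (r j)) \<longlonglongrightarrow> (\<integral>x. f x \<partial>\<rho>))"
    by (rule prob_weakly_compact_cball[of \<rho>' "real R", OF \<rho>']) blast
  then obtain r :: "nat \<Rightarrow> nat" and \<rho> where r: "strict_mono r" and \<rho>: "prob_space \<rho>" "sets \<rho> = sets borel"
    and conv: "\<And>f :: 'a \<Rightarrow> real. continuous_on UNIV f \<Longrightarrow> bounded (range f) \<Longrightarrow>
       (\<lambda>j. \<integral>x. f x \<partial>\<rho>' (r j)) \<longlonglongrightarrow> (\<integral>x. f x \<partial>\<rho>)"
    by blast
  have Yr: "(\<lambda>j. Y (r j)) \<longlonglongrightarrow> y" using LIMSEQ_subseq_LIMSEQ[OF Ylim r] by (simp add: comp_def)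
  have fin: "finite_measure M" if "prob_space M" for M :: "'a measure" using that by (rule prob_space.finite_measure)
  have meas: "{x. kern x c \<le> ennreal (real N) * pot M x} \<in> sets borel"
    if "prob_space M" "sets M = sets borel" for c and M :: "'a measure"
  proof -
    have [measurable]: "pot M \<in> borel_measurable borel"
      using that fin by (intro radon_potential_measurable radon_finite_measure) auto
    show ?thesis by measurable
  qed
  have ne: "nearly_everywhere \<alpha> A (\<lambda>x. kern x y \<le> ennreal (real N) * pot \<rho> x)"
    unfolding nearly_everywhere_iff_AE[OF meas[OF \<rho>]]
  proof
    fix \<mu> assume \<mu>: "\<mu> \<in> finite_energy_on \<alpha> A"
    then have rm: "radon_measure \<mu>" "energy \<alpha> \<mu> < \<infinity>" by (auto simp: finite_energy_on_def)
    show "AE x in \<mu>. kern x y \<le> ennreal (real N) * pot \<rho> x"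
    proof (rule weak_limit_dominates_AE[OF rm _ _ \<rho> conv Yr])
      show "AE x in \<mu>. kern x (Y (r j)) \<le> ennreal (real N) * pot (\<rho>' (r j)) x" for j
        using ne'[of "r j"] \<mu> unfolding nearly_everywhere_iff_AE[OF meas[OF \<rho>'(1,2)]] by blast
    qed (use \<rho>' in auto)
  qed
  have cont: "continuous_on UNIV (\<lambda>z. avg k (z - q))"
    by (intro continuous_on_compose2[OF avg_properties(1)] continuous_intros) auto
  have "bounded (range (\<lambda>z. avg k (z - q)))"
    by (rule bounded_subset[OF avg_properties(2)[of k]]) auto
  note lim1 = conv[OF cont this]
  have lim2: "(\<lambda>j. avg k (Y (r j) - q)) \<longlonglongrightarrow> avg k (y - q)"
    using continuous_on_tendsto_compose[OF cont Yr] by simp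
  have "real N * (\<integral>z. avg k (z - q) \<partial>\<rho>) + 1 / real (Suc m) \<le> avg k (y - q)"
    by (rule LIMSEQ_le[OF tendsto_add[OF tendsto_mult[OF tendsto_const lim1] tendsto_const] lim2])
      (use avg' in blast)
  moreover have "0 < 1 / real (Suc m)" by simp
  ultimately have "real N * (\<integral>z. avg k (z - q) \<partial>\<rho>) < avg k (y - q)" by linarith
  from average_less_imp_less[OF fin[OF \<rho>(1)] \<rho>(2) _ this]
  obtain x where x: "ennreal (real N) * pot \<rho> x < kern x y" by auto
  define \<nu> where "\<nu> = scale_measure (ennreal (real N)) \<rho>"
  have pot\<nu>: "pot \<nu> z = ennreal (real N) * pot \<rho> z" for z
    unfolding \<nu>_def by (rule potential_scale[OF \<rho>(2)])
  have "finite_measure \<nu>"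
  proof
    interpret prob_space \<rho> by (rule \<rho>)
    show "emeasure \<nu> (space \<nu>) \<noteq> \<infinity>" by (simp add: \<nu>_def emeasure_space_1 space_scale_measure)
  qed
  then have "radon_measure \<nu>" by (rule radon_finite_measure) (simp add: \<nu>_def \<rho>)
  moreover have "pot \<nu> x \<noteq> \<infinity>" using less_le_trans[OF x top_greatest] unfolding pot\<nu> by (simp add: less_top)
  ultimately have "\<nu> \<in> Mplus \<alpha>" unfolding Mplus_def by blast
  then show ?thesis unfolding irregular_at_def using ne x unfolding pot\<nu>[symmetric] by blast
qed

theorem irregular_points_borel: "{y. irregular_at A y} \<in> sets borel"
proof -
  obtain D :: "'a set" where D: "countable D" "\<And>X :: 'a set. open X \<Longrightarrow> X \<noteq> {} \<Longrightarrow> \<exists>d\<in>D. d \<in> X"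
    using countable_dense_setE by blast
  have "{y. irregular_at A y} = (\<Union>N. \<Union>R. \<Union>k. \<Union>m. \<Union>q\<in>D. closure (irregular_piece A N R k m q))"
  proof (intro equalityI subsetI)
    fix y assume "y \<in> {y. irregular_at A y}"
    then have y: "irregular_at A y" by simp
    have "\<exists>N R k m. \<exists>q\<in>D. y \<in> irregular_piece A N R k m q"
      by (rule irregular_at_in_piece[OF _ y]) (rule D(2))
    then obtain N R k m q where q: "q \<in> D" "y \<in> irregular_piece A N R k m q" by (elim exE bexE)
    from q(2) have "y \<in> closure (irregular_piece A N R k m q)" by (rule subsetD[OF closure_subset])
    with q(1) show "y \<in> (\<Union>N. \<Union>R. \<Union>k. \<Union>m. \<Union>q\<in>D. closure (irregular_piece A N R k m q))"
      by (intro UN_I[where a=N] UN_I[where a=R] UN_I[where a=k] UN_I[where a=m] UN_I[where a=q] UNIV_I)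
  next
    fix y assume "y \<in> (\<Union>N. \<Union>R. \<Union>k. \<Union>m. \<Union>q\<in>D. closure (irregular_piece A N R k m q))"
    then obtain N R k m q where "y \<in> closure (irregular_piece A N R k m q)" by (elim UN_E)
    then show "y \<in> {y. irregular_at A y}" by (intro CollectI closure_irregular_piece)
  qed
  also have "\<dots> \<in> sets borel"
    using D(1) by (intro sets.countable_UN' sets.countable_UN image_subsetI borel_closed closed_closure) auto
  finally show ?thesis .
qed

end

subsection \<open>Balayage of Dirac measures\<close>

context riesz_exponent
begin

text \<open>Tested at a point x at distance n from y: the ball of radius n about y lies within
  distance 2n of x, so its mass times \<open>kern x y\<close> is at most 2^p times
  \<open>pot \<nu> x\<close>, hence at most 2^p times \<open>kern x y\<close>. The resulting bound
  2^p on the mass is independent of n.\<close>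

lemma finite_measure_if_potential_le_kern:
  fixes \<nu> :: "'a measure"
  assumes radon: "radon_measure \<nu>" and le: "\<And>x. pot \<nu> x \<le> kern x y"
  shows "finite_measure \<nu>"
proof
  have sets: "sets \<nu> = sets borel" using radon by (simp add: radon_measure_def)
  note [measurable_cong] = sets
  have sp: "space \<nu> = UNIV" using sets_eq_imp_space_eq[OF sets] by simp
  obtain e :: 'a where e: "e \<in> Basis" using nonempty_Basis by blast
  have bound: "emeasure \<nu> (cball y (real n)) \<le> ennreal (2 powr p)" if n: "0 < n" for n :: nat
  proof -
    define x where "x = y + real n *\<^sub>R e"
    have d: "dist x y = real n" using e by (simp add: x_def dist_norm)
    then have "x \<noteq> y" using n by auto
    have [measurable]: "cball y (real n) \<in> sets borel" by simp
    have "kern x y * emeasure \<nu> (cball y (real n)) = (\<integral>\<^sup>+z. kern x y * indicator (cball y (real n)) z \<partial>\<nu>)"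
      using sets by (subst nn_integral_cmult_indicator) auto
    also have "\<dots> \<le> (\<integral>\<^sup>+z. ennreal (2 powr p) * kern x z \<partial>\<nu>)"
    proof (intro nn_integral_mono)
      fix z
      show "kern x y * indicator (cball y (real n)) z \<le> ennreal (2 powr p) * kern x z"
      proof (cases "z \<in> cball y (real n)")
        case True
        then have "dist x z \<le> 2 * dist x y" using dist_triangle[of x z y] d by simp
        then have "kern x y \<le> ennreal (2 powr p) * kern x z" by (intro kern_scale_mono) auto
        with True show ?thesis by simp
      qed simp
    qed
    also have "\<dots> = ennreal (2 powr p) * pot \<nu> x" unfolding potential_def by (rule nn_integral_cmult) measurable
    also have "\<dots> \<le> ennreal (2 powr p) * kern x y" by (intro mult_left_mono le) simp
    finally have "kern x y * emeasure \<nu> (cball y (real n)) \<le> kern x y * ennreal (2 powr p)" by (simp add: mult.commute)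
    moreover have "0 < kern x y" "kern x y < \<infinity>" using \<open>x \<noteq> y\<close> by (simp_all add: kern_off_diagonal)
    ultimately show ?thesis by (subst (asm) ennreal_mult_le_mult_iff) auto
  qed
  have "(\<Union>n. cball y (real n)) = UNIV" by (auto simp: real_arch_simple)
  moreover have "(SUP n. emeasure \<nu> (cball y (real n))) = emeasure \<nu> (\<Union>n. cball y (real n))"
  proof (rule SUP_emeasure_incseq)
    show "range (\<lambda>n. cball y (real n)) \<subseteq> sets \<nu>" unfolding sets by (intro image_subsetI borel_closed closed_cball)
    show "incseq (\<lambda>n. cball y (real n))" by (auto simp: incseq_def)
  qed
  moreover have "(SUP n. emeasure \<nu> (cball y (real n))) \<le> ennreal (2 powr p)"
  proof (rule SUP_least)
    fix n :: nat
    \<comment> \<open>For n = 0 the test point would be y itself, where the kernel is infinite, so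
      the bound is taken at \<open>Suc n\<close>.\<close>
    have "cball y (real n) \<subseteq> cball y (real (Suc n))" by (rule subset_cball) simp
    then have "emeasure \<nu> (cball y (real n)) \<le> emeasure \<nu> (cball y (real (Suc n)))"
      by (intro emeasure_mono) (simp_all add: sets)
    also have "\<dots> \<le> ennreal (2 powr p)" by (rule bound) simp
    finally show "emeasure \<nu> (cball y (real n)) \<le> ennreal (2 powr p)" .
  qed
  ultimately have "emeasure \<nu> (space \<nu>) \<le> ennreal (2 powr p)" by (simp add: sp)
  then show "emeasure \<nu> (space \<nu>) \<noteq> \<infinity>" by (auto simp: top_unique)
qed

lemma return_in_Mplus: "return borel (y::'a) \<in> Mplus \<alpha>"
proof -
  obtain e :: 'a where e: "e \<in> Basis" using nonempty_Basis by blast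
  then have "y + e \<noteq> y" by auto
  then have "pot (return borel y) (y + e) \<noteq> \<infinity>" by (simp add: potential_dirac kern_off_diagonal)
  moreover have "prob_space (return borel y)" by (rule prob_space_return) simp
  then have "radon_measure (return borel y)"
    by (intro radon_finite_measure prob_space.finite_measure) simp_all
  ultimately show ?thesis unfolding Mplus_def by blast
qed

definition swept :: "'a set \<Rightarrow> 'a \<Rightarrow> 'a measure \<Rightarrow> bool" where
  "swept A y \<nu> \<longleftrightarrow> \<nu> \<in> Mplus \<alpha> \<and> (\<forall>x. pot \<nu> x = (INF \<nu>' \<in> {\<nu>' \<in> Mplus \<alpha>.
     nearly_everywhere \<alpha> A (\<lambda>z. pot (return borel y) z \<le> pot \<nu>' z)}. pot \<nu>' x))"

lemma balayage_return: "balayage \<alpha> (return borel y) A = (THE \<nu>. swept A y \<nu>)"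
  unfolding balayage_def swept_def ..

text \<open>The Dirac measure competes in its own infimum, so swept potentials lie below the kernel
  with pole y. Swept measures are therefore finite and determined by their potentials.\<close>

lemma swept_unique:
  assumes "swept A y \<mu>" "swept A y \<nu>"
  shows "\<mu> = \<nu>"
proof -
  have mem: "return borel y \<in> {\<nu>' \<in> Mplus \<alpha>. nearly_everywhere \<alpha> A (\<lambda>z. pot (return borel y) z \<le> pot \<nu>' z)}"
  proof -
    have "nearly_everywhere \<alpha> A (\<lambda>z. pot (return borel y) z \<le> pot (return borel y) z)"
      by (subst nearly_everywhere_iff_AE) auto
    then show ?thesis using return_in_Mplus by blast
  qed
  have "pot \<tau> x \<le> kern x y" if "swept A y \<tau>" for \<tau> x
    using that INF_lower[OF mem, of "\<lambda>\<nu>'. pot \<nu>' x"] unfolding swept_def potential_dirac by simp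
  then have fin: "finite_measure \<tau> \<and> sets \<tau> = sets borel" if "swept A y \<tau>" for \<tau>
    using that finite_measure_if_potential_le_kern[of \<tau> y]
    unfolding swept_def Mplus_def radon_measure_def by blast
  show ?thesis
    by (rule potential_unique) (use fin assms in \<open>auto simp: swept_def\<close>)
qed

lemma swept_return_iff: "swept A y (return borel y) \<longleftrightarrow> \<not> irregular_at A y"
proof -
  let ?S = "{\<nu>' \<in> Mplus \<alpha>. nearly_everywhere \<alpha> A (\<lambda>z. kern z y \<le> pot \<nu>' z)}"
  have mem: "return borel y \<in> ?S"
  proof -
    have "nearly_everywhere \<alpha> A (\<lambda>z. kern z y \<le> pot (return borel y) z)"
      unfolding potential_dirac by (subst nearly_everywhere_iff_AE) auto
    then show ?thesis using return_in_Mplus by blast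
  qed
  have "swept A y (return borel y) \<longleftrightarrow> (\<forall>x. kern x y = (INF \<nu>' \<in> ?S. pot \<nu>' x))"
    unfolding swept_def potential_dirac using return_in_Mplus by simp
  also have "\<dots> \<longleftrightarrow> (\<forall>x. kern x y \<le> (INF \<nu>' \<in> ?S. pot \<nu>' x))"
  proof -
    have "(INF \<nu>' \<in> ?S. pot \<nu>' x) \<le> kern x y" for x
      using INF_lower[OF mem, of "\<lambda>\<nu>'. pot \<nu>' x"] unfolding potential_dirac .
    then show ?thesis by (simp add: eq_iff)
  qed
  also have "\<dots> \<longleftrightarrow> \<not> irregular_at A y"
    unfolding irregular_at_def le_INF_iff by (auto simp: not_less)
  finally show ?thesis .
qed

theorem regular_points_borel: "regular_points \<alpha> A \<in> sets (borel :: 'a measure)"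
proof -
  \<comment> \<open>The discrepancy between regularity and absence of irregularity. It is shown to
    be harmless without appeal to the existence of a swept measure.\<close>
  define Z where "Z = {y \<in> regular_points \<alpha> A. irregular_at A y}"
  have reg: "y \<in> regular_points \<alpha> A" if "\<not> irregular_at A y" for y
  proof -
    have sw: "swept A y (return borel y)" using that by (simp add: swept_return_iff)
    then have "(THE \<nu>. swept A y \<nu>) = return borel y"
      by (rule the_equality) (rule swept_unique[OF _ sw])
    then show ?thesis by (simp add: regular_points_def balayage_return)
  qed
  text \<open>At an irregular point without a swept measure the definite description takes a default
    value, which does not depend on the point and hence is the Dirac measure of at most one point.\<close>
  have Z: "return borel y = (THE \<nu> :: 'a measure. False)" if "y \<in> Z" for y
  proof -
    have y: "irregular_at A y" "(THE \<nu>. swept A y \<nu>) = return borel y"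
      using that by (auto simp: Z_def regular_points_def balayage_return)
    have "\<not> swept A y \<nu>" for \<nu>
    proof
      assume \<nu>: "swept A y \<nu>"
      then have "(THE \<nu>. swept A y \<nu>) = \<nu>" by (rule the_equality) (rule swept_unique[OF _ \<nu>])
      with y \<nu> show False by (simp add: swept_return_iff)
    qed
    then have "swept A y = (\<lambda>_. False)" by blast
    with y show ?thesis by simp
  qed
  have "y = y'" if "y \<in> Z" "y' \<in> Z" for y y'
  proof -
    have "return borel y = (return borel y' :: 'a measure)" using Z that by metis
    then have "emeasure (return borel y) {y} = emeasure (return borel y' :: 'a measure) {y}" by simp
    then show ?thesis by (simp split: split_indicator_asm)
  qed
  then have "finite Z" by (metis finite.emptyI finite_insert finite_subset subsetI singleton_iff empty_iff insertI1)
  then have "Z \<in> sets borel" by (simp add: finite_imp_closed borel_closed)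
  moreover have "regular_points \<alpha> A = - {y. irregular_at A y} \<union> Z"
    using reg by (auto simp: Z_def)
  ultimately show ?thesis using irregular_points_borel[of A] by auto
qed

end

theorem mainTheorem13:
  fixes \<alpha> :: real and A :: "'a::euclidean_space set"
  assumes "DIM('a) \<ge> 3" and "0 < \<alpha>" and "\<alpha> \<le> 2"
  shows "regular_points \<alpha> A \<in> sets (borel :: 'a measure)"
proof -
  interpret riesz_exponent \<alpha> "real DIM('a) - \<alpha>" "TYPE('a)"
    by unfold_locales (use assms in auto)
  show ?thesis by (rule regular_points_borel)
qed

end
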